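(* The problem $3$-Swap-Promise is $\mathsf{NP}$-hard when restricted to the class of planar graphs. Moreover, the same is true even when every swap must be between adjacent vertices.
   Context: All graphs are finite, simple and undirected. An $r$-coloring of a graph $G$ is any map $c:V(G)\to[r]$ (not necessarily proper); it is proper if adjacent vertices receive distinct colors; $\chi(G)$ is the chromatic number. A swap between two distinct vertices $u,v$ assigns to $u$ the color of $v$ and to $v$ the color of $u$. A coloring $c$ is a permutation of a coloring $c_0$ if $c$ can be obtained from $c_0$ by finitely many swaps. $r$-Swap-Promise (for fixed $r$) is the promise problem: input a graph $G$, an $r$-coloring $c$ of $G$ and a positive integer $k$, with the promise that $\chi(G)=r$ and $c$ is a permutation of some optimal proper vertex-coloring of $G$; decide whether $c$ can be turned into a proper $r$-coloring of $G$ using at most $k$ swaps. (An algorithm solves a promise problem if it answers correctly on all inputs satisfying the promise; on other inputs it may answer arbitrarily.) *)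

theory Defs
  imports "HOL-Analysis.Analysis" "HOL-Computational_Algebra.Polynomial"
begin

section \<open>Polynomial-time computation and NP\<close>

text \<open>
  Deterministic multi-tape Turing machines with two-way infinite tapes.  States and tape symbols
  are initial segments of the naturals: the working states are those below \<open>num_states\<close>, the
  initial state is \<open>0\<close>, and \<open>num_states\<close> itself is the halting state.  Symbol \<open>0\<close> is the blank,
  symbols \<open>1\<close> and \<open>2\<close> are the bits.
\<close>

datatype move = Move_Left | Stay | Move_Right

record tm =
  num_tapes :: nat
  num_states :: nat
  num_symbols :: nat
  delta :: "nat \<Rightarrow> nat list \<Rightarrow> nat \<times> (nat \<times> move) list"

definition wf_tm :: "tm \<Rightarrow> bool" where
  "wf_tm M \<longleftrightarrow> num_tapes M \<ge> 1 \<and> num_symbols M \<ge> 3 \<and>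
     (\<forall>q ss q' as. q < num_states M \<and> length ss = num_tapes M \<and> set ss \<subseteq> {..<num_symbols M} \<and>
        delta M q ss = (q', as) \<longrightarrow>
        q' \<le> num_states M \<and> length as = num_tapes M \<and> fst ` set as \<subseteq> {..<num_symbols M})"

type_synonym tape = "(int \<Rightarrow> nat) \<times> int"

type_synonym tm_config = "nat \<times> tape list"

fun read_tape :: "tape \<Rightarrow> nat" where
  "read_tape (t, h) = t h"

fun move_offset :: "move \<Rightarrow> int" where
  "move_offset Move_Left = -1"
| "move_offset Stay = 0"
| "move_offset Move_Right = 1"

fun act_tape :: "nat \<times> move \<Rightarrow> tape \<Rightarrow> tape" where
  "act_tape (s, m) (t, h) = (t(h := s), h + move_offset m)"

fun tm_step :: "tm \<Rightarrow> tm_config \<Rightarrow> tm_config" where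
  "tm_step M (q, ts) =
     (if q < num_states M
      then let (q', as) = delta M q (map read_tape ts) in (q', map2 act_tape as ts)
      else (q, ts))"

definition bit_symbol :: "bool \<Rightarrow> nat" where
  "bit_symbol b = (if b then 2 else 1)"

definition input_tape :: "bool list \<Rightarrow> tape" where
  "input_tape x =
     (\<lambda>i. if 0 \<le> i \<and> i < int (length x) then bit_symbol (x ! nat i) else 0, 0)"

text \<open>The input strings are written on the first tapes; the remaining tapes are blank.\<close>

definition tm_init :: "tm \<Rightarrow> bool list list \<Rightarrow> tm_config" where
  "tm_init M xs =
     (0, map (\<lambda>i. input_tape (if i < length xs then xs ! i else [])) [0..<num_tapes M])"

text \<open>The output is read off the first tape, from cell \<open>0\<close> up to the first blank.\<close>

definition tape_output :: "tape \<Rightarrow> bool list \<Rightarrow> bool" where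
  "tape_output tp y \<longleftrightarrow>
     (\<forall>i < length y. fst tp (int i) = bit_symbol (y ! i)) \<and> fst tp (int (length y)) = 0"

text \<open>Halting configurations are fixed points of \<^const>\<open>tm_step\<close>, so this says that the machine
  halts after at most \<open>T\<close> steps with output \<open>y\<close>.\<close>

definition tm_outputs_within :: "tm \<Rightarrow> bool list list \<Rightarrow> nat \<Rightarrow> bool list \<Rightarrow> bool" where
  "tm_outputs_within M xs T y \<longleftrightarrow>
     (\<exists>ts. (tm_step M ^^ T) (tm_init M xs) = (num_states M, ts) \<and> tape_output (hd ts) y)"

text \<open>\<open>f\<close> is a function of \<open>m\<close> bit strings, given as a list of length \<open>m\<close>.\<close>

definition poly_time :: "nat \<Rightarrow> (bool list list \<Rightarrow> bool list) \<Rightarrow> bool" where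
  "poly_time m f \<longleftrightarrow>
     (\<exists>M (p :: nat poly). wf_tm M \<and> m \<le> num_tapes M \<and>
        (\<forall>xs. length xs = m \<longrightarrow>
           tm_outputs_within M xs (poly p (\<Sum>x\<leftarrow>xs. length x)) (f xs)))"

definition NP :: "bool list set set" where
  "NP = {L. \<exists>R (q :: nat poly). poly_time 2 (\<lambda>xs. [R (xs ! 0) (xs ! 1)]) \<and>
          (\<forall>x. x \<in> L \<longleftrightarrow> (\<exists>w. length w \<le> poly q (length x) \<and> R x w))}"

text \<open>A promise problem is the pair of its yes-instances and its no-instances; the strings in
  neither set violate the promise.\<close>

type_synonym promise_problem = "bool list set \<times> bool list set"

definition NP_hard :: "promise_problem \<Rightarrow> bool" where
  "NP_hard P \<longleftrightarrow>
     (\<forall>L \<in> NP. \<exists>f. poly_time 1 (\<lambda>xs. f (xs ! 0)) \<and>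
        (\<forall>x. x \<in> L \<longrightarrow> f x \<in> fst P) \<and> (\<forall>x. x \<notin> L \<longrightarrow> f x \<in> snd P))"

section \<open>Graphs, colorings and swaps\<close>

definition simple_graph :: "'a set \<Rightarrow> 'a set set \<Rightarrow> bool" where
  "simple_graph V E \<longleftrightarrow> finite V \<and> (\<forall>e\<in>E. e \<subseteq> V \<and> card e = 2)"

text \<open>Existence of a drawing in the plane: vertices are distinct points, edges are arcs that
  join their end vertices and meet vertices and other edges only in common end vertices.\<close>

definition planar :: "'a set \<Rightarrow> 'a set set \<Rightarrow> bool" where
  "planar V E \<longleftrightarrow>
     (\<exists>(p :: 'a \<Rightarrow> complex) (\<gamma> :: 'a set \<Rightarrow> real \<Rightarrow> complex).
        inj_on p V \<and>
        (\<forall>e\<in>E. arc (\<gamma> e) \<and> {pathstart (\<gamma> e), pathfinish (\<gamma> e)} = p ` e \<and>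
                path_image (\<gamma> e) \<inter> p ` V = p ` e) \<and>
        (\<forall>e\<in>E. \<forall>f\<in>E. e \<noteq> f \<longrightarrow> path_image (\<gamma> e) \<inter> path_image (\<gamma> f) = p ` (e \<inter> f)))"

definition coloring :: "'a set \<Rightarrow> nat \<Rightarrow> ('a \<Rightarrow> nat) \<Rightarrow> bool" where
  "coloring V r c \<longleftrightarrow> (\<forall>v\<in>V. c v \<in> {1..r})"

definition proper_coloring :: "'a set \<Rightarrow> 'a set set \<Rightarrow> nat \<Rightarrow> ('a \<Rightarrow> nat) \<Rightarrow> bool" where
  "proper_coloring V E r c \<longleftrightarrow>
     coloring V r c \<and> (\<forall>u\<in>V. \<forall>v\<in>V. {u, v} \<in> E \<longrightarrow> c u \<noteq> c v)"

definition chromatic_number :: "'a set \<Rightarrow> 'a set set \<Rightarrow> nat" where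
  "chromatic_number V E = (LEAST r. \<exists>c. proper_coloring V E r c)"

definition optimal_coloring :: "'a set \<Rightarrow> 'a set set \<Rightarrow> ('a \<Rightarrow> nat) \<Rightarrow> bool" where
  "optimal_coloring V E c \<longleftrightarrow> proper_coloring V E (chromatic_number V E) c"

definition swap :: "'a set \<Rightarrow> 'a set set \<Rightarrow> ('a \<Rightarrow> nat) \<Rightarrow> ('a \<Rightarrow> nat) \<Rightarrow> bool" where
  "swap V E c c' \<longleftrightarrow> (\<exists>u\<in>V. \<exists>v\<in>V. u \<noteq> v \<and> c' = c(u := c v, v := c u))"

definition adjacent_swap :: "'a set \<Rightarrow> 'a set set \<Rightarrow> ('a \<Rightarrow> nat) \<Rightarrow> ('a \<Rightarrow> nat) \<Rightarrow> bool" where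
  "adjacent_swap V E c c' \<longleftrightarrow>
     (\<exists>u\<in>V. \<exists>v\<in>V. u \<noteq> v \<and> {u, v} \<in> E \<and> c' = c(u := c v, v := c u))"

definition permutation_of :: "'a set \<Rightarrow> 'a set set \<Rightarrow> ('a \<Rightarrow> nat) \<Rightarrow> ('a \<Rightarrow> nat) \<Rightarrow> bool" where
  "permutation_of V E c c0 \<longleftrightarrow> (swap V E)\<^sup>*\<^sup>* c0 c"

section \<open>The promise problem\<close>

text \<open>Binary digits, least significant first.\<close>

fun bin_digits :: "nat \<Rightarrow> bool list" where
  "bin_digits n = (if n = 0 then [] else odd n # bin_digits (n div 2))"

declare bin_digits.simps [simp del]

text \<open>Self-delimiting: every digit is preceded by \<open>True\<close>, and \<open>False\<close> ends the code word.\<close>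

definition encode_nat :: "nat \<Rightarrow> bool list" where
  "encode_nat n = concat (map (\<lambda>b. [True, b]) (bin_digits n)) @ [False]"

text \<open>A graph on the vertices \<open>0, \<dots>, n - 1\<close> is encoded by \<open>n\<close> and its adjacency matrix.\<close>

definition encode_instance :: "nat \<Rightarrow> nat set set \<Rightarrow> (nat \<Rightarrow> nat) \<Rightarrow> nat \<Rightarrow> bool list" where
  "encode_instance n E c k =
     encode_nat n @
     concat (map (\<lambda>i. map (\<lambda>j. {i, j} \<in> E) [0..<n]) [0..<n]) @
     concat (map (\<lambda>i. encode_nat (c i)) [0..<n]) @
     encode_nat k"

definition swap_promise ::
  "nat \<Rightarrow> 'a set \<Rightarrow> 'a set set \<Rightarrow> ('a \<Rightarrow> nat) \<Rightarrow> nat \<Rightarrow> bool" where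
  "swap_promise r V E c k \<longleftrightarrow>
     simple_graph V E \<and> coloring V r c \<and> k > 0 \<and> chromatic_number V E = r \<and>
     (\<exists>c0. optimal_coloring V E c0 \<and> permutation_of V E c c0)"

definition solvable_within ::
  "('a set \<Rightarrow> 'a set set \<Rightarrow> ('a \<Rightarrow> nat) \<Rightarrow> ('a \<Rightarrow> nat) \<Rightarrow> bool) \<Rightarrow>
   nat \<Rightarrow> 'a set \<Rightarrow> 'a set set \<Rightarrow> ('a \<Rightarrow> nat) \<Rightarrow> nat \<Rightarrow> bool" where
  "solvable_within step r V E c k \<longleftrightarrow>
     (\<exists>j\<le>k. \<exists>c'. (step V E ^^ j) c c' \<and> proper_coloring V E r c')"

text \<open>\<open>r\<close>-Swap-Promise restricted to the graphs in \<open>cls\<close>; \<open>step\<close> is the kind of swap that may be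
  used to reach a proper coloring (the promise always refers to arbitrary swaps).\<close>

definition Swap_Promise ::
  "(nat set \<Rightarrow> nat set set \<Rightarrow> (nat \<Rightarrow> nat) \<Rightarrow> (nat \<Rightarrow> nat) \<Rightarrow> bool) \<Rightarrow>
   (nat set \<Rightarrow> nat set set \<Rightarrow> bool) \<Rightarrow> nat \<Rightarrow> promise_problem" where
  "Swap_Promise step cls r =
     ({encode_instance n E c k | n E c k.
         cls {..<n} E \<and> swap_promise r {..<n} E c k \<and> solvable_within step r {..<n} E c k},
      {encode_instance n E c k | n E c k.
         cls {..<n} E \<and> swap_promise r {..<n} E c k \<and> \<not> solvable_within step r {..<n} E c k})"

end

theory Submission
  imports Defs
begin

text \<open>
  A computation of a verifier on the input and a guessed witness is described by facts that propagate
  by Horn rules, and these rules are turned into a graph whose 3-colorings are the assignments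
  that respect them.  The graph always has a 3-coloring, namely one that makes the fact ``rejected''
  true, but it has one that gives this fact the color of ``false'' only if some witness is accepted.
  Drawing the vertices as rows and columns of a grid, with the crossover gadget of Garey, Johnson
  and Stockmeyer in every cell, makes the graph planar.  Completing every vertex to a triangle of its
  own forces all proper colorings to use each color equally often, and two adjacent swaps per triangle
  lead from one to the other.  Finally the rows of ``false'' and ``rejected'' are prolonged so far that the
  budget of swaps does not suffice to recolor them.  Initially they have the same color, so a
  solution within the budget, by arbitrary or adjacent swaps, exists iff some witness is accepted.

  The reduction is computed by register programs with polynomially bounded registers, whose values
  a Turing machine represents by head positions.
\<close>

section \<open>Register programs\<close>

text \<open>The promise shapes the construction: even when no witness exists, the graph must be
  3-colorable and the given coloring must contain each color the right number of times. Hence the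
  constraint system always has a trivial solution, and the question is whether it has one with an
  extra property. The hardness rests on a gap in distance. If a witness exists, some proper coloring
  agrees with the initial one on the whole prolongation, and rotating the 13 triangles of each of
  the (n+1)^2 remaining cells costs at most 26 (n+1)^2 adjacent swaps. Otherwise every proper
  coloring changes one of two rows along M cells, while k arbitrary swaps change at most 2k < M
  vertices. The upper bound uses adjacent swaps and the lower bound arbitrary ones, so one reduction
  settles both statements. Since all quantities are polynomially bounded, values can be kept in
  unary, and every output symbol is computed from its index alone, by bounded sums and table
  lookup.\<close>

datatype test = Reg nat | Inp nat

datatype prog =
    Inc nat
  | Dec nat
  | Out bool
  | Fwd
  | Bwd
  | Seq prog prog (infixr ";;" 60)
  | While test prog
  | Cond test prog prog

text \<open>A memory consists of the output written so far, the position of the input head and the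
  registers.\<close>

type_synonym mem = "bool list \<times> int \<times> (nat \<Rightarrow> nat)"

fun holds :: "bool list \<Rightarrow> test \<Rightarrow> mem \<Rightarrow> bool" where
  "holds x (Reg r) (w, h, g) \<longleftrightarrow> g r \<noteq> 0"
| "holds x (Inp s) (w, h, g) \<longleftrightarrow> fst (input_tape x) h \<noteq> s"

fun pstep :: "bool list \<Rightarrow> prog list \<times> mem \<Rightarrow> prog list \<times> mem" where
  "pstep x ([], m) = ([], m)"
| "pstep x (Inc r # cs, (w, h, g)) = (cs, (w, h, g(r := Suc (g r))))"
| "pstep x (Dec r # cs, (w, h, g)) = (cs, (w, h, g(r := g r - 1)))"
| "pstep x (Out b # cs, (w, h, g)) = (cs, (w @ [b], h, g))"
| "pstep x (Fwd # cs, (w, h, g)) = (cs, (w, h + 1, g))"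
| "pstep x (Bwd # cs, (w, h, g)) = (cs, (w, h - 1, g))"
| "pstep x ((c ;; d) # cs, m) = (c # d # cs, m)"
| "pstep x (While b c # cs, m) = (if holds x b m then c # While b c # cs else cs, m)"
| "pstep x (Cond b c d # cs, m) = ((if holds x b m then c else d) # cs, m)"

fun test_regs :: "test \<Rightarrow> nat set" where
  "test_regs (Reg r) = {r}"
| "test_regs (Inp s) = {}"

fun regs :: "prog \<Rightarrow> nat set" where
  "regs (Inc r) = {r}"
| "regs (Dec r) = {r}"
| "regs (c ;; d) = regs c \<union> regs d"
| "regs (While b c) = test_regs b \<union> regs c"
| "regs (Cond b c d) = test_regs b \<union> regs c \<union> regs d"
| "regs _ = {}"

lemma finite_regs: "finite (regs c)"
proof (induction c)
  case (While b c) then show ?case by (cases b) auto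
next
  case (Cond b c d) then show ?case by (cases b) auto
qed auto

text \<open>Only finitely many continuation stacks occur while a program is executed, so they can serve
  as the states of a Turing machine.\<close>

fun stacks :: "prog \<Rightarrow> prog list \<Rightarrow> prog list set" where
  "stacks (c ;; d) cs = insert ((c ;; d) # cs) (stacks c (d # cs) \<union> stacks d cs)"
| "stacks (While b c) cs = insert (While b c # cs) (stacks c (While b c # cs))"
| "stacks (Cond b c d) cs = insert (Cond b c d # cs) (stacks c cs \<union> stacks d cs)"
| "stacks c cs = {c # cs}"

lemma finite_stacks: "finite (stacks c cs)"
  by (induction c cs rule: stacks.induct) auto

lemma stacks_self: "c # cs \<in> stacks c cs"
  by (cases c) auto

lemma stacks_nonempty: "[] \<notin> stacks c cs"
  by (induction c cs rule: stacks.induct) auto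

fun succs :: "prog list \<Rightarrow> prog list set" where
  "succs [] = {[]}"
| "succs ((c ;; d) # cs) = {c # d # cs}"
| "succs (While b c # cs) = {c # While b c # cs, cs}"
| "succs (Cond b c d # cs) = {c # cs, d # cs}"
| "succs (c # cs) = {cs}"

lemma fst_pstep: "fst (pstep x (cs, m)) \<in> succs cs"
  by (cases "(x, (cs, m))" rule: pstep.cases) auto

lemma stacks_succs: "ds \<in> stacks c cs \<Longrightarrow> succs ds \<subseteq> insert cs (stacks c cs)"
proof (induction c cs rule: stacks.induct)
  case (1 c d cs)
  then show ?case using stacks_self by auto
next
  case (2 b c cs)
  then show ?case using stacks_self[of c "While b c # cs"] by auto
next
  case (3 b c d cs)
  then show ?case using stacks_self by auto
qed auto

lemma stacks_step:
  "ds \<in> stacks c cs \<Longrightarrow> fst (pstep x (ds, m)) \<in> insert cs (stacks c cs)"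
  using stacks_succs fst_pstep by blast

lemma stacks_regs:
  "ds \<in> stacks c cs \<Longrightarrow> d \<in> set ds \<Longrightarrow> regs d \<subseteq> regs c \<or> d \<in> set cs"
  by (induction c cs arbitrary: d rule: stacks.induct) fastforce+

section \<open>Turing machines from finite control systems\<close>

fun cstep :: "('s \<Rightarrow> nat list \<Rightarrow> 's \<times> (nat \<times> move) list) \<Rightarrow> 's \<Rightarrow> 's \<times> tape list \<Rightarrow> 's \<times> tape list"
  where "cstep ctl z (s, ts) =
    (if s = z then (s, ts)
     else (fst (ctl s (map read_tape ts)), map2 act_tape (snd (ctl s (map read_tape ts))) ts))"

text \<open>Machine states are numbers, with 0 initial and \<open>num_states\<close> halting. So
  \<open>s0\<close> heads the enumeration of \<open>S\<close>, and \<open>z\<close>, which lies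
  outside \<open>S\<close>, gets the first number beyond it. The simulation is step by step, without
  loss of time.\<close>

lemma tm_of_control:
  fixes ctl :: "'s \<Rightarrow> nat list \<Rightarrow> 's \<times> (nat \<times> move) list"
  assumes fin: "finite S" and s0: "s0 \<in> S" and z: "z \<notin> S" and K: "K \<ge> 1"
    and ctl: "\<And>s ss. s \<in> S \<Longrightarrow> fst (ctl s ss) \<in> insert z S"
    and wf: "\<And>s ss. s \<in> S \<Longrightarrow> length ss = K \<Longrightarrow> set ss \<subseteq> {..<3} \<Longrightarrow>
        length (snd (ctl s ss)) = K \<and> fst ` set (snd (ctl s ss)) \<subseteq> {..<3}"
  obtains M where "wf_tm M" "num_tapes M = K"
    "\<And>n ts ts'. (cstep ctl z ^^ n) (s0, ts) = (z, ts') \<Longrightarrow>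
        (tm_step M ^^ n) (0, ts) = (num_states M, ts')"
proof -
  obtain l where l: "distinct l" "set l = S - {s0}"
    using finite_distinct_list[of "S - {s0}"] fin by auto
  define L where "L = s0 # l"
  have L: "distinct L" "set L = S" using l s0 by (auto simp: L_def)
  define enc where "enc s = (if s \<in> S then inv_into {..<length L} ((!) L) s else length L)" for s
  have img: "(!) L ` {..<length L} = S"
    using L(2) by (auto simp: set_conv_nth)
  have enc_lt: "enc s < length L" "L ! enc s = s" if "s \<in> S" for s
    using that img inv_into_into[of s "(!) L" "{..<length L}"]
      f_inv_into_f[of s "(!) L" "{..<length L}"] by (auto simp: enc_def)
  have enc_z: "enc z = length L" using z by (simp add: enc_def)
  have enc0: "enc s0 = 0"
  proof -
    have "inj_on ((!) L) {..<length L}" using L(1) by (simp add: inj_on_nth)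
    moreover have "s0 = L ! 0" "0 < length L" by (auto simp: L_def)
    ultimately show ?thesis using s0 by (simp add: enc_def inv_into_f_eq)
  qed
  define M where "M = \<lparr>num_tapes = K, num_states = length L, num_symbols = 3,
     delta = (\<lambda>q ss. (enc (fst (ctl (L ! q) ss)), snd (ctl (L ! q) ss)))\<rparr>"
  have enc_le: "enc s \<le> length L" if "s \<in> insert z S" for s
    using that enc_lt enc_z by (auto intro: less_imp_le)
  have "wf_tm M"
    unfolding wf_tm_def
  proof (intro conjI allI impI)
    fix q ss q' as
    assume a: "q < num_states M \<and> length ss = num_tapes M \<and> set ss \<subseteq> {..<num_symbols M} \<and>
        delta M q ss = (q', as)"
    then have "L ! q \<in> S" using L(2) by (auto simp: M_def)
    from wf[OF this, of ss] ctl[OF this, of ss] a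
    show "q' \<le> num_states M" "length as = num_tapes M" "fst ` set as \<subseteq> {..<num_symbols M}"
      by (auto simp: M_def enc_le)
  qed (use K in \<open>auto simp: M_def\<close>)
  moreover have "num_tapes M = K" by (simp add: M_def)
  moreover have sim: "(tm_step M ^^ n) (enc s, ts) =
      (enc (fst ((cstep ctl z ^^ n) (s, ts))), snd ((cstep ctl z ^^ n) (s, ts)))"
    if "s \<in> insert z S" for n s ts
    using that
  proof (induction n arbitrary: s ts)
    case (Suc n)
    show ?case
    proof (cases "s = z")
      case True
      have "tm_step M (enc s, ts) = (enc s, ts)" using True enc_z by (simp add: M_def)
      then show ?thesis using Suc True by (simp add: funpow_swap1[symmetric] del: funpow.simps add: funpow_Suc_right)
    next
      case False
      then have s: "s \<in> S" using Suc by auto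
      have "tm_step M (enc s, ts) = (enc (fst (cstep ctl z (s, ts))), snd (cstep ctl z (s, ts)))"
        using enc_lt[OF s] False by (simp add: M_def)
      moreover have "fst (cstep ctl z (s, ts)) \<in> insert z S" using ctl[OF s] False by auto
      ultimately show ?thesis
        using Suc.IH[of "fst (cstep ctl z (s, ts))" "snd (cstep ctl z (s, ts))"]
        by (simp add: funpow_Suc_right del: funpow.simps cstep.simps)
    qed
  qed simp
  moreover have "num_states M = length L" by (simp add: M_def)
  ultimately show ?thesis
    using that[of M] enc0 enc_z s0 by (metis fst_conv insertI2 snd_conv)
qed

section \<open>Compiling register programs\<close>

definition idle :: "nat list \<Rightarrow> (nat \<times> move) list" where
  "idle ss = map (\<lambda>s. (s, Stay)) ss"

text \<open>Tape 0 holds the output and tape 1 the input, so register r lives on tape r + 2. Its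
  only mark 1 is in cell 0, hence reading 1 means that the register is 0.\<close>

fun test_syms :: "test \<Rightarrow> nat list \<Rightarrow> bool" where
  "test_syms (Reg r) ss \<longleftrightarrow> ss ! (r + 2) \<noteq> 1"
| "test_syms (Inp s) ss \<longleftrightarrow> ss ! 1 \<noteq> s"

text \<open>The states \<open>Inl 0\<close>, \<open>Inl 1\<close>, \<open>Inl 2\<close> mark cell \<open>0\<close> of the register tapes, move the input
  from tape \<open>0\<close> to tape \<open>1\<close> and rewind both tapes.  A register is represented by the head position
  on its tape.\<close>

fun ctl :: "prog \<Rightarrow> nat + prog list \<Rightarrow> nat list \<Rightarrow> (nat + prog list) \<times> (nat \<times> move) list" where
  "ctl p (Inl i) ss =
     (if i = 0 then (Inl 1, map (\<lambda>i. (if i < 2 then ss ! i else 1, Stay)) [0..<length ss])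
      else if i = 1 then
        (if ss ! 0 \<noteq> 0 then (Inl 1, (idle ss)[0 := (0, Move_Right), 1 := (ss ! 0, Move_Right)])
         else (Inl 2, (idle ss)[0 := (0, Move_Left), 1 := (ss ! 1, Move_Left)]))
      else
        (if ss ! 1 \<noteq> 0 then (Inl 2, (idle ss)[0 := (0, Move_Left), 1 := (ss ! 1, Move_Left)])
         else (Inr [p], (idle ss)[0 := (0, Move_Right), 1 := (ss ! 1, Move_Right)])))"
| "ctl p (Inr []) ss = (Inr [], idle ss)"
| "ctl p (Inr (Inc r # cs)) ss = (Inr cs, (idle ss)[r + 2 := (ss ! (r + 2), Move_Right)])"
| "ctl p (Inr (Dec r # cs)) ss =
     (Inr cs, (idle ss)[r + 2 := (ss ! (r + 2), if ss ! (r + 2) = 1 then Stay else Move_Left)])"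
| "ctl p (Inr (Out b # cs)) ss = (Inr cs, (idle ss)[0 := (bit_symbol b, Move_Right)])"
| "ctl p (Inr (Fwd # cs)) ss = (Inr cs, (idle ss)[1 := (ss ! 1, Move_Right)])"
| "ctl p (Inr (Bwd # cs)) ss = (Inr cs, (idle ss)[1 := (ss ! 1, Move_Left)])"
| "ctl p (Inr ((c ;; d) # cs)) ss = (Inr (c # d # cs), idle ss)"
| "ctl p (Inr (While b c # cs)) ss =
     (Inr (if test_syms b ss then c # While b c # cs else cs), idle ss)"
| "ctl p (Inr (Cond b c d # cs)) ss = (Inr ((if test_syms b ss then c else d) # cs), idle ss)"

definition reg_tape :: "nat \<Rightarrow> tape" where
  "reg_tape v = (\<lambda>i. if i = 0 then 1 else 0, int v)"

fun mem_tapes :: "bool list \<Rightarrow> nat \<Rightarrow> mem \<Rightarrow> tape list" where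
  "mem_tapes x K (w, h, g) =
     (fst (input_tape w), int (length w)) # (fst (input_tape x), h) # map (\<lambda>r. reg_tape (g r)) [0..<K]"

lemma read_reg_tape: "read_tape (reg_tape v) = (if v = 0 then 1 else 0)"
  by (simp add: reg_tape_def)

lemma act_idle: "map2 act_tape (idle (map read_tape ts)) ts = ts"
proof -
  have "map2 act_tape (map (\<lambda>s. (s, Stay)) (map read_tape ts)) ts = ts"
    by (induction ts) auto
  then show ?thesis by (simp add: idle_def)
qed

lemma act_update:
  assumes "i < length ts"
  shows "map2 act_tape (as[i := a]) ts = (map2 act_tape as ts)[i := act_tape a (ts ! i)]"
  using assms
proof (induction as arbitrary: i ts)
  case (Cons b as)
  then show ?case by (cases ts; cases i) auto
qed simp

lemma act_idle_update:
  "i < length ts \<Longrightarrow>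
    map2 act_tape ((idle (map read_tape ts))[i := a]) ts = ts[i := act_tape a (ts ! i)]"
  by (simp add: act_update act_idle)

lemma act_idle_update2:
  "i < length ts \<Longrightarrow> j < length ts \<Longrightarrow> i \<noteq> j \<Longrightarrow>
    map2 act_tape ((idle (map read_tape ts))[i := a, j := b]) ts =
    ts[i := act_tape a (ts ! i), j := act_tape b (ts ! j)]"
  by (simp add: act_update act_idle)

lemma map_fun_upd_upt:
  "r < K \<Longrightarrow> (map (\<lambda>r. f (g r)) [0..<K])[r := f v] = map (\<lambda>q. f ((g(r := v)) q)) [0..<K]"
  by (rule nth_equalityI) (auto simp: nth_list_update)

lemma input_tape_snoc:
  "(fst (input_tape w))(int (length w) := bit_symbol b) = fst (input_tape (w @ [b]))"
  by (auto simp: input_tape_def fun_eq_iff nth_append)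

lemma test_syms_holds:
  assumes "test_regs b \<subseteq> {..<K}"
  shows "test_syms b (map read_tape (mem_tapes x K m)) = holds x b m"
  using assms by (cases b; cases m) (auto simp: read_reg_tape)

text \<open>One program step corresponds to exactly one machine step. Only registers below
  \<open>K\<close> have a tape, which is why all statements on the stack are restricted to
  them.\<close>

lemma cstep_pstep:
  assumes "\<And>c. c \<in> set cs \<Longrightarrow> regs c \<subseteq> {..<K}"
  shows "cstep (ctl p) (Inr []) (Inr cs, mem_tapes x K m) =
    (Inr (fst (pstep x (cs, m))), mem_tapes x K (snd (pstep x (cs, m))))"
proof (cases cs)
  case (Cons c cs')
  obtain w h g where m: "m = (w, h, g)" by (cases m)
  have r: "regs c \<subseteq> {..<K}" using assms Cons by auto
  define ts where "ts = mem_tapes x K m"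
  have len: "length ts = K + 2" by (simp add: m ts_def)
  show ?thesis
  proof (cases c)
    case (Inc r)
    have r: "r < K" using r Inc by simp
    have "cstep (ctl p) (Inr []) (Inr cs, ts) =
        (Inr cs', ts[r + 2 := act_tape (read_tape (ts ! (r + 2)), Move_Right) (ts ! (r + 2))])"
      using r len by (simp add: Cons Inc act_idle_update)
    moreover have "act_tape (read_tape (ts ! (r + 2)), Move_Right) (ts ! (r + 2)) = reg_tape (Suc (g r))"
      using r by (simp add: ts_def m reg_tape_def fun_upd_idem)
    moreover have "ts[r + 2 := reg_tape (Suc (g r))] = mem_tapes x K (snd (pstep x (cs, m)))"
      using map_fun_upd_upt[OF r, of reg_tape g "Suc (g r)"] by (simp add: ts_def m Cons Inc)
    ultimately show ?thesis by (simp add: ts_def Cons Inc m)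
  next
    case (Dec r)
    have r: "r < K" using r Dec by simp
    define mv where "mv = (if read_tape (ts ! (r + 2)) = 1 then Stay else Move_Left)"
    have "cstep (ctl p) (Inr []) (Inr cs, ts) =
        (Inr cs', ts[r + 2 := act_tape (read_tape (ts ! (r + 2)), mv) (ts ! (r + 2))])"
      using r len by (simp add: Cons Dec act_idle_update mv_def)
    \<comment> \<open>At value 0 the head stays on the mark, in accordance with truncated
      subtraction.\<close>
    moreover have "act_tape (read_tape (ts ! (r + 2)), mv) (ts ! (r + 2)) = reg_tape (g r - 1)"
      using r by (auto simp: ts_def m reg_tape_def fun_upd_idem mv_def of_nat_diff)
    moreover have "ts[r + 2 := reg_tape (g r - 1)] = mem_tapes x K (snd (pstep x (cs, m)))"
      using map_fun_upd_upt[OF r, of reg_tape g "g r - 1"] by (simp add: ts_def m Cons Dec)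
    ultimately show ?thesis by (simp add: ts_def Cons Dec m)
  next
    case (Out b)
    have "cstep (ctl p) (Inr []) (Inr cs, ts) =
        (Inr cs', ts[0 := act_tape (bit_symbol b, Move_Right) (ts ! 0)])"
      using len by (simp add: Cons Out act_idle_update)
    then show ?thesis using input_tape_snoc[of w b] by (simp add: ts_def Cons Out m add.commute)
  next
    case Fwd
    have "cstep (ctl p) (Inr []) (Inr cs, ts) =
        (Inr cs', ts[1 := act_tape (read_tape (ts ! 1), Move_Right) (ts ! 1)])"
      using len by (simp add: Cons Fwd act_idle_update)
    then show ?thesis by (simp add: ts_def Cons Fwd m)
  next
    case Bwd
    have "cstep (ctl p) (Inr []) (Inr cs, ts) =
        (Inr cs', ts[1 := act_tape (read_tape (ts ! 1), Move_Left) (ts ! 1)])"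
      using len by (simp add: Cons Bwd act_idle_update)
    then show ?thesis by (simp add: ts_def Cons Bwd m)
  next
    case (Seq d e)
    show ?thesis using Cons Seq m act_idle[of "mem_tapes x K m"] by simp
  next
    case (While b d)
    show ?thesis using Cons While r act_idle[of "mem_tapes x K m"] test_syms_holds[of b K x m] by simp
  next
    case (Cond b d e)
    show ?thesis using Cons Cond r act_idle[of "mem_tapes x K m"] test_syms_holds[of b K x m] by simp
  qed
qed simp


lemma cstep_pstep_funpow:
  assumes "regs p \<subseteq> {..<K}" "cs \<in> insert [] (stacks p [])"
  shows "(cstep (ctl q) (Inr []) ^^ n) (Inr cs, mem_tapes x K m) =
    (Inr (fst ((pstep x ^^ n) (cs, m))), mem_tapes x K (snd ((pstep x ^^ n) (cs, m))))"
  using assms(2)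
proof (induction n arbitrary: cs m)
  case (Suc n)
  have "regs c \<subseteq> {..<K}" if "c \<in> set cs" for c
    using that Suc.prems stacks_regs[of cs p "[]" c] assms(1) by auto
  note step = cstep_pstep[OF this, of cs q x m]
  have "fst (pstep x (cs, m)) \<in> insert [] (stacks p [])"
    using Suc.prems stacks_step[of cs p "[]" x m] by auto
  from Suc.IH[OF this, of "snd (pstep x (cs, m))"] show ?case
    by (simp add: funpow_Suc_right step del: funpow.simps cstep.simps)
qed simp

definition setup_tapes :: "nat \<Rightarrow> (int \<Rightarrow> nat) \<Rightarrow> (int \<Rightarrow> nat) \<Rightarrow> int \<Rightarrow> tape list" where
  "setup_tapes K a b h = (a, h) # (b, h) # replicate K (reg_tape 0)"

lemma setup_step:
  "cstep (ctl p) (Inr []) (Inl 1, setup_tapes K a b h) =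
    (if a h \<noteq> 0 then (Inl 1, setup_tapes K (a(h := 0)) (b(h := a h)) (h + 1))
     else (Inl 2, setup_tapes K a b (h - 1)))"
  "a h = 0 \<Longrightarrow> cstep (ctl p) (Inr []) (Inl 2, setup_tapes K a b h) =
    (if b h \<noteq> 0 then (Inl 2, setup_tapes K a b (h - 1))
     else (Inr [p], setup_tapes K a b (h + 1)))"
proof -
  define ts where "ts = setup_tapes K a b h"
  have len: "0 < length ts" "1 < length ts" by (simp_all add: ts_def setup_tapes_def)
  note upd = act_idle_update2[OF len, simplified]
  have rd: "map read_tape ts ! 0 = a h" "map read_tape ts ! 1 = b h"
    "ts ! 0 = (a, h)" "ts ! Suc 0 = (b, h)"
    by (simp_all add: ts_def setup_tapes_def)
  have st: "ts[0 := (a', h'), Suc 0 := (b', h')] = setup_tapes K a' b' h'" for a' b' h'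
    by (simp add: ts_def setup_tapes_def)
  show "cstep (ctl p) (Inr []) (Inl 1, setup_tapes K a b h) =
    (if a h \<noteq> 0 then (Inl 1, setup_tapes K (a(h := 0)) (b(h := a h)) (h + 1))
     else (Inl 2, setup_tapes K a b (h - 1)))"
    unfolding ts_def[symmetric] using rd by (auto simp: upd st fun_upd_idem simp del: nth_map)
  show "cstep (ctl p) (Inr []) (Inl 2, setup_tapes K a b h) =
    (if b h \<noteq> 0 then (Inl 2, setup_tapes K a b (h - 1))
     else (Inr [p], setup_tapes K a b (h + 1)))" if "a h = 0"
    unfolding ts_def[symmetric] using rd that by (auto simp: upd st fun_upd_idem simp del: nth_map)
qed

text \<open>After j cells have been moved, \<open>from_cell x j\<close> is what remains on tape 0
  and \<open>before_cell x j\<close> is what has arrived on tape 1.\<close>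

definition from_cell :: "bool list \<Rightarrow> nat \<Rightarrow> int \<Rightarrow> nat" where
  "from_cell x j i = (if int j \<le> i then fst (input_tape x) i else 0)"

definition before_cell :: "bool list \<Rightarrow> nat \<Rightarrow> int \<Rightarrow> nat" where
  "before_cell x j i = (if i < int j then fst (input_tape x) i else 0)"

lemma setup_copy:
  "j \<le> length x \<Longrightarrow> (cstep (ctl p) (Inr []) ^^ j) (Inl 1, setup_tapes K (from_cell x 0) (before_cell x 0) 0) =
    (Inl 1, setup_tapes K (from_cell x j) (before_cell x j) (int j))"
proof (induction j)
  case (Suc j)
  have "from_cell x j (int j) \<noteq> 0"
    using Suc.prems by (simp add: from_cell_def input_tape_def bit_symbol_def)
  moreover have "(from_cell x j)(int j := 0) = from_cell x (Suc j)"
    "(before_cell x j)(int j := from_cell x j (int j)) = before_cell x (Suc j)"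
    by (auto simp: from_cell_def before_cell_def)
  ultimately show ?case using Suc by (simp add: setup_step add.commute del: cstep.simps One_nat_def)
qed simp

lemma setup_rewind:
  "j \<le> length x \<Longrightarrow>
    (cstep (ctl p) (Inr []) ^^ j) (Inl 2, setup_tapes K (\<lambda>_. 0) (fst (input_tape x)) (int j - 1)) =
    (Inl 2, setup_tapes K (\<lambda>_. 0) (fst (input_tape x)) (- 1))"
proof (induction j)
  case (Suc j)
  then have "fst (input_tape x) (int j) \<noteq> 0" by (simp add: input_tape_def bit_symbol_def)
  then show ?case using Suc by (simp add: setup_step funpow_Suc_right del: cstep.simps funpow.simps)
qed simp

text \<open>One step marks the register tapes, \<open>length x\<close> steps move the input, one
  step turns around at the first blank, \<open>length x\<close> steps rewind to cell -1, and one
  step enters the program at cell 0. Tape 0 is then empty and can take the output.\<close>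

lemma setup_tapes_done:
  "(cstep (ctl p) (Inr []) ^^ (2 * length x + 3))
     (Inl 0, map (\<lambda>i. input_tape (if i < length [x] then [x] ! i else [])) [0..<K + 2]) =
   (Inr [p], mem_tapes x K ([], 0, \<lambda>_. 0))"
proof -
  let ?s = "cstep (ctl p) (Inr [])"
  define ts where "ts = map (\<lambda>i. input_tape (if i < length [x] then [x] ! i else [])) [0..<K + 2]"
  have len: "length ts = K + 2" by (simp add: ts_def)
  have "?s (Inl 0, ts) = (Inl 1, setup_tapes K (from_cell x 0) (before_cell x 0) 0)"
  proof -
    have "map2 act_tape (map (\<lambda>i. (if i < 2 then map read_tape ts ! i else 1, Stay))
        [0..<length (map read_tape ts)]) ts = setup_tapes K (from_cell x 0) (before_cell x 0) 0"
    proof (rule nth_equalityI)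
      fix i assume "i < length (map2 act_tape (map (\<lambda>i. (if i < 2 then map read_tape ts ! i else 1, Stay))
        [0..<length (map read_tape ts)]) ts)"
      then have i: "i < K + 2" by (simp add: len)
      consider "i = 0" | "i = 1" | k where "i = k + 2" "k < K"
        using i by (metis One_nat_def Suc_less_eq add_2_eq_Suc' not0_implies_Suc)
      then show "map2 act_tape (map (\<lambda>i. (if i < 2 then map read_tape ts ! i else 1, Stay))
        [0..<length (map read_tape ts)]) ts ! i = setup_tapes K (from_cell x 0) (before_cell x 0) 0 ! i"
      proof cases
        case 1
        then show ?thesis by (auto simp: len ts_def setup_tapes_def from_cell_def input_tape_def fun_eq_iff
            simp del: upt_Suc)
      next
        case 2
        then show ?thesis by (auto simp: len ts_def setup_tapes_def before_cell_def input_tape_def fun_eq_iff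
            simp del: upt_Suc)
      next
        case 3
        then show ?thesis by (auto simp: len ts_def setup_tapes_def reg_tape_def input_tape_def fun_eq_iff
            simp del: upt_Suc)
      qed
    qed (simp add: len setup_tapes_def)
    then show ?thesis by simp
  qed
  then have 1: "(?s ^^ 1) (Inl 0, ts) = (Inl 1, setup_tapes K (from_cell x 0) (before_cell x 0) 0)"
    by (simp del: cstep.simps)
  note 2 = setup_copy[of "length x" x p K, OF order_refl]
  have bl: "from_cell x (length x) = (\<lambda>_. 0)" "before_cell x (length x) = fst (input_tape x)"
    by (auto simp: from_cell_def before_cell_def input_tape_def)
  have 3: "(?s ^^ 1) (Inl 1, setup_tapes K (\<lambda>_. 0) (fst (input_tape x)) (int (length x))) =
    (Inl 2, setup_tapes K (\<lambda>_. 0) (fst (input_tape x)) (int (length x) - 1))"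
    using setup_step(1)[of p K "\<lambda>_. 0" "fst (input_tape x)" "int (length x)"] by (simp del: cstep.simps)
  note 4 = setup_rewind[of "length x" x p K, OF order_refl]
  have 5: "(?s ^^ 1) (Inl 2, setup_tapes K (\<lambda>_. 0) (fst (input_tape x)) (- 1)) =
    (Inr [p], setup_tapes K (\<lambda>_. 0) (fst (input_tape x)) 0)"
    by (simp add: setup_step input_tape_def del: cstep.simps)
  have 6: "setup_tapes K (\<lambda>_. 0) (fst (input_tape x)) 0 = mem_tapes x K ([], 0, \<lambda>_. 0)"
    by (auto simp: setup_tapes_def input_tape_def map_replicate_const)
  have "2 * length x + 3 = 1 + (length x + (1 + (length x + 1)))" by simp
  then have "(?s ^^ (2 * length x + 3)) (Inl 0, ts) =
    (?s ^^ 1) ((?s ^^ length x) ((?s ^^ 1) ((?s ^^ length x) ((?s ^^ 1) (Inl 0, ts)))))"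
    by (simp only: funpow_add comp_apply)
  then show ?thesis
    unfolding 1 2 bl 3 4 5 6 unfolding ts_def .
qed

lemma funpow_fixpoint: "f y = y \<Longrightarrow> (f ^^ n) y = y"
  by (induction n) auto

lemma funpow_stays:
  assumes "(f ^^ n) y = z" "f z = z" "n \<le> m"
  shows "(f ^^ m) y = z"
proof -
  have "(f ^^ m) y = (f ^^ (m - n)) ((f ^^ n) y)"
    using assms(3) by (metis comp_apply funpow_add le_add_diff_inverse2)
  then show ?thesis using assms by (simp add: funpow_fixpoint)
qed

text \<open>The stacks of \<open>p\<close> together with three setup states form a finite control
  system, and the setup adds \<open>[:3, 2:]\<close> to the time bound. Halting configurations are
  fixed points, so the actual number of steps may be replaced by its bound.\<close>

theorem poly_time_prog:
  fixes P :: "nat poly"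
  assumes "\<And>x. \<exists>n \<le> poly P (length x). \<exists>h g. (pstep x ^^ n) ([p], ([], 0, \<lambda>_. 0)) = ([], (f x, h, g))"
  shows "poly_time 1 (\<lambda>xs. f (xs ! 0))"
proof -
  obtain K where K: "regs p \<subseteq> {..<K}"
    using finite_regs[of p] finite_nat_iff_bounded by blast
  define S :: "(nat + prog list) set" where "S = {Inl 0, Inl 1, Inl 2} \<union> Inr ` stacks p []"
  have fin: "finite S" "Inl 0 \<in> S" "Inr [] \<notin> S"
    by (auto simp: S_def finite_stacks stacks_nonempty)
  have bit3: "bit_symbol b < 3" for b by (simp add: bit_symbol_def)
  have nxt: "fst (ctl p s ss) \<in> insert (Inr []) S" if s: "s \<in> S" for s ss
  proof (cases s)
    case (Inl i)
    then show ?thesis using s stacks_self[of p "[]"] by (auto simp: S_def)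
  next
    case (Inr cs)
    then have cs: "cs \<in> stacks p []" using s by (auto simp: S_def)
    have "fst (ctl p (Inr cs) ss) \<in> Inr ` succs cs"
      by (cases cs rule: succs.cases) auto
    then show ?thesis using stacks_succs[OF cs] Inr by (fastforce simp: S_def)
  qed
  have idl: "length (idle ss) = length ss" "fst ` set (idle ss) \<subseteq> {..<3}" if "set ss \<subseteq> {..<3}" for ss
    using that by (auto simp: idle_def)
  have upd: "fst ` set (as[i := (a, m)]) \<subseteq> {..<3}" if "fst ` set as \<subseteq> {..<3}" "a < 3"
    for as :: "(nat \<times> move) list" and i a m
    using that set_update_subset_insert[of as i "(a, m)"] by fastforce
  have wf: "length (snd (ctl p s ss)) = K + 2 \<and> fst ` set (snd (ctl p s ss)) \<subseteq> {..<3}"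
    if s: "s \<in> S" and ss: "length ss = K + 2" "set ss \<subseteq> {..<3}" for s ss
  proof -
    have nth3: "ss ! i < 3" if "i < K + 2" for i
      using that ss nth_mem[of i ss] by (metis lessThan_iff subsetD)
    show ?thesis
    proof (cases s)
      case (Inl i)
      have "ss ! 0 < 3" "ss ! Suc 0 < 3" using nth3[of 0] nth3[of 1] by simp_all
      moreover have "fst ` set (map (\<lambda>i. (if i < 2 then ss ! i else 1, Stay)) [0..<length ss]) \<subseteq> {..<3}"
        using nth3 ss by auto
      ultimately show ?thesis using ss idl[OF ss(2)] by (simp add: Inl upd)
    next
      case (Inr cs)
      then have cs: "cs \<in> stacks p []" using s by (auto simp: S_def)
      have r: "\<forall>c \<in> set cs. \<forall>r \<in> regs c. ss ! Suc (Suc r) < 3"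
      proof (intro ballI)
        fix c r assume that: "c \<in> set cs" "r \<in> regs c"
        show "ss ! Suc (Suc r) < 3" using that stacks_regs[OF cs, of c] K nth3[of "Suc (Suc r)"] by auto
      qed
      show ?thesis
        unfolding Inr using ss nth3[of 0] nth3[of 1] r
        by (cases cs rule: succs.cases) (simp_all add: idl upd bit3)
    qed
  qed
  obtain M where M: "wf_tm M" "num_tapes M = K + 2"
    and sim: "\<And>n ts ts'. (cstep (ctl p) (Inr []) ^^ n) (Inl 0, ts) = (Inr [], ts') \<Longrightarrow>
        (tm_step M ^^ n) (0, ts) = (num_states M, ts')"
    by (rule tm_of_control[OF fin _ nxt wf]) auto
  have out: "tm_outputs_within M xs (poly (P + [:3, 2:]) (\<Sum>x\<leftarrow>xs. length x)) (f (xs ! 0))"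
    if xs1: "length xs = 1" for xs
  proof -
    obtain x where xs: "xs = [x]" using xs1 by (metis One_nat_def length_0_conv length_Suc_conv)
    obtain n h g where n: "n \<le> poly P (length x)"
      and run: "(pstep x ^^ n) ([p], ([], 0, \<lambda>_. 0)) = ([], (f x, h, g))"
      using assms by blast
    have "(cstep (ctl p) (Inr []) ^^ (n + (2 * length x + 3)))
     (Inl 0, map (\<lambda>i. input_tape (if i < length [x] then [x] ! i else [])) [0..<K + 2]) =
      (Inr [], mem_tapes x K (f x, h, g))"
      unfolding funpow_add[of n "2 * length x + 3"] comp_apply setup_tapes_done
      using cstep_pstep_funpow[OF K, where cs = "[p]" and q = p and n = n and x = x and m = "([], 0, \<lambda>_. 0)"] stacks_self[of p "[]"]
      by (simp add: run)
    from sim[OF this] have "(tm_step M ^^ (n + (2 * length x + 3))) (tm_init M xs) =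
      (num_states M, mem_tapes x K (f x, h, g))"
      unfolding tm_init_def M(2) xs by simp
    moreover have "n + (2 * length x + 3) \<le> poly (P + [:3, 2:]) (length x)"
      using n by (simp add: algebra_simps)
    moreover have "tm_step M (num_states M, ts) = (num_states M, ts)" for ts by simp
    ultimately have "(tm_step M ^^ poly (P + [:3, 2:]) (length x)) (tm_init M xs) =
      (num_states M, mem_tapes x K (f x, h, g))"
      using funpow_stays by metis
    then show ?thesis
      by (auto simp: tm_outputs_within_def xs tape_output_def input_tape_def)
  qed
  show ?thesis
    unfolding poly_time_def
    by (rule exI[of _ M], rule exI[of _ "P + [:3, 2:]"]) (use M out in auto)
qed

section \<open>Time bounds for structured programs\<close>

text \<open>One step count must serve all continuations \<open>cs\<close>; this makes the relation
  compose under sequencing and loops.\<close>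

definition runs :: "bool list \<Rightarrow> prog \<Rightarrow> mem \<Rightarrow> nat \<Rightarrow> mem \<Rightarrow> bool" where
  "runs x c m N m' \<longleftrightarrow> (\<exists>n\<le>N. \<forall>cs. (pstep x ^^ n) (c # cs, m) = (cs, m'))"

lemma runs_mono: "runs x c m N m' \<Longrightarrow> N \<le> N' \<Longrightarrow> runs x c m N' m'"
  unfolding runs_def using le_trans by blast

lemma runs_single: "(\<And>cs. pstep x (c # cs, m) = (cs, m')) \<Longrightarrow> runs x c m 1 m'"
  unfolding runs_def by (rule exI[of _ 1]) simp

lemma runs_eval: "(\<And>cs. (pstep x ^^ n) (c # cs, m) = (cs, m')) \<Longrightarrow> runs x c m n m'"
  unfolding runs_def by blast

lemma runs_basic:
  "runs x (Inc r) (w, h, g) 1 (w, h, g(r := Suc (g r)))"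
  "runs x (Dec r) (w, h, g) 1 (w, h, g(r := g r - 1))"
  "runs x (Out b) (w, h, g) 1 (w @ [b], h, g)"
  "runs x Fwd (w, h, g) 1 (w, h + 1, g)"
  "runs x Bwd (w, h, g) 1 (w, h - 1, g)"
  by (rule runs_single; simp)+

lemma runs_first:
  assumes "\<And>cs. pstep x (c # cs, m) = (ds @ cs, m)"
    and "\<And>cs. (pstep x ^^ n) (ds @ cs, m) = (cs, m')" "n \<le> N"
  shows "runs x c m (Suc N) m'"
  unfolding runs_def
  by (rule exI[of _ "Suc n"]) (use assms in \<open>simp add: funpow_Suc_right del: funpow.simps\<close>)

lemma runs_Seq:
  assumes "runs x c m N m'" "runs x d m' N' m''"
  shows "runs x (c ;; d) m (Suc (N + N')) m''"
proof -
  obtain n n' where n: "n \<le> N" "\<And>cs. (pstep x ^^ n) (c # cs, m) = (cs, m')"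
    and n': "n' \<le> N'" "\<And>cs. (pstep x ^^ n') (d # cs, m') = (cs, m'')"
    using assms by (auto simp: runs_def)
  have "(pstep x ^^ (n' + n)) (c # d # cs, m) = (cs, m'')" for cs
    by (simp add: funpow_add n n')
  then show ?thesis
    by (intro runs_first[of x _ m "[c, d]" "n' + n"]) (use n n' in auto)
qed

lemma runs_While_False: "\<not> holds x b m \<Longrightarrow> runs x (While b c) m 1 m"
  by (rule runs_single) simp

lemma runs_While_True:
  assumes "holds x b m" "runs x c m N m'" "runs x (While b c) m' N' m''"
  shows "runs x (While b c) m (Suc (N + N')) m''"
proof -
  obtain n n' where n: "n \<le> N" "\<And>cs. (pstep x ^^ n) (c # cs, m) = (cs, m')"
    and n': "n' \<le> N'" "\<And>cs. (pstep x ^^ n') (While b c # cs, m') = (cs, m'')"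
    using assms by (auto simp: runs_def)
  have "(pstep x ^^ (n' + n)) (c # While b c # cs, m) = (cs, m'')" for cs
    by (simp add: funpow_add n n')
  then show ?thesis
    by (intro runs_first[of x _ m "[c, While b c]" "n' + n"]) (use assms(1) n n' in auto)
qed

text \<open>The index of \<open>s\<close> counts the iterations still to come, so it decreases along
  the run. Each iteration costs one test and the body, and the last test costs one more
  step.\<close>

lemma runs_loop:
  assumes "\<And>j. j < n \<Longrightarrow> runs x c (s (Suc j)) N (s j)"
    and "\<And>j. j \<le> n \<Longrightarrow> holds x b (s j) \<longleftrightarrow> j \<noteq> 0"
  shows "runs x (While b c) (s n) (n * Suc N + 1) (s 0)"
  using assms
proof (induction n)
  case 0
  then show ?case using runs_While_False by simp
next
  case (Suc n)
  have "runs x (While b c) (s n) (n * Suc N + 1) (s 0)"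
    using Suc by simp
  from runs_While_True[OF _ _ this, of "s (Suc n)" N]
  have "runs x (While b c) (s (Suc n)) (Suc (N + (n * Suc N + 1))) (s 0)"
    using Suc.prems by auto
  then show ?case by (rule runs_mono) simp
qed

text \<open>The flag selects addition or truncated subtraction, so that one draining loop and one
  closure proof serve both.\<close>

definition accum :: "bool \<Rightarrow> nat \<Rightarrow> nat \<Rightarrow> nat" where
  "accum u m n = (if u then m + n else m - n)"

lemma runs_drain:
  assumes "a \<noteq> b"
  shows "runs x (While (Reg a) (Dec a ;; (if u then Inc b else Dec b))) (w, h, g) (4 * g a + 1)
    (w, h, g(a := 0, b := accum u (g b) (g a)))"
proof -
  define s where "s j = (w, h, g(a := j, b := accum u (g b) (g a - j)))" for j
  have "runs x (Dec a ;; (if u then Inc b else Dec b)) (s (Suc j)) 3 (s j)" if "j < g a" for j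
    by (rule runs_eval)
      (use that assms in \<open>auto simp: s_def accum_def fun_eq_iff eval_nat_numeral\<close>)
  moreover have "holds x (Reg a) (s j) \<longleftrightarrow> j \<noteq> 0" for j
    using assms by (simp add: s_def)
  ultimately have "runs x (While (Reg a) (Dec a ;; (if u then Inc b else Dec b))) (s (g a))
      (g a * Suc 3 + 1) (s 0)"
    by (intro runs_loop) auto
  moreover have "s (g a) = (w, h, g)" using assms by (auto simp: s_def accum_def fun_eq_iff)
  ultimately show ?thesis using assms by (simp add: s_def mult.commute)
qed

lemma runs_move:
  "a \<noteq> b \<Longrightarrow> runs x (While (Reg a) (Dec a ;; Inc b)) (w, h, g) (4 * g a + 1)
    (w, h, g(a := 0, b := g b + g a))"
  using runs_drain[of a b x True w h g] by (simp add: accum_def)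

section \<open>Functions computable in polynomial time\<close>

lemma poly_nat_mono:
  fixes P :: "nat poly"
  shows "m \<le> n \<Longrightarrow> poly P m \<le> poly P n"
  by (induction P) (auto intro!: add_mono mult_mono)

text \<open>Arguments count with their values rather than their lengths, because registers are
  worked on in unary.\<close>

definition msize :: "bool list \<Rightarrow> nat list \<Rightarrow> nat" where
  "msize x e = length x + sum_list e"

text \<open>\<open>cmp k F\<close>: for arguments held in any \<open>k\<close> registers below \<open>d\<close>, some program stores the value
  of \<open>F\<close> in register \<open>d\<close>, using only registers from \<open>d\<close> on as scratch memory.\<close>

definition cmp :: "nat \<Rightarrow> (bool list \<Rightarrow> nat list \<Rightarrow> nat) \<Rightarrow> bool" where
  "cmp k F \<longleftrightarrow>
     (\<exists>B :: nat poly. \<forall>x e. length e = k \<longrightarrow> F x e \<le> poly B (msize x e)) \<and>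
     (\<forall>\<rho> d. length \<rho> = k \<and> (\<forall>r \<in> set \<rho>. r < d) \<longrightarrow>
        (\<exists>c (P :: nat poly). \<forall>x w g. (\<forall>r\<ge>d. g r = 0) \<longrightarrow>
           runs x c (w, 0, g) (poly P (msize x (map g \<rho>))) (w, 0, g(d := F x (map g \<rho>)))))"

lemma cmpI:
  assumes "\<And>x e. length e = k \<Longrightarrow> F x e \<le> poly B (msize x e)"
    and "\<And>\<rho> d. length \<rho> = k \<Longrightarrow> (\<And>r. r \<in> set \<rho> \<Longrightarrow> r < d) \<Longrightarrow>
      \<exists>c (P :: nat poly). \<forall>x w g. (\<forall>r\<ge>d. g r = 0) \<longrightarrow>
           runs x c (w, 0, g) (poly P (msize x (map g \<rho>))) (w, 0, g(d := F x (map g \<rho>)))"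
  shows "cmp k F"
  unfolding cmp_def using assms by blast

lemma cmp_bound:
  assumes "cmp k F"
  obtains B :: "nat poly" where "\<And>x e. length e = k \<Longrightarrow> F x e \<le> poly B (msize x e)"
  using assms unfolding cmp_def by blast

lemma cmp_prog:
  assumes "cmp k F" "length \<rho> = k" "\<And>r. r \<in> set \<rho> \<Longrightarrow> r < d"
  obtains c and P :: "nat poly" where "\<And>x w g. (\<And>r. r \<ge> d \<Longrightarrow> g r = 0) \<Longrightarrow>
    runs x c (w, 0, g) (poly P (msize x (map g \<rho>))) (w, 0, g(d := F x (map g \<rho>)))"
  using assms unfolding cmp_def by blast

lemma cmp_cong:
  assumes "cmp k F" "\<And>x e. length e = k \<Longrightarrow> F x e = G x e"
  shows "cmp k G"
  using assms unfolding cmp_def by simp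

text \<open>Argument lists are environments in which a bound variable is put in front. This is
  weakening: a function of the outer variables may be used under a binder.\<close>

lemma cmp_tl:
  assumes "cmp k F"
  shows "cmp (Suc k) (\<lambda>x e. F x (tl e))"
proof -
  obtain B :: "nat poly" where B: "\<And>x e. length e = k \<Longrightarrow> F x e \<le> poly B (msize x e)"
    by (rule cmp_bound[OF assms]) blast
  have le: "msize x (tl e) \<le> msize x e" for x e by (cases e) (auto simp: msize_def)
  show ?thesis
  proof (rule cmpI)
    fix x and e :: "nat list" assume "length e = Suc k"
    then show "F x (tl e) \<le> poly B (msize x e)"
      using B[of "tl e" x] poly_nat_mono[OF le[of x e], of B] by simp
  next
    fix \<rho> :: "nat list" and d assume \<rho>: "length \<rho> = Suc k" "\<And>r. r \<in> set \<rho> \<Longrightarrow> r < d"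
    then have "length (tl \<rho>) = k" "\<And>r. r \<in> set (tl \<rho>) \<Longrightarrow> r < d"
      by (auto dest: list.set_sel(2)[rotated])
    from cmp_prog[OF assms this] obtain c and P :: "nat poly" where
      "\<And>x w g. (\<And>r. r \<ge> d \<Longrightarrow> g r = 0) \<Longrightarrow>
        runs x c (w, 0, g) (poly P (msize x (map g (tl \<rho>)))) (w, 0, g(d := F x (map g (tl \<rho>))))"
      by metis
    then show "\<exists>c (P :: nat poly). \<forall>x w g. (\<forall>r\<ge>d. g r = 0) \<longrightarrow>
      runs x c (w, 0, g) (poly P (msize x (map g \<rho>))) (w, 0, g(d := F x (tl (map g \<rho>))))"
      using poly_nat_mono[OF le] by (metis (no_types, lifting) map_tl runs_mono)
  qed
qed

text \<open>Draining a register destroys it, so its value is moved into \<open>d\<close> and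
  \<open>Suc d\<close> at the same time and then restored from the second copy.\<close>

lemma cmp_nth:
  assumes "i < k"
  shows "cmp k (\<lambda>x e. e ! i)"
proof (rule cmpI)
  fix x and e :: "nat list" assume "length e = k"
  then show "e ! i \<le> poly [:0, 1:] (msize x e)"
    using assms elem_le_sum_list[of i e] by (simp add: msize_def)
next
  fix \<rho> :: "nat list" and d assume \<rho>: "length \<rho> = k" "\<And>r. r \<in> set \<rho> \<Longrightarrow> r < d"
  define r where "r = \<rho> ! i"
  have r: "r < d" using \<rho> assms by (simp add: r_def)
  define c where "c = While (Reg r) (Dec r ;; Inc d ;; Inc (Suc d)) ;; While (Reg (Suc d)) (Dec (Suc d) ;; Inc r)"
  have "runs x c (w, 0, g) (poly [:3, 10:] (msize x (map g \<rho>))) (w, 0, g(d := map g \<rho> ! i))"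
    if g: "\<And>r. r \<ge> d \<Longrightarrow> g r = 0" for x w g
  proof -
    define s where "s j = (w, 0 :: int, g(r := j, d := g r - j, Suc d := g r - j))" for j
    have 1: "runs x (Dec r ;; Inc d ;; Inc (Suc d)) (s (Suc j)) 5 (s j)" if "j < g r" for j
      by (rule runs_eval) (use r that in \<open>auto simp: s_def fun_eq_iff eval_nat_numeral\<close>)
    have 2: "runs x (While (Reg r) (Dec r ;; Inc d ;; Inc (Suc d))) (s (g r)) (g r * Suc 5 + 1) (s 0)"
      by (rule runs_loop) (use 1 r in \<open>auto simp: s_def\<close>)
    have s: "s (g r) = (w, 0, g)" "s 0 = (w, 0, g(r := 0, d := g r, Suc d := g r))"
      using g[of d] g[of "Suc d"] r by (auto simp: s_def fun_eq_iff)
    have e: "(g(r := 0, d := g r, Suc d := g r))(Suc d := 0,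
      r := (g(r := 0, d := g r, Suc d := g r)) r + (g(r := 0, d := g r, Suc d := g r)) (Suc d)) = g(d := g r)"
      using g[of "Suc d"] r by (auto simp: fun_eq_iff)
    have "runs x c (w, 0, g) (Suc ((g r * Suc 5 + 1) + (4 * g r + 1))) (w, 0, g(d := g r))"
      unfolding c_def using runs_Seq[OF 2[unfolded s] runs_move[of "Suc d" r x w 0 "g(r := 0, d := g r, Suc d := g r)"]] r
      unfolding e by simp
    moreover have "g r \<le> msize x (map g \<rho>)"
      using assms \<rho> elem_le_sum_list[of i "map g \<rho>"] by (simp add: r_def msize_def)
    moreover have "map g \<rho> ! i = g r" using assms \<rho> by (simp add: r_def)
    ultimately show ?thesis by (auto elim!: runs_mono)
  qed
  then show "\<exists>c (P :: nat poly). \<forall>x w g. (\<forall>r\<ge>d. g r = 0) \<longrightarrow>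
      runs x c (w, 0, g) (poly P (msize x (map g \<rho>))) (w, 0, g(d := map g \<rho> ! i))"
    by blast
qed

lemma cmp_const: "cmp k (\<lambda>x e. n)"
proof (rule cmpI)
  show "n \<le> poly [:n:] (msize x e)" for x e by simp
next
  fix \<rho> :: "nat list" and d
  have "\<exists>c (P :: nat poly). \<forall>x w g. g d = 0 \<longrightarrow>
      runs x c (w, 0, g) (poly P (msize x (map g \<rho>))) (w, 0, g(d := n))"
  proof (induction n)
    case 0
    \<comment> \<open>Register \<open>d\<close> already holds 0; the increment and decrement
      together serve as an empty program.\<close>
    have "runs x (Inc d ;; Dec d) (w, 0, g) (poly [:3:] (msize x (map g \<rho>))) (w, 0, g(d := 0))"
      if "g d = 0" for x w g
    proof -
      have "runs x (Inc d ;; Dec d) (w, 0, g) 3 (w, 0, g(d := 0))"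
        by (rule runs_eval) (use that in \<open>auto simp: fun_eq_iff eval_nat_numeral\<close>)
      then show ?thesis by simp
    qed
    then show ?case by blast
  next
    case (Suc n)
    then obtain c and P :: "nat poly" where c: "\<And>x w g. g d = 0 \<Longrightarrow>
      runs x c (w, 0, g) (poly P (msize x (map g \<rho>))) (w, 0, g(d := n))" by blast
    have "runs x (c ;; Inc d) (w, 0, g) (poly (P + [:2:]) (msize x (map g \<rho>))) (w, 0, g(d := Suc n))"
      if "g d = 0" for x w g
    proof -
      have 1: "runs x c (w, 0, g) (poly P (msize x (map g \<rho>))) (w, 0, g(d := n))"
        using c that by blast
      have 2: "runs x (Inc d) (w, 0, g(d := n)) 1 (w, 0, g(d := Suc n))"
        using runs_basic(1)[of x d w 0 "g(d := n)"] by simp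
      show ?thesis using runs_Seq[OF 1 2] by simp
    qed
    then show ?case by blast
  qed
  then show "\<exists>c (P :: nat poly). \<forall>x w g. (\<forall>r\<ge>d. g r = 0) \<longrightarrow>
      runs x c (w, 0, g) (poly P (msize x (map g \<rho>))) (w, 0, g(d := n))"
    by (meson order_refl)
qed

lemma cmp_accum:
  assumes F: "cmp k F" and G: "cmp k G"
  shows "cmp k (\<lambda>x e. accum u (F x e) (G x e))"
proof -
  obtain BF :: "nat poly" where BF: "\<And>x e. length e = k \<Longrightarrow> F x e \<le> poly BF (msize x e)"
    by (rule cmp_bound[OF F]) blast
  obtain BG :: "nat poly" where BG: "\<And>x e. length e = k \<Longrightarrow> G x e \<le> poly BG (msize x e)"
    by (rule cmp_bound[OF G]) blast
  show ?thesis
  proof (rule cmpI)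
    fix x and e :: "nat list" assume "length e = k"
    then show "accum u (F x e) (G x e) \<le> poly (BF + BG) (msize x e)"
      using BF[of e x] BG[of e x] by (auto simp: accum_def)
  next
    fix \<rho> :: "nat list" and d assume \<rho>: "length \<rho> = k" "\<And>r. r \<in> set \<rho> \<Longrightarrow> r < d"
    obtain c and P :: "nat poly" where c: "\<And>x w g. (\<And>r. r \<ge> d \<Longrightarrow> g r = 0) \<Longrightarrow>
      runs x c (w, 0, g) (poly P (msize x (map g \<rho>))) (w, 0, g(d := F x (map g \<rho>)))"
      by (rule cmp_prog[OF F \<rho>]) blast+
    have \<rho>': "\<And>r. r \<in> set \<rho> \<Longrightarrow> r < Suc d" using \<rho>(2) less_SucI by blast
    obtain c' and P' :: "nat poly" where c': "\<And>x w g. (\<And>r. r \<ge> Suc d \<Longrightarrow> g r = 0) \<Longrightarrow>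
      runs x c' (w, 0, g) (poly P' (msize x (map g \<rho>))) (w, 0, g(Suc d := G x (map g \<rho>)))"
      by (rule cmp_prog[OF G \<rho>(1) \<rho>']) blast+
    define c'' where "c'' = While (Reg (Suc d)) (Dec (Suc d) ;; (if u then Inc d else Dec d))"
    have "runs x (c ;; c' ;; c'') (w, 0, g) (poly (P + P' + smult 4 BG + [:3:]) (msize x (map g \<rho>)))
        (w, 0, g(d := accum u (F x (map g \<rho>)) (G x (map g \<rho>))))"
      if g: "\<And>r. r \<ge> d \<Longrightarrow> g r = 0" for x w g
    proof -
      define e where "e = map g \<rho>"
      have le: "length e = k" using \<rho> by (simp add: e_def)
      define g1 where "g1 = g(d := F x e)"
      have e1: "map g1 \<rho> = e" using \<rho>(2) by (auto simp: g1_def e_def)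
      define g2 where "g2 = g1(Suc d := G x e)"
      have 1: "runs x c (w, 0, g) (poly P (msize x e)) (w, 0, g1)"
        using c[OF g] by (simp add: g1_def e_def)
      have 2: "runs x c' (w, 0, g1) (poly P' (msize x e)) (w, 0, g2)"
        using c'[of g1 x w] g by (simp add: g2_def e1) (simp add: g1_def)
      have "g2(Suc d := 0, d := accum u (g2 d) (g2 (Suc d))) = g(d := accum u (F x e) (G x e))"
        using g by (auto simp: g2_def g1_def fun_eq_iff)
      then have 3: "runs x c'' (w, 0, g2) (4 * G x e + 1) (w, 0, g(d := accum u (F x e) (G x e)))"
        using runs_drain[of "Suc d" d x u w 0 g2] by (simp add: c''_def g2_def)
      show ?thesis
        using runs_mono[OF runs_Seq[OF 1 runs_Seq[OF 2 3]]] BG[OF le, of x]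
        by (simp add: e_def)
    qed
    then show "\<exists>c (P :: nat poly). \<forall>x w g. (\<forall>r\<ge>d. g r = 0) \<longrightarrow>
      runs x c (w, 0, g) (poly P (msize x (map g \<rho>)))
        (w, 0, g(d := accum u (F x (map g \<rho>)) (G x (map g \<rho>))))"
      by blast
  qed
qed

lemma cmp_add: "cmp k F \<Longrightarrow> cmp k G \<Longrightarrow> cmp k (\<lambda>x e. F x e + G x e)"
  using cmp_accum[of k F G True] by (simp add: accum_def)

lemma cmp_diff: "cmp k F \<Longrightarrow> cmp k G \<Longrightarrow> cmp k (\<lambda>x e. F x e - G x e)"
  using cmp_accum[of k F G False] by (simp add: accum_def)

text \<open>The one closure property with a loop over a computable body; products, bounded
  quantifiers and division are derived from it. The summation index runs downwards: register
  \<open>d\<close> is both the loop counter and the argument of the body, \<open>Suc d\<close> holds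
  the partial sum and \<open>Suc (Suc d)\<close> the current summand.\<close>

lemma cmp_sum:
  assumes F: "cmp k F" and G: "cmp (Suc k) G"
  shows "cmp k (\<lambda>x e. \<Sum>i<F x e. G x (i # e))"
proof -
  obtain BF :: "nat poly" where BF: "\<And>x e. length e = k \<Longrightarrow> F x e \<le> poly BF (msize x e)"
    by (rule cmp_bound[OF F]) blast
  obtain BG :: "nat poly" where BG: "\<And>x e. length e = Suc k \<Longrightarrow> G x e \<le> poly BG (msize x e)"
    by (rule cmp_bound[OF G]) blast
  \<comment> \<open>Bounds the size of the environment extended by the summation index, so that
    composing with \<open>X\<close> turns bounds for the body into bounds in the size of the outer
    arguments.\<close>
  define X where "X = [:0, 1:] + BF"
  have X: "msize x (i # e) \<le> poly X (msize x e)" if "length e = k" "i \<le> F x e" for x i e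
    using BF[OF that(1), of x] that by (simp add: X_def msize_def)
  define B where "B = BG \<circ>\<^sub>p X"
  have B: "G x (i # e) \<le> poly B (msize x e)" if "length e = k" "i \<le> F x e" for x i e
    using BG[of "i # e" x] poly_nat_mono[OF X[OF that], of BG] that
    by (simp add: B_def poly_pcompose)
  have sum_le: "(\<Sum>i\<in>A. G x (i # e)) \<le> poly (BF * B) (msize x e)"
    if "length e = k" "A \<subseteq> {..<F x e}" for x e A
  proof -
    have "(\<Sum>i\<in>A. G x (i # e)) \<le> (\<Sum>i<F x e. G x (i # e))"
      using that by (intro sum_mono2) auto
    also have "\<dots> \<le> F x e * poly B (msize x e)"
      using B[OF that(1)] sum_bounded_above[of "{..<F x e}" "\<lambda>i. G x (i # e)"] by simp
    finally show ?thesis using BF[OF that(1), of x] by (simp add: le_trans mult_le_mono)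
  qed
  show ?thesis
  proof (rule cmpI)
    show "(\<Sum>i<F x e. G x (i # e)) \<le> poly (BF * B) (msize x e)" if "length e = k" for x e
      using sum_le[OF that] by simp
  next
    fix \<rho> :: "nat list" and d assume \<rho>: "length \<rho> = k" "\<And>r. r \<in> set \<rho> \<Longrightarrow> r < d"
    obtain c and P :: "nat poly" where c: "\<And>x w g. (\<And>r. r \<ge> d \<Longrightarrow> g r = 0) \<Longrightarrow>
      runs x c (w, 0, g) (poly P (msize x (map g \<rho>))) (w, 0, g(d := F x (map g \<rho>)))"
      by (rule cmp_prog[OF F \<rho>]) blast+
    have \<rho>': "length (d # \<rho>) = Suc k" "\<And>r. r \<in> set (d # \<rho>) \<Longrightarrow> r < Suc (Suc d)"
      using \<rho> by (auto intro: less_SucI)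
    obtain c' and P' :: "nat poly" where c': "\<And>x w g. (\<And>r. r \<ge> Suc (Suc d) \<Longrightarrow> g r = 0) \<Longrightarrow>
      runs x c' (w, 0, g) (poly P' (msize x (map g (d # \<rho>)))) (w, 0, g(Suc (Suc d) := G x (map g (d # \<rho>))))"
      by (rule cmp_prog[OF G \<rho>']) blast+
    define mv where "mv a b = While (Reg a) (Dec a ;; Inc b)" for a b
    define body where "body = Dec d ;; c' ;; mv (Suc (Suc d)) (Suc d)"
    define Q where "Q = P' \<circ>\<^sub>p X + smult 4 B + [:4:]"
    define R where "R = P + BF * (Q + [:1:]) + smult 4 (BF * B) + [:4:]"
    have "runs x (c ;; While (Reg d) body ;; mv (Suc d) d) (w, 0, g) (poly R (msize x (map g \<rho>)))
        (w, 0, g(d := \<Sum>i<F x (map g \<rho>). G x (i # map g \<rho>)))"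
      if g: "\<And>r. r \<ge> d \<Longrightarrow> g r = 0" for x w g
    proof -
      define e where "e = map g \<rho>"
      have le: "length e = k" using \<rho> by (simp add: e_def)
      \<comment> \<open>The part of the sum that has been collected when the counter has come down
        to j.\<close>
      define S where "S j = (\<Sum>i=j..<F x e. G x (i # e))" for j
      define s where "s j = (w, 0 :: int, g(d := j, Suc d := S j))" for j
      have step: "runs x body (s (Suc j)) (poly Q (msize x e)) (s j)" if j: "j < F x e" for j
      proof -
        define g1 where "g1 = g(d := j, Suc d := S (Suc j))"
        define g2 where "g2 = g1(Suc (Suc d) := G x (j # e))"
        have 1: "runs x (Dec d) (s (Suc j)) 1 (w, 0, g1)"
          by (rule runs_eval) (auto simp: s_def g1_def fun_eq_iff)
        have e1: "map g1 (d # \<rho>) = j # e" using \<rho>(2) by (fastforce simp: g1_def e_def)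
        have 2: "runs x c' (w, 0, g1) (poly P' (msize x (j # e))) (w, 0, g2)"
          using c'[of g1 x w] g unfolding e1 by (simp add: g2_def) (simp add: g1_def)
        have "S j = S (Suc j) + G x (j # e)"
          using j by (simp add: S_def sum.atLeast_Suc_lessThan)
        then have "(w, 0, g2(Suc (Suc d) := 0, Suc d := g2 (Suc d) + g2 (Suc (Suc d)))) = s j"
          using g by (auto simp: g2_def g1_def fun_eq_iff s_def)
        then have 3: "runs x (mv (Suc (Suc d)) (Suc d)) (w, 0, g2) (4 * G x (j # e) + 1) (s j)"
          using runs_move[of "Suc (Suc d)" "Suc d" x w 0 g2] by (simp add: mv_def g2_def)
        show ?thesis
          unfolding body_def
          using runs_mono[OF runs_Seq[OF 1 runs_Seq[OF 2 3]]] B[OF le, of j x] j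
            poly_nat_mono[OF X[OF le, of j x], of P']
          by (simp add: Q_def poly_pcompose)
      qed
      have 2: "runs x (While (Reg d) body) (s (F x e)) (F x e * Suc (poly Q (msize x e)) + 1) (s 0)"
        by (rule runs_loop) (use step in \<open>auto simp: s_def\<close>)
      have 1: "runs x c (w, 0, g) (poly P (msize x e)) (s (F x e))"
      proof -
        have "g(d := F x e, Suc d := 0) = g(d := F x e)" using g[of "Suc d"] by (auto simp: fun_eq_iff)
        then show ?thesis using c[OF g] by (simp add: s_def e_def S_def)
      qed
      have "g(d := S 0) = (g(d := 0, Suc d := S 0))(Suc d := 0, d := (g(d := 0, Suc d := S 0)) d + (g(d := 0, Suc d := S 0)) (Suc d))"
        using g[of "Suc d"] by (auto simp: fun_eq_iff)
      then have 3: "runs x (mv (Suc d) d) (s 0) (4 * S 0 + 1) (w, 0, g(d := S 0))"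
        using runs_move[of "Suc d" d x w 0 "g(d := 0, Suc d := S 0)"] by (simp add: mv_def s_def)
      have "S 0 \<le> poly (BF * B) (msize x e)" "S 0 = (\<Sum>i<F x e. G x (i # e))"
        using sum_le[OF le, of "{..<F x e}" x] by (simp_all add: S_def atLeast0LessThan)
      moreover have "F x e * Suc (poly Q (msize x e)) \<le> poly (BF * (Q + [:1:])) (msize x e)"
        using BF[OF le, of x] by (simp add: algebra_simps add_mono mult_le_mono)
      ultimately show ?thesis
        using runs_mono[OF runs_Seq[OF 1 runs_Seq[OF 2 3]], of "poly R (msize x e)"]
        by (simp add: R_def e_def[symmetric])
    qed
    then show "\<exists>c (P :: nat poly). \<forall>x w g. (\<forall>r\<ge>d. g r = 0) \<longrightarrow>
      runs x c (w, 0, g) (poly P (msize x (map g \<rho>)))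
        (w, 0, g(d := \<Sum>i<F x (map g \<rho>). G x (i # map g \<rho>)))"
      by blast
  qed
qed

lemma cmp_length: "cmp k (\<lambda>x e. length x)"
proof (rule cmpI)
  show "length x \<le> poly [:0, 1:] (msize x e)" for x e by (simp add: msize_def)
next
  fix \<rho> :: "nat list" and d
  define c where "c = While (Inp 0) (Fwd ;; Inc d ;; Inc (Suc d)) ;; While (Reg (Suc d)) (Bwd ;; Dec (Suc d))"
  have "runs x c (w, 0, g) (poly [:3, 10:] (msize x (map g \<rho>))) (w, 0, g(d := length x))"
    if g: "\<And>r. r \<ge> d \<Longrightarrow> g r = 0" for x w g
  proof -
    define n where "n = length x"
    define s where "s j = (w, int (n - j), g(d := n - j, Suc d := n - j))" for j
    have 1: "runs x (While (Inp 0) (Fwd ;; Inc d ;; Inc (Suc d))) (s n) (n * Suc 5 + 1) (s 0)"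
    proof (rule runs_loop)
      show "runs x (Fwd ;; Inc d ;; Inc (Suc d)) (s (Suc j)) 5 (s j)" if "j < n" for j
        by (rule runs_eval) (use that in \<open>auto simp: s_def fun_eq_iff eval_nat_numeral\<close>)
      show "holds x (Inp 0) (s j) \<longleftrightarrow> j \<noteq> 0" if "j \<le> n" for j
        using that by (auto simp: s_def input_tape_def n_def bit_symbol_def)
    qed
    define s' where "s' j = (w, int j, g(d := n, Suc d := j))" for j
    have 2: "runs x (While (Reg (Suc d)) (Bwd ;; Dec (Suc d))) (s' n) (n * Suc 3 + 1) (s' 0)"
    proof (rule runs_loop)
      show "runs x (Bwd ;; Dec (Suc d)) (s' (Suc j)) 3 (s' j)" if "j < n" for j
        by (rule runs_eval) (use that in \<open>auto simp: s'_def fun_eq_iff eval_nat_numeral\<close>)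
      show "holds x (Reg (Suc d)) (s' j) \<longleftrightarrow> j \<noteq> 0" if "j \<le> n" for j
        by (auto simp: s'_def)
    qed
    have "s 0 = s' n" "s n = (w, 0, g)" "s' 0 = (w, 0, g(d := n))"
      using g by (auto simp: s_def s'_def fun_eq_iff)
    then show ?thesis
      using runs_mono[OF runs_Seq[OF 1 2[folded \<open>s 0 = s' n\<close>]]]
      by (simp add: c_def n_def msize_def)
  qed
  then show "\<exists>c (P :: nat poly). \<forall>x w g. (\<forall>r\<ge>d. g r = 0) \<longrightarrow>
      runs x c (w, 0, g) (poly P (msize x (map g \<rho>))) (w, 0, g(d := length x))"
    by blast
qed

definition input_symbol :: "bool list \<Rightarrow> nat \<Rightarrow> nat" where
  "input_symbol x i = fst (input_tape x) (int i)"

lemma input_symbol_le: "input_symbol x i \<le> 2"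
  by (simp add: input_symbol_def input_tape_def bit_symbol_def)

lemma cmp_input_symbol:
  assumes F: "cmp k F"
  shows "cmp k (\<lambda>x e. input_symbol x (F x e))"
proof -
  obtain BF :: "nat poly" where BF: "\<And>x e. length e = k \<Longrightarrow> F x e \<le> poly BF (msize x e)"
    by (rule cmp_bound[OF F]) blast
  show ?thesis
  proof (rule cmpI)
    show "input_symbol x (F x e) \<le> poly [:2:] (msize x e)" for x e by (simp add: input_symbol_le)
  next
    fix \<rho> :: "nat list" and d assume \<rho>: "length \<rho> = k" "\<And>r. r \<in> set \<rho> \<Longrightarrow> r < d"
    obtain c and P :: "nat poly" where c: "\<And>x w g. (\<And>r. r \<ge> d \<Longrightarrow> g r = 0) \<Longrightarrow>
      runs x c (w, 0, g) (poly P (msize x (map g \<rho>))) (w, 0, g(d := F x (map g \<rho>)))"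
      by (rule cmp_prog[OF F \<rho>]) blast+
    define c1 where "c1 = Dec d ;; Inc (Suc d) ;; Fwd"
    \<comment> \<open>The nested tests add 2, 1 or 0 to register \<open>d\<close>, which the
      preceding loop has emptied. The last loop returns the input head to cell 0, as
      \<open>cmp\<close> demands.\<close>
    define c2 where "c2 = Cond (Inp 0) (Cond (Inp 1) (Inc d ;; Inc d) (Inc d ;; Inc d ;; Dec d)) (Inc d ;; Dec d)"
    define c3 where "c3 = Dec (Suc d) ;; Bwd"
    have "runs x (c ;; While (Reg d) c1 ;; c2 ;; While (Reg (Suc d)) c3) (w, 0, g)
        (poly (P + smult 10 BF + [:13:]) (msize x (map g \<rho>)))
        (w, 0, g(d := input_symbol x (F x (map g \<rho>))))"
      if g: "\<And>r. r \<ge> d \<Longrightarrow> g r = 0" for x w g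
    proof -
      define e where "e = map g \<rho>"
      have le: "length e = k" using \<rho> by (simp add: e_def)
      define n where "n = F x e"
      have 1: "runs x c (w, 0, g) (poly P (msize x e)) (w, 0, g(d := n))"
        using c[OF g] by (simp add: e_def n_def)
      define s where "s j = (w, int (n - j), g(d := j, Suc d := n - j))" for j
      have 2: "runs x (While (Reg d) c1) (s n) (n * Suc 5 + 1) (s 0)"
      proof (rule runs_loop)
        show "runs x c1 (s (Suc j)) 5 (s j)" if "j < n" for j
          by (rule runs_eval) (use that in \<open>auto simp: c1_def s_def fun_eq_iff eval_nat_numeral\<close>)
        show "holds x (Reg d) (s j) \<longleftrightarrow> j \<noteq> 0" if "j \<le> n" for j
          by (auto simp: s_def)
      qed
      define s' where "s' j = (w, int j, g(d := input_symbol x n, Suc d := j))" for j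
      have 3: "runs x c2 (s 0) 8 (s' n)"
      proof -
        consider "input_symbol x n = 0" | "input_symbol x n = 1" | "input_symbol x n = 2"
          using input_symbol_le[of x n] by linarith
        then show ?thesis
        proof cases
          case 1
          have "runs x c2 (s 0) 4 (s' n)"
            by (rule runs_eval)
              (use 1 g in \<open>auto simp: c2_def s_def s'_def input_symbol_def fun_eq_iff eval_nat_numeral\<close>)
          then show ?thesis by (rule runs_mono) simp
        next
          case 2
          have "runs x c2 (s 0) 7 (s' n)"
            by (rule runs_eval)
              (use 2 g in \<open>auto simp: c2_def s_def s'_def input_symbol_def fun_eq_iff eval_nat_numeral\<close>)
          then show ?thesis by (rule runs_mono) simp
        next
          case 3
          have "runs x c2 (s 0) 5 (s' n)"
            by (rule runs_eval)
              (use 3 g in \<open>auto simp: c2_def s_def s'_def input_symbol_def fun_eq_iff eval_nat_numeral\<close>)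
          then show ?thesis by (rule runs_mono) simp
        qed
      qed
      have 4: "runs x (While (Reg (Suc d)) c3) (s' n) (n * Suc 3 + 1) (s' 0)"
      proof (rule runs_loop)
        show "runs x c3 (s' (Suc j)) 3 (s' j)" if "j < n" for j
          by (rule runs_eval) (use that in \<open>auto simp: c3_def s'_def fun_eq_iff eval_nat_numeral\<close>)
        show "holds x (Reg (Suc d)) (s' j) \<longleftrightarrow> j \<noteq> 0" if "j \<le> n" for j
          by (auto simp: s'_def)
      qed
      have s: "s n = (w, 0, g(d := n))" "s' 0 = (w, 0, g(d := input_symbol x n))"
        using g[of "Suc d"] by (auto simp: s_def s'_def fun_eq_iff)
      show ?thesis
        using runs_mono[OF runs_Seq[OF 1 runs_Seq[OF 2[unfolded s] runs_Seq[OF 3 4[unfolded s]]]]] BF[OF le, of x]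
        by (simp add: e_def n_def)
    qed
    then show "\<exists>c (P :: nat poly). \<forall>x w g. (\<forall>r\<ge>d. g r = 0) \<longrightarrow>
      runs x c (w, 0, g) (poly P (msize x (map g \<rho>))) (w, 0, g(d := input_symbol x (F x (map g \<rho>))))"
      by blast
  qed
qed

lemma cmp_mult:
  assumes "cmp k F" "cmp k G"
  shows "cmp k (\<lambda>x e. F x e * G x e)"
  by (rule cmp_cong[OF cmp_sum[OF assms(1) cmp_tl[OF assms(2)]]]) simp

section \<open>Decidable predicates, bounded quantifiers and division\<close>

definition cmpb :: "nat \<Rightarrow> (bool list \<Rightarrow> nat list \<Rightarrow> bool) \<Rightarrow> bool" where
  "cmpb k P \<longleftrightarrow> cmp k (\<lambda>x e. of_bool (P x e))"

lemma cmpbI: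
  assumes "cmp k F" "\<And>x e. length e = k \<Longrightarrow> F x e = of_bool (P x e)"
  shows "cmpb k P"
  unfolding cmpb_def using assms by (rule cmp_cong)

lemma cmpb_cong:
  assumes "cmpb k P" "\<And>x e. length e = k \<Longrightarrow> P x e = Q x e"
  shows "cmpb k Q"
  by (rule cmpbI[OF assms(1)[unfolded cmpb_def]]) (simp add: assms(2))

lemma cmpb_le: "cmp k F \<Longrightarrow> cmp k G \<Longrightarrow> cmpb k (\<lambda>x e. F x e \<le> G x e)"
  by (rule cmpbI[OF cmp_diff[OF cmp_const[of k 1] cmp_diff[of k F G]]]) auto

lemma cmpb_conj:
  assumes "cmpb k P" "cmpb k Q"
  shows "cmpb k (\<lambda>x e. P x e \<and> Q x e)"
  by (rule cmpbI[OF cmp_mult[OF assms[unfolded cmpb_def]]]) simp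

lemma cmpb_not:
  assumes "cmpb k P"
  shows "cmpb k (\<lambda>x e. \<not> P x e)"
  by (rule cmpbI[OF cmp_diff[OF cmp_const[of k 1] assms[unfolded cmpb_def]]]) simp

lemma cmpb_less:
  assumes "cmp k F" "cmp k G"
  shows "cmpb k (\<lambda>x e. F x e < G x e)"
  by (rule cmpb_cong[OF cmpb_not[OF cmpb_le[OF assms(2,1)]]]) auto

lemma cmpb_disj:
  assumes "cmpb k P" "cmpb k Q"
  shows "cmpb k (\<lambda>x e. P x e \<or> Q x e)"
  by (rule cmpb_cong[OF cmpb_not[OF cmpb_conj[OF assms[THEN cmpb_not]]]]) simp

lemma cmpb_eq:
  assumes "cmp k F" "cmp k G"
  shows "cmpb k (\<lambda>x e. F x e = G x e)"
  by (rule cmpb_cong[OF cmpb_conj[OF cmpb_le[OF assms] cmpb_le[OF assms(2,1)]]]) auto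

lemma cmpb_const: "cmpb k (\<lambda>x e. b)"
  unfolding cmpb_def by (rule cmp_const)

lemma cmp_if:
  assumes "cmpb k P" "cmp k F" "cmp k G"
  shows "cmp k (\<lambda>x e. if P x e then F x e else G x e)"
  by (rule cmp_cong[OF cmp_add[OF cmp_mult[OF assms(1)[unfolded cmpb_def] assms(2)]
        cmp_mult[OF cmpb_not[OF assms(1), unfolded cmpb_def] assms(3)]]]) auto

text \<open>A predicate holds for all i < n iff the number of i < n satisfying it is at least n, and
  this number is a bounded sum.\<close>

lemma cmpb_all:
  assumes "cmp k F" "cmpb (Suc k) P"
  shows "cmpb k (\<lambda>x e. \<forall>i<F x e. P x (i # e))"
proof (rule cmpb_cong[OF cmpb_le[OF assms(1) cmp_sum[OF assms(1) assms(2)[unfolded cmpb_def]]]])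
  fix x e
  define n where "n = F x e"
  define A where "A = {..<n} \<inter> {i. P x (i # e)}"
  have "(\<Sum>i<n. of_bool (P x (i # e))) = card A"
    by (simp add: A_def sum_of_bool_eq)
  moreover have sub: "A \<subseteq> {..<n}" by (simp add: A_def)
  have "n \<le> card A \<longleftrightarrow> A = {..<n}"
  proof
    assume "n \<le> card A"
    then show "A = {..<n}" using card_seteq[OF finite_lessThan sub] by simp
  qed simp
  moreover have "A = {..<n} \<longleftrightarrow> (\<forall>i<n. P x (i # e))" unfolding A_def by blast
  ultimately show "F x e \<le> (\<Sum>i<F x e. of_bool (P x (i # e))) \<longleftrightarrow> (\<forall>i<F x e. P x (i # e))"
    by (simp add: n_def)
qed

text \<open>For n > 0, m div n is the number of i < m with (i + 1) n at most m. Division by 0 yields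
  0 and is treated separately.\<close>

lemma cmp_div:
  assumes F: "cmp k F" and G: "cmp k G"
  shows "cmp k (\<lambda>x e. F x e div G x e)"
proof -
  have "cmpb (Suc k) (\<lambda>x e. Suc (e ! 0) * G x (tl e) \<le> F x (tl e))"
    using cmpb_le[OF cmp_mult[OF cmp_add[OF cmp_nth[of 0 "Suc k"] cmp_const[of "Suc k" 1]] cmp_tl[OF G]] cmp_tl[OF F]]
    by simp
  from cmp_sum[OF F this[unfolded cmpb_def]]
  have 1: "cmp k (\<lambda>x e. \<Sum>i<F x e. of_bool (Suc i * G x e \<le> F x e))"
    by simp
  have D: "m div n = (if n = 0 then 0 else \<Sum>i<m. of_bool (Suc i * n \<le> m))" for m n :: nat
  proof (cases "n = 0")
    case False
    have "{..<m} \<inter> {i. Suc i * n \<le> m} = {..<m div n}"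
    proof -
      have *: "Suc i * n \<le> m \<longleftrightarrow> i < m div n" for i
        using less_eq_div_iff_mult_less_eq[of n "Suc i" m] False by (simp only: Suc_le_eq neq0_conv)
      have "i < m" if "i < m div n" for i
        using that div_le_dividend[of m n] by (rule less_le_trans)
      then show ?thesis unfolding * by blast
    qed
    then show ?thesis using False by (simp add: sum_of_bool_eq)
  qed simp
  show ?thesis
    by (rule cmp_cong[OF cmp_if[OF cmpb_eq[OF G cmp_const[of k 0]] cmp_const[of k 0] 1]])
      (rule D[symmetric])
qed

lemma cmp_mod:
  assumes F: "cmp k F" and G: "cmp k G"
  shows "cmp k (\<lambda>x e. F x e mod G x e)"
  by (rule cmp_cong[OF cmp_diff[OF F cmp_mult[OF cmp_div[OF F G] G]]])
    (simp add: minus_div_mult_eq_mod)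

lemma cmp_poly:
  fixes P :: "nat poly"
  assumes "cmp k F"
  shows "cmp k (\<lambda>x e. poly P (F x e))"
proof (induction P)
  case 0
  then show ?case using cmp_const[of k 0] by simp
next
  case (pCons a P)
  then show ?case using cmp_add[OF cmp_const[of k a] cmp_mult[OF assms]] by simp
qed

lemma cmpb_bex_list:
  assumes "\<And>z. z \<in> set l \<Longrightarrow> cmpb k (P z)"
  shows "cmpb k (\<lambda>x e. \<exists>z\<in>set l. P z x e)"
  using assms
proof (induction l)
  case Nil
  then show ?case using cmpb_const[of k False] by simp
next
  case (Cons z l)
  then have "cmpb k (\<lambda>x e. P z x e \<or> (\<exists>z\<in>set l. P z x e))"
    by (intro cmpb_disj) auto
  then show ?case by (rule cmpb_cong) auto
qed

lemma cmpb_finite_case: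
  assumes "cmp k F" "\<And>x e. F x e < n" "\<And>z. cmpb k (P z)"
  shows "cmpb k (\<lambda>x e. P (F x e) x e)"
proof -
  have "cmpb k (\<lambda>x e. \<exists>z\<in>set [0..<n]. F x e = z \<and> P z x e)"
    by (intro cmpb_bex_list cmpb_conj cmpb_eq cmp_const assms)
  then show ?thesis by (rule cmpb_cong) (use assms(2) in auto)
qed

text \<open>\<open>P\<close> may be any predicate, since a value below the constant \<open>n\<close>
  can be compared with all possibilities in turn. In this way the transition function of the
  verifier, which need not be given by arithmetic, enters the reduction.\<close>

lemma cmpb_finite:
  assumes "cmp k F" "\<And>x e. F x e < n"
  shows "cmpb k (\<lambda>x e. P (F x e))"
  by (rule cmpb_finite_case[OF assms, of "\<lambda>z x e. P z"]) (rule cmpb_const)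

lemma cmpb_finite3:
  assumes "cmp k F" "\<And>x e. F x e < n" "cmp k G" "\<And>x e. G x e < n" "cmp k H" "\<And>x e. H x e < n"
  shows "cmpb k (\<lambda>x e. P (F x e) (G x e) (H x e))"
proof -
  have "cmpb k (\<lambda>x e. P a b (H x e))" for a b
    by (rule cmpb_finite[OF assms(5,6)])
  then have "cmpb k (\<lambda>x e. P a (G x e) (H x e))" for a
    by (rule cmpb_finite_case[OF assms(3,4), of "\<lambda>b x e. P a b (H x e)"])
  then show ?thesis
    by (rule cmpb_finite_case[OF assms(1,2), of "\<lambda>a x e. P a (G x e) (H x e)"])
qed

section \<open>Output\<close>

text \<open>Symbol 0 emits nothing. Hence code words of varying length can be laid out in fields
  whose width is easy to compute.\<close>

definition emit :: "nat \<Rightarrow> bool list" where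
  "emit s = (if s = 0 then [] else if s = 1 then [False] else [True])"

text \<open>To produce a string in polynomial time it suffices to compute its i-th symbol from i.
  Register 0 counts the remaining symbols, register 1 holds the index and register 2 the symbol to
  be emitted.\<close>

theorem poly_time_emit:
  assumes N: "cmp 0 (\<lambda>x e. N x)" and S: "cmp 1 (\<lambda>x e. S x (e ! 0))"
    and S2: "\<And>x i. S x i \<le> 2"
  shows "poly_time 1 (\<lambda>xs. concat (map (\<lambda>i. emit (S (xs ! 0) i)) [0..<N (xs ! 0)]))"
proof -
  obtain B :: "nat poly" where B0: "\<And>x e :: nat list. length e = 0 \<Longrightarrow> N x \<le> poly B (msize x e)"
    by (rule cmp_bound[OF N]) blast
  have B: "N x \<le> poly B (length x)" for x
    using B0[of "[]" x] by (simp add: msize_def)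
  obtain c and P :: "nat poly" where c0: "\<And>x w g. (\<And>r. r \<ge> 0 \<Longrightarrow> g r = 0) \<Longrightarrow>
      runs x c (w, 0, g) (poly P (msize x (map g []))) (w, 0, g(0 := N x))"
    by (rule cmp_prog[OF N, of "[]" 0]) (simp, simp, blast)
  have c: "runs x c (w, 0, \<lambda>_. 0) (poly P (length x)) (w, 0, (\<lambda>_. 0)(0 := N x))" for x w
    using c0[of "\<lambda>_. 0" x w] by (simp add: msize_def)
  obtain c' and P' :: "nat poly" where c'0: "\<And>x w g. (\<And>r. r \<ge> 2 \<Longrightarrow> g r = 0) \<Longrightarrow>
      runs x c' (w, 0, g) (poly P' (msize x (map g [1]))) (w, 0, g(2 := S x (map g [1] ! 0)))"
    by (rule cmp_prog[OF S, of "[1]" 2]) (simp, simp, blast)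
  have c': "runs x c' (w, 0, g) (poly P' (length x + g 1)) (w, 0, g(2 := S x (g 1)))"
    if "\<And>r. r \<ge> 2 \<Longrightarrow> g r = 0" for x w g
    using c'0[of g x w] that by (simp add: msize_def)
  define c2 where "c2 = Cond (Reg 2) (Dec 2 ;; Cond (Reg 2) (Dec 2 ;; Out True) (Out False)) (Inc 2 ;; Dec 2)"
  define body where "body = Dec 0 ;; c' ;; c2 ;; Inc 1"
  define p where "p = c ;; While (Reg 0) body"
  define X where "X = [:0, 1:] + B"
  define Q where "Q = P' \<circ>\<^sub>p X + [:20:]"
  define T where "T = P + B * (Q + [:1:]) + [:2:]"
  let ?f = "\<lambda>x. concat (map (\<lambda>i. emit (S x i)) [0..<N x])"
  have "runs x p ([], 0, \<lambda>_. 0) (poly T (length x)) (?f x, 0, (\<lambda>_. 0)(1 := N x))" for x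
  proof -
    define n where "n = N x"
    define s where "s j = (concat (map (\<lambda>i. emit (S x i)) [0..<n - j]), 0 :: int,
      (\<lambda>_ :: nat. 0 :: nat)(0 := j, 1 := n - j))" for j
    have step: "runs x body (s (Suc j)) (poly Q (length x)) (s j)" if j: "j < n" for j
    proof -
      define i where "i = n - Suc j"
      have i: "n - j = Suc i" "i < n" using j by (auto simp: i_def)
      define w where "w = concat (map (\<lambda>i. emit (S x i)) [0..<i])"
      define g where "g = (\<lambda>_ :: nat. 0 :: nat)(0 := j, 1 := i)"
      have 1: "runs x (Dec 0) (s (Suc j)) 1 (w, 0, g)"
        by (rule runs_eval) (auto simp: s_def w_def g_def i_def[symmetric] fun_eq_iff)
      have 2: "runs x c' (w, 0, g) (poly P' (length x + i)) (w, 0, g(2 := S x i))"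
        using c'[of g x w] by (simp add: g_def)
      have 3: "runs x c2 (w, 0, g(2 := S x i)) 10 (w @ emit (S x i), 0, g)"
      proof -
        have g2: "g(2 := 0) = g" "g (Suc (Suc 0)) = 0" by (auto simp: g_def fun_eq_iff)
        consider "S x i = 0" | "S x i = 1" | "S x i = 2" using S2[of x i] by linarith
        then show ?thesis
        proof cases
          case 1
          have "runs x c2 (w, 0, g(2 := S x i)) 4 (w @ emit (S x i), 0, g)"
            by (rule runs_eval) (use 1 g2 in \<open>simp add: c2_def emit_def eval_nat_numeral\<close>)
          then show ?thesis by (rule runs_mono) simp
        next
          case 2
          have "runs x c2 (w, 0, g(2 := S x i)) 5 (w @ emit (S x i), 0, g)"
            by (rule runs_eval) (use 2 g2 in \<open>simp add: c2_def emit_def eval_nat_numeral\<close>)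
          then show ?thesis by (rule runs_mono) simp
        next
          case 3
          have "runs x c2 (w, 0, g(2 := S x i)) 7 (w @ emit (S x i), 0, g)"
            by (rule runs_eval) (use 3 g2 in \<open>simp add: c2_def emit_def eval_nat_numeral\<close>)
          then show ?thesis by (rule runs_mono) simp
        qed
      qed
      have 4: "runs x (Inc 1) (w @ emit (S x i), 0, g) 1 (s j)"
        by (rule runs_eval) (auto simp: s_def w_def g_def i(1) fun_eq_iff)
      have "length x + i \<le> poly X (length x)" using B[of x] i by (simp add: X_def n_def)
      from poly_nat_mono[OF this, of P'] show ?thesis
        unfolding body_def using runs_mono[OF runs_Seq[OF 1 runs_Seq[OF 2 runs_Seq[OF 3 4]]]]
        by (simp add: Q_def poly_pcompose)
    qed
    have 2: "runs x (While (Reg 0) body) (s n) (n * Suc (poly Q (length x)) + 1) (s 0)"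
      by (rule runs_loop) (use step in \<open>auto simp: s_def\<close>)
    have s: "s n = ([], 0, (\<lambda>_. 0)(0 := N x))" "s 0 = (?f x, 0, (\<lambda>_. 0)(1 := N x))"
      by (auto simp: s_def n_def fun_eq_iff)
    have 1: "runs x c ([], 0, \<lambda>_. 0) (poly P (length x)) ([], 0, (\<lambda>_. 0)(0 := N x))"
      using c by blast
    have "n * Suc (poly Q (length x)) \<le> poly (B * (Q + [:1:])) (length x)"
      using B[of x] by (simp add: n_def algebra_simps add_mono mult_le_mono)
    then show ?thesis
      unfolding p_def using runs_mono[OF runs_Seq[OF 1 2[unfolded s]]] by (simp add: T_def)
  qed
  note run = this
  show ?thesis
  proof (rule poly_time_prog)
    fix x
    from run[of x] obtain n where "n \<le> poly T (length x)"
      "(pstep x ^^ n) ([p], ([], 0, \<lambda>_. 0)) = ([], (?f x, 0, (\<lambda>_. 0)(1 := N x)))"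
      unfolding runs_def by meson
    then show "\<exists>n\<le>poly T (length x). \<exists>h g. (pstep x ^^ n) ([p], ([], 0, \<lambda>_. 0)) = ([], (?f x, h, g))"
      by (intro exI conjI)
  qed
qed

section \<open>Cells\<close>

text \<open>The local vertices of a cell are \<open>3 * l + j\<close> with \<open>l < 13\<close> and \<open>j < 3\<close>, where \<open>j = 0\<close> is a core
  vertex and \<open>j = 1, 2\<close> complete it to a triangle.  The core vertices \<open>l = 0, 1\<close> lie on the left
  and on the upper side of the cell, \<open>l = 2, \<dots>, 10\<close> are the inner vertices of the crossover gadget
  of Garey, Johnson and Stockmeyer, and \<open>l = 11, 12\<close> serve to identify the colors of \<open>0\<close> and \<open>1\<close>.
  The coordinates draw a cell with straight edges in a square of side \<open>20\<close>.  The numbers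
  \<open>39\<close> and \<open>40\<close> denote the left vertex of the right neighbor and the upper vertex of the lower
  neighbor.\<close>

definition cell_pos :: "(int \<times> int) list" where
  "cell_pos = [(0, 10), (1, 10), (2, 9), (10, 0), (10, 1), (11, 2), (11, 11), (10, 11), (9, 12), (6, 10),
    (4, 9), (4, 11), (10, 6), (8, 7), (9, 4), (14, 10), (12, 9), (11, 8), (10, 14), (8, 13), (7, 12),
    (6, 6), (5, 7), (5, 8), (14, 6), (13, 5), (12, 5), (14, 14), (15, 13), (15, 12), (6, 14), (5, 13),
    (7, 13), (4, 4), (3, 4), (3, 5), (2, 2), (1, 2), (1, 3), (20, 10), (10, 20)]"

definition cross_edges :: "(nat \<times> nat) list" where
  "cross_edges = [(0, 18), (0, 21), (0, 30), (3, 9), (3, 21), (3, 24), (6, 9), (6, 12), (6, 15),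
    (6, 18), (9, 12), (9, 18), (9, 21), (12, 15), (12, 24), (12, 39), (15, 18), (15, 27), (15, 40),
    (18, 30), (24, 39), (27, 39), (27, 40), (30, 40)]"

definition equal_edges :: "(nat \<times> nat) list" where
  "equal_edges = [(0, 33), (0, 36), (33, 36), (3, 33), (3, 36)]"

definition triangle_edges :: "(nat \<times> nat) list" where
  "triangle_edges =
    concat (map (\<lambda>l. [(3 * l, 3 * l + 1), (3 * l, 3 * l + 2), (3 * l + 1, 3 * l + 2)]) [0..<13])"

text \<open>The first component is \<open>0\<close> for edges of every cell, \<open>1\<close> for crossovers, \<open>2\<close> for adjacent row and
  column and \<open>3\<close> for cells on the diagonal.\<close>

definition local_edges :: "(nat \<times> nat \<times> nat) list" where
  "local_edges = map (Pair 0) triangle_edges @ map (Pair 1) cross_edges @ [(2, 0, 3)] @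
    map (Pair 3) equal_edges"

section \<open>Certificates for the drawing of a cell\<close>

text \<open>Twice the signed area of a triangle; its sign tells on which side of the line through
  the first two points the third one lies.\<close>

fun orient :: "int \<times> int \<Rightarrow> int \<times> int \<Rightarrow> int \<times> int \<Rightarrow> int" where
  "orient (a, b) (c, d) (e, f) = (c - a) * (f - b) - (d - b) * (e - a)"

text \<open>A sufficient condition for two segments to meet in a common end at most: if they share
  an end, they are not collinear, and otherwise both ends of one lie strictly on the same side of
  the line through the other.\<close>

fun apart :: "nat \<times> nat \<Rightarrow> nat \<times> nat \<Rightarrow> bool" where
  "apart (a, b) (c, d) =
    (let A = cell_pos ! a; B = cell_pos ! b; C = cell_pos ! c; D = cell_pos ! d in
     if a = c then orient A B D \<noteq> 0 else if a = d then orient A B C \<noteq> 0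
     else if b = c then orient B A D \<noteq> 0 else if b = d then orient B A C \<noteq> 0
     else orient A B C * orient A B D > 0 \<or> orient C D A * orient C D B > 0)"

text \<open>Edges of all types are drawn together and compared pairwise, so planarity does not
  depend on which types are active in a cell.\<close>

lemma local_apart:
  "\<forall>e \<in> set local_edges. \<forall>f \<in> set local_edges. snd e \<noteq> snd f \<longrightarrow> apart (snd e) (snd f)"
  by code_simp

text \<open>Edges stay within the square of their cell and never run along one of its sides. So
  edges of different cells can meet only in end vertices on a common side.\<close>

definition sides_ok :: "nat \<times> nat \<Rightarrow> bool" where
  "sides_ok e = (case e of (a, b) \<Rightarrow> a < 39 \<and> b < 41 \<and> a < b \<and>
     (let A = cell_pos ! a; B = cell_pos ! b in
      {fst A, fst B, snd A, snd B} \<subseteq> {0..20} \<and>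
      \<not> (fst A = 0 \<and> fst B = 0) \<and> \<not> (fst A = 20 \<and> fst B = 20) \<and>
      \<not> (snd A = 0 \<and> snd B = 0) \<and> \<not> (snd A = 20 \<and> snd B = 20)))"

lemma local_sides: "\<forall>e \<in> set local_edges. sides_ok (snd e)"
  by code_simp

lemma cell_pos_distinct: "distinct cell_pos" "length cell_pos = 41"
  "\<forall>l\<in>set [0..<39]. fst (cell_pos ! l) \<in> {0..<20} \<and> snd (cell_pos ! l) \<in> {0..<20}"
  by code_simp+

section \<open>Colors of the gadgets in a cell\<close>

lemma crossover:
  fixes k :: "nat \<Rightarrow> nat"
  assumes "\<And>l. l < 41 \<Longrightarrow> k l \<in> {1..3}" and "\<And>a b. (a, b) \<in> set cross_edges \<Longrightarrow> k a \<noteq> k b"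
  shows "k 39 = k 0 \<and> k 40 = k 3"
proof -
  have c: "k l = 1 \<or> k l = 2 \<or> k l = 3" if "l < 41" for l
    using assms(1)[OF that] by auto
  have ne: "k 0 \<noteq> k 18" "k 0 \<noteq> k 21" "k 0 \<noteq> k 30" "k 3 \<noteq> k 9" "k 3 \<noteq> k 21" "k 3 \<noteq> k 24" "k 6 \<noteq> k 9"
    "k 6 \<noteq> k 12" "k 6 \<noteq> k 15" "k 6 \<noteq> k 18" "k 9 \<noteq> k 12" "k 9 \<noteq> k 18" "k 9 \<noteq> k 21" "k 12 \<noteq> k 15"
    "k 12 \<noteq> k 24" "k 12 \<noteq> k 39" "k 15 \<noteq> k 18" "k 15 \<noteq> k 27" "k 15 \<noteq> k 40" "k 18 \<noteq> k 30" "k 24 \<noteq> k 39"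
    "k 27 \<noteq> k 39" "k 27 \<noteq> k 40" "k 30 \<noteq> k 40"
    using assms(2) by (simp_all add: cross_edges_def)
  \<comment> \<open>The vertices 9, 12, 15, 18 form a 4-cycle around the hub 6, so the cycle
    alternates between the two colors that the hub leaves.\<close>
  have e: "k 15 = k 9" "k 12 = k 18"
    using c[of 6] c[of 9] c[of 12] c[of 15] c[of 18] ne(7-12) ne(14) ne(17)
    by (simp_all, metis+)
  show ?thesis
    using c[of 0] c[of 3] c[of 9] c[of 18] c[of 21] c[of 24] c[of 27] c[of 30] c[of 39] c[of 40]
      ne[unfolded e]
    by (simp, smt (verit))
qed

definition nx :: "nat \<Rightarrow> nat" where
  "nx a = a mod 3 + 1"

text \<open>Colors of the 13 core vertices of a cell whose row has color \<open>a\<close> and whose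
  column has color \<open>b\<close>. As 1 + 2 + 3 = 6, \<open>6 - a - b\<close> is the third color
  if \<open>a\<close> and \<open>b\<close> differ. The last two entries are the colors other than
  \<open>a\<close>, as the equality gadget on the diagonal requires.\<close>

definition cell_col :: "nat \<Rightarrow> nat \<Rightarrow> nat list" where
  "cell_col a b = [a, b] @
    (if a = b then [a, nx a, nx (nx a), nx a, nx (nx a), nx (nx a), nx a, nx (nx a), nx a]
     else [6 - a - b, a, b, a, b, 6 - a - b, 6 - a - b, 6 - a - b, 6 - a - b]) @ [nx a, nx (nx a)]"

text \<open>Triangles are always colored in the cyclic order 1, 2, 3, so the color of the core
  vertex determines the other two, and any two such colorings of a triangle differ by a
  rotation.\<close>

definition rot :: "nat \<Rightarrow> nat \<Rightarrow> nat" where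
  "rot a j = (if j = 0 then a else if j = 1 then nx a else nx (nx a))"

definition ext_col :: "nat \<Rightarrow> nat \<Rightarrow> nat \<Rightarrow> nat" where
  "ext_col a b l = (if l = 39 then a else if l = 40 then b else rot (cell_col a b ! (l div 3)) (l mod 3))"

text \<open>The outgoing vertices 39 and 40 repeat the row and the column color, which is why the
  colorings of neighboring cells fit together.\<close>

lemma ext_col_proper:
  "\<forall>a\<in>{1,2,3}. \<forall>b\<in>{1,2,3}. \<forall>(fl, u, v)\<in>set local_edges.
     (fl = 2 \<longrightarrow> a \<noteq> b) \<longrightarrow> (fl = 3 \<longrightarrow> a = b) \<longrightarrow> ext_col a b u \<noteq> ext_col a b v"
  by code_simp

lemma cell_col_range: "\<forall>a\<in>{1,2,3}. \<forall>b\<in>{1,2,3}. list_all (\<lambda>c. c \<in> {1..3}) (cell_col a b)"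
  by code_simp

section \<open>Grid graphs\<close>

text \<open>The rows are the vertices of a graph with edge relation \<open>adj\<close>, and so are the columns from \<open>M\<close>
  on; the columns before \<open>M\<close> prolong the rows \<open>0\<close> and \<open>3\<close>.\<close>

locale grid_graph =
  fixes n M :: nat and adj :: "nat \<Rightarrow> nat \<Rightarrow> bool"
begin

text \<open>Crossovers occur in rows below n and columns below M + n. The additional last column,
  like the additional row in \<open>NV\<close>, contains the far ends of their outgoing
  edges.\<close>

definition C :: nat where
  "C = M + n + 1"

definition NV :: nat where
  "NV = 39 * ((n + 1) * C)"

definition active :: "nat \<Rightarrow> nat \<Rightarrow> nat \<Rightarrow> bool" where
  "active fl r s \<longleftrightarrow>
     (if fl = 0 then True
      else if fl = 1 then (if s < M then r = 0 \<or> r = 3 else r < n \<and> s < M + n)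
      else if fl = 2 then M \<le> s \<and> adj r (s - M)
      else M \<le> s \<and> r = s - M \<and> r < n)"

definition target :: "nat \<Rightarrow> nat \<Rightarrow> nat" where
  "target q b = (if b < 39 then 39 * q + b else if b = 39 then 39 * (q + 1) else 39 * (q + C) + 3)"

text \<open>Phrased by div and mod on vertex numbers, so that the edge relation can be evaluated
  arithmetically; \<open>edgeI\<close> and \<open>edgeE\<close> translate it into rows, columns and
  local vertices.\<close>

definition link :: "nat \<Rightarrow> nat \<Rightarrow> bool" where
  "link u v \<longleftrightarrow> (\<exists>z \<in> set local_edges. u mod 39 = fst (snd z) \<and> v = target (u div 39) (snd (snd z)) \<and>
     active (fst z) (u div 39 div C) (u div 39 mod C))"

definition E :: "nat set set" where
  "E = {{u, v} | u v. u < NV \<and> link u v}"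

definition vx :: "nat \<Rightarrow> nat \<Rightarrow> nat \<Rightarrow> nat" where
  "vx r s l = 39 * (r * C + s) + l"

definition xv :: "nat \<Rightarrow> nat \<Rightarrow> nat \<Rightarrow> nat" where
  "xv r s b = (if b < 39 then vx r s b else if b = 39 then vx r (s + 1) 0 else vx (r + 1) s 3)"

lemma target_eq: "target (r * C + s) b = xv r s b"
  by (simp add: target_def xv_def vx_def algebra_simps)

lemma vx_div:
  assumes "l < 39"
  shows "vx r s l div 39 = r * C + s" "vx r s l mod 39 = l"
proof -
  have "(39 * q + l) div 39 = q" "(39 * q + l) mod 39 = l" for q using assms by simp_all
  then show "vx r s l div 39 = r * C + s" "vx r s l mod 39 = l" by (simp_all only: vx_def)
qed

lemma cell_div:
  assumes "s < C"
  shows "(r * C + s) div C = r" "(r * C + s) mod C = s"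
  using assms by simp_all

lemma vx_less:
  assumes "r \<le> n" "s < C" "l < 39"
  shows "vx r s l < NV"
proof -
  have "r * C + s < (n + 1) * C"
  proof -
    have "r * C \<le> n * C" "(n + 1) * C = n * C + C" using assms(1) by (simp_all add: mult_le_mono1)
    then show ?thesis using assms(2) by linarith
  qed
  then have "r * C + s + 1 \<le> (n + 1) * C" by simp
  from mult_le_mono2[OF this, of 39] show ?thesis
    using assms(3) by (simp add: vx_def NV_def)
qed

lemma NV_cases:
  assumes "v < NV"
  obtains r s l where "r \<le> n" "s < C" "l < 39" "v = vx r s l"
proof
  have C0: "0 < C" by (simp add: C_def)
  have q: "v div 39 < (n + 1) * C" using assms by (simp add: NV_def less_mult_imp_div_less mult.commute)
  show "v div 39 div C \<le> n" using less_mult_imp_div_less[OF q] by simp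
  show "v div 39 mod C < C" using C0 by simp
  show "v mod 39 < 39" by simp
  show "v = vx (v div 39 div C) (v div 39 mod C) (v mod 39)"
  proof -
    have "v div 39 div C * C + v div 39 mod C = v div 39" by (rule div_mult_mod_eq)
    then show ?thesis unfolding vx_def by simp
  qed
qed

lemma local_edges_facts:
  assumes "(fl, a, b) \<in> set local_edges"
  shows "a < 39" "b < 41" "a < b" "39 \<le> b \<Longrightarrow> fl = 1" "fl < 4"
proof -
  have "\<forall>z\<in>set local_edges. fst (snd z) < 39 \<and> snd (snd z) < 41 \<and> fst (snd z) < snd (snd z) \<and>
    (39 \<le> snd (snd z) \<longrightarrow> fst z = 1) \<and> fst z < 4"
    by code_simp
  then show "a < 39" "b < 41" "a < b" "39 \<le> b \<Longrightarrow> fl = 1" "fl < 4"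
    using assms by fastforce+
qed

end

locale grid = grid_graph +
  assumes n4: "4 \<le> n" and adj_less: "adj i j \<Longrightarrow> i < n \<and> j < n"
begin

lemma active_1: "active 1 r s \<Longrightarrow> r < n \<and> s + 1 < C"
  using n4 by (auto simp: active_def C_def split: if_splits)

lemma xv_cell:
  assumes "(fl, a, b) \<in> set local_edges" "active fl r s" "r \<le> n" "s < C"
  obtains r' s' l where "r' \<le> n" "s' < C" "l < 39" "xv r s b = vx r' s' l"
proof (cases "b < 39")
  case True
  then show ?thesis using assms that[of r s b] by (simp add: xv_def)
next
  case False
  then have "r < n" "s + 1 < C"
    using active_1 local_edges_facts(4)[OF assms(1)] assms(2) by auto
  then show ?thesis
    using False assms that[of r "s + 1" 0] that[of "r + 1" s 3]
    by (cases "b = 39") (simp_all add: xv_def)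
qed

lemma edgeI:
  assumes "(fl, a, b) \<in> set local_edges" "active fl r s" "r \<le> n" "s < C"
  shows "{vx r s a, xv r s b} \<in> E"
proof -
  have a: "a < 39" using local_edges_facts[OF assms(1)] by simp
  have "link (vx r s a) (xv r s b)"
    unfolding link_def
    by (rule bexI[OF _ assms(1)]) (use assms in \<open>simp add: vx_div[OF a] cell_div target_eq\<close>)
  then show ?thesis using vx_less[OF assms(3,4) a] by (auto simp: E_def)
qed

lemma edgeE:
  assumes "e \<in> E"
  obtains fl a b r s where "(fl, a, b) \<in> set local_edges" "active fl r s" "r \<le> n" "s < C"
    "e = {vx r s a, xv r s b}"
proof -
  obtain u v where uv: "e = {u, v}" "u < NV" "link u v" using assms by (auto simp: E_def)
  obtain r s l where u: "r \<le> n" "s < C" "l < 39" "u = vx r s l" using NV_cases[OF uv(2)] .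
  obtain fl a b where "(fl, a, b) \<in> set local_edges" "u mod 39 = a" "v = target (u div 39) b"
    "active fl (u div 39 div C) (u div 39 mod C)"
    using uv(3) unfolding link_def by auto
  then show ?thesis
    using that[of fl a b r s] u uv(1) by (simp add: vx_div cell_div target_eq)
qed

lemma vx_inject:
  assumes "s < C" "l < 39" "s' < C" "l' < 39" "vx r s l = vx r' s' l'"
  shows "r = r'" "s = s'" "l = l'"
  using assms vx_div[of l r s] vx_div[of l' r' s'] cell_div[of s r] cell_div[of s' r'] by auto

lemma simple: "simple_graph {..<NV} E"
  unfolding simple_graph_def
proof (intro conjI ballI)
  fix e assume "e \<in> E"
  then obtain fl a b r s where e: "(fl, a, b) \<in> set local_edges" "active fl r s" "r \<le> n" "s < C"
    "e = {vx r s a, xv r s b}" by (rule edgeE)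
  note f = local_edges_facts[OF e(1)]
  obtain r' s' l where x: "r' \<le> n" "s' < C" "l < 39" "xv r s b = vx r' s' l"
    using xv_cell[OF e(1-4)] .
  show "e \<subseteq> {..<NV}" using e vx_less[OF e(3,4) f(1)] vx_less[OF x(1-3)] x(4) by simp
  have "vx r s a \<noteq> xv r s b"
  proof (cases "b < 39")
    case True
    then show ?thesis using f by (simp add: xv_def vx_def)
  next
    case False
    then have "s + 1 < C" using active_1 f(4) e(2) by auto
    then show ?thesis using False vx_inject[OF e(4) f(1), of "s + 1" 0 r r]
        vx_inject[OF e(4) f(1), of s 3 r "r + 1"] e(4) by (auto simp: xv_def)
  qed
  then show "card e = 2" by (simp add: e(5))
qed simp

section \<open>Colorings of the grid graph\<close>

definition admissible :: "(nat \<Rightarrow> nat) \<Rightarrow> bool" where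
  "admissible h \<longleftrightarrow> (\<forall>i. h i \<in> {1..3}) \<and> (\<forall>i j. adj i j \<longrightarrow> h i \<noteq> h j)"

text \<open>Left of column \<open>M\<close> only rows 0 and 3 carry a color; everything else there
  is colored as if rows and columns had color 1. So if h gives rows 0 and 3 color 1, this part
  agrees with the initial coloring.\<close>

definition row_col :: "(nat \<Rightarrow> nat) \<Rightarrow> nat \<Rightarrow> nat \<Rightarrow> nat" where
  "row_col h r s = (if M \<le> s \<or> r = 0 \<or> r = 3 then h r else 1)"

definition col_col :: "(nat \<Rightarrow> nat) \<Rightarrow> nat \<Rightarrow> nat" where
  "col_col h s = (if s < M then 1 else h (s - M))"

definition core_col :: "(nat \<Rightarrow> nat) \<Rightarrow> nat \<Rightarrow> nat" where
  "core_col h t = cell_col (row_col h (t div 13 div C) (t div 13 mod C)) (col_col h (t div 13 mod C)) ! (t mod 13)"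

definition grid_col :: "(nat \<Rightarrow> nat) \<Rightarrow> nat \<Rightarrow> nat" where
  "grid_col h v = rot (core_col h (v div 3)) (v mod 3)"

lemma mod39: "v mod 39 div 3 = v div 3 mod 13" "v mod 39 mod 3 = v mod (3 :: nat)"
  using mod_mult2_eq[of v 3 13] by simp_all

lemma grid_col_vx:
  assumes "s < C" "l < 39"
  shows "grid_col h (vx r s l) = ext_col (row_col h r s) (col_col h s) l"
proof -
  let ?v = "vx r s l"
  have "?v div 3 div 13 = r * C + s" using vx_div(1)[OF assms(2)] by (simp add: div_mult2_eq[symmetric])
  moreover have "?v div 3 mod 13 = l div 3" "?v mod 3 = l mod 3"
    using mod39[of ?v] vx_div(2)[OF assms(2), of r s] by simp_all
  ultimately show ?thesis
    using assms by (simp add: grid_col_def core_col_def ext_col_def cell_div)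
qed

lemma admissible_range:
  assumes "admissible h"
  shows "row_col h r s \<in> {1, 2, 3}" "col_col h s \<in> {1, 2, 3}"
proof -
  have "h i \<in> {1, 2, 3}" for i
  proof -
    have "h i \<in> {1..3}" using assms by (simp add: admissible_def)
    then show ?thesis by auto
  qed
  then show "row_col h r s \<in> {1, 2, 3}" "col_col h s \<in> {1, 2, 3}"
    by (simp_all add: row_col_def col_col_def)
qed

lemma core_col_range:
  assumes "admissible h"
  shows "core_col h t \<in> {1..3}"
proof -
  let ?l = "cell_col (row_col h (t div 13 div C) (t div 13 mod C)) (col_col h (t div 13 mod C))"
  have "list_all (\<lambda>c. c \<in> {1..3}) ?l"
    using cell_col_range admissible_range[OF assms] by blast
  moreover have "length ?l = 13" by (simp add: cell_col_def)
  ultimately show ?thesis by (simp add: core_col_def list_all_length)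
qed

lemma nx_range: "nx a \<in> {1..3}"
  by (auto simp: nx_def)

lemma grid_col_proper:
  assumes h: "admissible h"
  shows "proper_coloring {..<NV} E 3 (grid_col h)"
  unfolding proper_coloring_def
proof (intro conjI ballI impI)
  show "coloring {..<NV} 3 (grid_col h)"
    unfolding coloring_def grid_col_def rot_def using core_col_range[OF h] nx_range by simp
next
  fix u v assume "{u, v} \<in> E"
  then obtain fl a b r s where e: "(fl, a, b) \<in> set local_edges" "active fl r s" "r \<le> n" "s < C"
    "{u, v} = {vx r s a, xv r s b}" by (rule edgeE)
  note f = local_edges_facts[OF e(1)]
  let ?A = "row_col h r s" and ?B = "col_col h s"
  have a: "grid_col h (vx r s a) = ext_col ?A ?B a" using grid_col_vx[OF e(4) f(1)] .
  have b: "grid_col h (xv r s b) = ext_col ?A ?B b"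
  proof (cases "b < 39")
    case True
    then show ?thesis using grid_col_vx[OF e(4)] by (simp add: xv_def)
  next
    case False
    then have fl: "fl = 1" using f by simp
    have sc: "s + 1 < C" using active_1 e(2) fl by simp
    show ?thesis
    proof (cases "b = 39")
      case True
      then have "grid_col h (xv r s b) = row_col h r (s + 1)"
        using grid_col_vx[OF sc, of 0 h r] by (simp add: xv_def ext_col_def rot_def cell_col_def)
      \<comment> \<open>Crossing the border to column \<open>M\<close> does not change the row
        color, since left of it only rows 0 and 3 contain crossovers.\<close>
      also have "\<dots> = ?A" using e(2) by (auto simp: fl active_def row_col_def split: if_splits)
      finally show ?thesis using True by (simp add: ext_col_def)
    next
      case False
      with \<open>\<not> b < 39\<close> f have "b = 40" by simp
      then show ?thesis
        using grid_col_vx[OF e(4), of 3 h "r + 1"] by (simp add: xv_def ext_col_def rot_def cell_col_def)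
    qed
  qed
  have "fl = 2 \<longrightarrow> ?A \<noteq> ?B" "fl = 3 \<longrightarrow> ?A = ?B"
    using e(2) h by (auto simp: active_def row_col_def col_col_def admissible_def)
  then have "ext_col ?A ?B a \<noteq> ext_col ?A ?B b"
    using ext_col_proper admissible_range[OF h] e(1) by blast
  then show "grid_col h u \<noteq> grid_col h v"
    using a b e(5) by (auto simp: doubleton_eq_iff)
qed

lemma cross_mem: "(a, b) \<in> set cross_edges \<Longrightarrow> (1, a, b) \<in> set local_edges"
  by (auto simp: local_edges_def)

lemma proper_edge:
  assumes k: "proper_coloring {..<NV} E 3 k"
    and e: "(fl, a, b) \<in> set local_edges" "active fl r s" "r \<le> n" "s < C"
  shows "k (vx r s a) \<noteq> k (xv r s b)"
proof -
  obtain r' s' l where x: "r' \<le> n" "s' < C" "l < 39" "xv r s b = vx r' s' l"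
    using xv_cell[OF e] .
  show ?thesis
    using k edgeI[OF e] vx_less[OF e(3,4) local_edges_facts(1)[OF e(1)]] vx_less[OF x(1-3)] x(4)
    by (auto simp: proper_coloring_def)
qed

lemma proper_cross:
  assumes k: "proper_coloring {..<NV} E 3 k" and act: "active 1 r s" "r \<le> n" "s < C"
  shows "k (vx r (s + 1) 0) = k (vx r s 0)" "k (vx (r + 1) s 3) = k (vx r s 3)"
proof -
  have rs: "r < n" "s + 1 < C" using active_1[OF act(1)] by auto
  have "xv r s 39 = vx r (s + 1) 0" "xv r s 40 = vx (r + 1) s 3" "xv r s 0 = vx r s 0" "xv r s 3 = vx r s 3"
    by (simp_all add: xv_def)
  moreover have "k (xv r s 39) = k (xv r s 0) \<and> k (xv r s 40) = k (xv r s 3)"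
  proof (rule crossover[of "\<lambda>l. k (xv r s l)"])
    fix l :: nat assume l: "l < 41"
    have "xv r s l < NV"
      using vx_less[of r s l] vx_less[of r "s + 1" 0] vx_less[of "r + 1" s 3] rs act(2,3)
      by (simp add: xv_def)
    then show "k (xv r s l) \<in> {1..3}" using k by (simp add: proper_coloring_def coloring_def)
  next
    fix a b assume ab: "(a, b) \<in> set cross_edges"
    have "a < 39" using local_edges_facts(1)[OF cross_mem[OF ab]] .
    then have "xv r s a = vx r s a" by (simp add: xv_def)
    then show "k (xv r s a) \<noteq> k (xv r s b)"
      using proper_edge[OF k cross_mem[OF ab] act] by simp
  qed
  ultimately show "k (vx r (s + 1) 0) = k (vx r s 0)" "k (vx (r + 1) s 3) = k (vx r s 3)" by simp_all
qed

text \<open>The vertices 33 and 36 are adjacent and both are joined to 0 and to 3, which leaves the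
  same single color for 0 and 3.\<close>

lemma proper_equal:
  assumes k: "proper_coloring {..<NV} E 3 k" and act: "active 3 r s" "r \<le> n" "s < C"
  shows "k (vx r s 0) = k (vx r s 3)"
proof -
  have m: "(3, 0, 33) \<in> set local_edges" "(3, 0, 36) \<in> set local_edges" "(3, 33, 36) \<in> set local_edges"
    "(3, 3, 33) \<in> set local_edges" "(3, 3, 36) \<in> set local_edges"
    by (simp_all add: local_edges_def equal_edges_def)
  have rng: "k (vx r s l) = 1 \<or> k (vx r s l) = 2 \<or> k (vx r s l) = 3" if "l < 39" for l
  proof -
    have "k (vx r s l) \<in> {1..3}"
      using k vx_less[OF act(2,3) that] by (simp add: proper_coloring_def coloring_def)
    then show ?thesis by auto
  qed
  have "k (vx r s 0) \<noteq> k (vx r s 33)" "k (vx r s 0) \<noteq> k (vx r s 36)" "k (vx r s 33) \<noteq> k (vx r s 36)"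
    "k (vx r s 3) \<noteq> k (vx r s 33)" "k (vx r s 3) \<noteq> k (vx r s 36)"
    using proper_edge[OF k m(1) act] proper_edge[OF k m(2) act] proper_edge[OF k m(3) act]
      proper_edge[OF k m(4) act] proper_edge[OF k m(5) act] by (simp_all add: xv_def)
  then show ?thesis using rng[of 0] rng[of 3] rng[of 33] rng[of 36] by (simp, metis)
qed

text \<open>Column \<open>M\<close> is the first one that all rows pass with crossovers. The value 1
  for other indices meets the range condition that \<open>admissible\<close> puts on every
  argument.\<close>

definition read_rows :: "(nat \<Rightarrow> nat) \<Rightarrow> nat \<Rightarrow> nat" where
  "read_rows k i = (if i < n then k (vx i M 0) else 1)"

lemma row_right:
  assumes k: "proper_coloring {..<NV} E 3 k" and "i < n" "j \<le> n"
  shows "k (vx i (M + j) 0) = k (vx i M 0)"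
  using assms(3)
proof (induction j)
  case (Suc j)
  have "active 1 i (M + j)" using assms(2) Suc by (simp add: active_def)
  from proper_cross(1)[OF k this] show ?case using Suc assms(2) by (simp add: C_def)
qed simp

lemma row_left:
  assumes k: "proper_coloring {..<NV} E 3 k" and i: "i = 0 \<or> i = 3" and "j \<le> M"
  shows "k (vx i (M - j) 0) = k (vx i M 0)"
  using assms(3)
proof (induction j)
  case (Suc j)
  have "active 1 i (M - Suc j)" using i Suc by (auto simp: active_def)
  from proper_cross(1)[OF k this] show ?case
    using Suc i n4 by (auto simp: C_def Suc_diff_Suc)
qed simp

lemma column:
  assumes k: "proper_coloring {..<NV} E 3 k" and "j < n" "i \<le> n"
  shows "k (vx i (M + j) 3) = k (vx 0 (M + j) 3)"
  using assms(3)
proof (induction i)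
  case (Suc i)
  have "active 1 i (M + j)" using assms(2) Suc by (simp add: active_def)
  from proper_cross(2)[OF k this] show ?case using Suc assms(2) by (simp add: C_def)
qed simp

text \<open>Crossovers carry the color of a row to the right and the color of a column downwards. On
  the diagonal, row j and column j get the same color, and for adjacent i and j the edge in the cell
  of row i and column j separates the color of row i from that of column j.\<close>

lemma read_rows_admissible:
  assumes k: "proper_coloring {..<NV} E 3 k"
  shows "admissible (read_rows k)"
  unfolding admissible_def
proof (intro conjI allI impI)
  fix i show "read_rows k i \<in> {1..3}"
  proof (cases "i < n")
    case True
    then have "vx i M 0 < NV" by (intro vx_less) (auto simp: C_def)
    then show ?thesis using True k by (simp add: read_rows_def proper_coloring_def coloring_def)
  qed (simp add: read_rows_def)
next
  fix i j assume a: "adj i j"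
  then have ij: "i < n" "j < n" using adj_less by auto
  have "k (vx i (M + j) 0) \<noteq> k (xv i (M + j) 3)"
    by (rule proper_edge[OF k, of 2]) (use a ij in \<open>auto simp: local_edges_def active_def C_def\<close>)
  moreover have "k (vx j (M + j) 0) = k (vx j (M + j) 3)"
    by (rule proper_equal[OF k]) (use ij in \<open>auto simp: active_def C_def\<close>)
  ultimately have "k (vx i M 0) \<noteq> k (vx j M 0)"
    using row_right[OF k, of i j] row_right[OF k, of j j] column[OF k, of j i] column[OF k, of j j] ij
    by (simp add: xv_def)
  then show "read_rows k i \<noteq> read_rows k j" using ij by (simp add: read_rows_def)
qed


end

section \<open>Straight line drawings\<close>

definition planar_orient :: "complex \<Rightarrow> complex \<Rightarrow> complex \<Rightarrow> real" where
  "planar_orient a b c = (Re b - Re a) * (Im c - Im a) - (Im b - Im a) * (Re c - Re a)"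

text \<open>\<open>planar_orient a b\<close> is an affine function of its last point, so along a
  segment it interpolates between its values at the ends.\<close>

lemma planar_orient_segment:
  assumes "z \<in> closed_segment c d"
  obtains u where "0 \<le> u" "u \<le> 1"
    "planar_orient a b z = (1 - u) * planar_orient a b c + u * planar_orient a b d"
    "z = (1 - u) *\<^sub>R c + u *\<^sub>R d"
proof -
  obtain u where u: "0 \<le> u" "u \<le> 1" "z = (1 - u) *\<^sub>R c + u *\<^sub>R d"
    using assms by (auto simp: closed_segment_def)
  have "planar_orient a b z = (1 - u) * planar_orient a b c + u * planar_orient a b d"
    unfolding u(3) planar_orient_def by (simp add: algebra_simps)
  with u that show ?thesis by blast
qed

lemma planar_orient_on_segment:
  assumes "z \<in> closed_segment a b"
  shows "planar_orient a b z = 0"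
  by (rule planar_orient_segment[OF assms, of a b]) (simp add: planar_orient_def)

lemma segments_disjoint:
  assumes "planar_orient a b c * planar_orient a b d > 0"
  shows "closed_segment a b \<inter> closed_segment c d = {}"
proof (rule ccontr)
  assume "closed_segment a b \<inter> closed_segment c d \<noteq> {}"
  then obtain z where z: "z \<in> closed_segment a b" "z \<in> closed_segment c d" by auto
  obtain u where u: "0 \<le> u" "u \<le> 1"
    "planar_orient a b z = (1 - u) * planar_orient a b c + u * planar_orient a b d"
    using planar_orient_segment[OF z(2)] by metis
  define p where "p = planar_orient a b c"
  define q where "q = planar_orient a b d"
  have 0: "(1 - u) * p + u * q = 0"
    using u(3) planar_orient_on_segment[OF z(1)] by (simp add: p_def q_def)
  have pq: "p * q > 0" using assms by (simp add: p_def q_def)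
  have "((1 - u) * p + u * q) * p = (1 - u) * (p * p) + u * (p * q)" by (simp add: algebra_simps)
  then have s: "(1 - u) * (p * p) + u * (p * q) = 0" using 0 by simp
  have pp: "p * p > 0" using pq by (metis mult_zero_left not_real_square_gt_zero order_less_irrefl)
  have "(1 - u) * (p * p) \<ge> 0" "u * (p * q) \<ge> 0" using u pp pq by simp_all
  then have "(1 - u) * (p * p) = 0" "u * (p * q) = 0" using s by linarith+
  then show False using pp pq by auto
qed

lemma segments_common_end:
  assumes "planar_orient v a b \<noteq> 0"
  shows "closed_segment v a \<inter> closed_segment v b \<subseteq> {v}"
proof
  fix z assume z: "z \<in> closed_segment v a \<inter> closed_segment v b"
  then obtain u where u: "planar_orient v a z = (1 - u) * planar_orient v a v + u * planar_orient v a b"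
    "z = (1 - u) *\<^sub>R v + u *\<^sub>R b"
    using planar_orient_segment[of z v b v a] by (metis IntD2)
  have "planar_orient v a v = 0" by (simp add: planar_orient_def)
  then have "u = 0" using u(1) planar_orient_on_segment[of z v a] z assms by auto
  then show "z \<in> {v}" using u(2) by simp
qed

lemma convex_comb_le_eq:
  fixes a b t u :: real
  assumes "0 \<le> u" "u \<le> 1" "a \<le> t" "b \<le> t" "\<not> (a = t \<and> b = t)" "(1 - u) * a + u * b \<ge> t"
  shows "u = 0 \<or> u = 1"
proof (rule ccontr)
  assume "\<not> (u = 0 \<or> u = 1)"
  then have u: "0 < u" "0 < 1 - u" using assms by auto
  have le: "(1 - u) * a \<le> (1 - u) * t" "u * b \<le> u * t" using u assms by simp_all
  have "(1 - u) * a < (1 - u) * t \<or> u * b < u * t" using u assms by auto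
  then have "(1 - u) * a + u * b < (1 - u) * t + u * t" using le by linarith
  then show False using assms(6) by (simp add: algebra_simps)
qed

text \<open>The axis-parallel line with coordinate t has one segment on each side. A common point
  lies on this line, and a segment that is not contained in the line reaches it in an end
  only.\<close>

lemma segments_separated:
  fixes \<phi> :: "complex \<Rightarrow> real"
  assumes \<phi>: "\<phi> = Re \<or> \<phi> = Im"
    and l: "\<phi> a \<le> t" "\<phi> b \<le> t" "\<not> (\<phi> a = t \<and> \<phi> b = t)"
    and r: "t \<le> \<phi> c" "t \<le> \<phi> d" "\<not> (\<phi> c = t \<and> \<phi> d = t)"
    and z: "z \<in> closed_segment a b" "z \<in> closed_segment c d"
  shows "z \<in> {a, b} \<and> z \<in> {c, d}"
proof -
  obtain u where u: "0 \<le> u" "u \<le> 1" "z = (1 - u) *\<^sub>R a + u *\<^sub>R b"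
    using z by (auto simp: closed_segment_def)
  obtain v where v: "0 \<le> v" "v \<le> 1" "z = (1 - v) *\<^sub>R c + v *\<^sub>R d"
    using z by (auto simp: closed_segment_def)
  have pu: "\<phi> z = (1 - u) * \<phi> a + u * \<phi> b" using \<phi> unfolding u(3) by auto
  have pv: "\<phi> z = (1 - v) * \<phi> c + v * \<phi> d" using \<phi> unfolding v(3) by auto
  have "\<phi> z \<le> t"
  proof -
    have "(1 - u) * \<phi> a \<le> (1 - u) * t" "u * \<phi> b \<le> u * t"
      using u l by (simp_all add: mult_left_mono)
    then show ?thesis unfolding pu by (simp add: algebra_simps)
  qed
  moreover have "t \<le> \<phi> z"
  proof -
    have "(1 - v) * t \<le> (1 - v) * \<phi> c" "v * t \<le> v * \<phi> d"
      using v r by (simp_all add: mult_left_mono)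
    then show ?thesis unfolding pv by (simp add: algebra_simps)
  qed
  ultimately have "\<phi> z = t" by simp
  then have "u = 0 \<or> u = 1" "v = 0 \<or> v = 1"
    using convex_comb_le_eq[OF u(1,2) l] convex_comb_le_eq[OF v(1,2), of "- \<phi> c" "- t" "- \<phi> d"] pu pv r
    by auto
  then show ?thesis using u(3) v(3) by auto
qed

text \<open>Only pairs of edges need to be inspected. Since every vertex lies on some edge, an edge
  passing through a foreign vertex would meet an edge at that vertex in a point that is not an end
  of its own. \<open>Min\<close> and \<open>Max\<close> merely fix a direction of each edge.\<close>

lemma planar_straight:
  fixes p :: "nat \<Rightarrow> complex"
  assumes G: "simple_graph V E" and inj: "inj_on p V"
    and deg: "\<And>v. v \<in> V \<Longrightarrow> \<exists>e\<in>E. v \<in> e"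
    and ends: "\<And>a b c d z. {a, b} \<in> E \<Longrightarrow> {c, d} \<in> E \<Longrightarrow> {a, b} \<noteq> {c, d} \<Longrightarrow>
      z \<in> closed_segment (p a) (p b) \<Longrightarrow> z \<in> closed_segment (p c) (p d) \<Longrightarrow> z \<in> {p a, p b} \<and> z \<in> {p c, p d}"
  shows "planar V E"
proof -
  define \<gamma> where "\<gamma> e = linepath (p (Min e)) (p (Max e))" for e
  have edge: "\<exists>a b. e = {a, b} \<and> a \<noteq> b \<and> Min e = a \<and> Max e = b \<and> a \<in> V \<and> b \<in> V" if e: "e \<in> E" for e
  proof -
    have "e \<subseteq> V" "card e = 2" using G e by (auto simp: simple_graph_def)
    then obtain a b where "e = {a, b}" "a \<noteq> b" by (auto simp: card_2_iff)
    then show ?thesis using \<open>e \<subseteq> V\<close> by (cases "a < b") (auto simp: doubleton_eq_iff)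
  qed
  have cut: "path_image (\<gamma> e) \<inter> path_image (\<gamma> f) = p ` (e \<inter> f)" if ef: "e \<in> E" "f \<in> E" "e \<noteq> f" for e f
  proof -
    obtain a b where e: "e = {a, b}" "a \<noteq> b" "Min e = a" "Max e = b" "a \<in> V" "b \<in> V"
      using edge[OF ef(1)] by blast
    obtain c d where f: "f = {c, d}" "c \<noteq> d" "Min f = c" "Max f = d" "c \<in> V" "d \<in> V"
      using edge[OF ef(2)] by blast
    show ?thesis
    proof
      show "path_image (\<gamma> e) \<inter> path_image (\<gamma> f) \<subseteq> p ` (e \<inter> f)"
      proof
        fix z assume "z \<in> path_image (\<gamma> e) \<inter> path_image (\<gamma> f)"
        then have "z \<in> closed_segment (p a) (p b)" "z \<in> closed_segment (p c) (p d)"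
          by (auto simp: \<gamma>_def e(3,4) f(3,4))
        then have "z \<in> {p a, p b} \<and> z \<in> {p c, p d}"
          using ends[of a b c d z] ef e(1) f(1) by simp
        then have "\<exists>x\<in>e. z = p x" "\<exists>y\<in>f. z = p y" using e(1) f(1) by auto
        then obtain x y where xy: "x \<in> e" "y \<in> f" "z = p x" "z = p y" by blast
        have "x \<in> V" "y \<in> V" using xy e f by auto
        then have "x = y" using inj xy by (auto dest: inj_onD)
        then show "z \<in> p ` (e \<inter> f)" using xy by auto
      qed
      show "p ` (e \<inter> f) \<subseteq> path_image (\<gamma> e) \<inter> path_image (\<gamma> f)"
        using e f by (auto simp: \<gamma>_def)
    qed
  qed
  have "arc (\<gamma> e) \<and> {pathstart (\<gamma> e), pathfinish (\<gamma> e)} = p ` e \<and> path_image (\<gamma> e) \<inter> p ` V = p ` e"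
    if eE: "e \<in> E" for e
  proof (intro conjI)
    obtain a b where e: "e = {a, b}" "a \<noteq> b" "Min e = a" "Max e = b" "a \<in> V" "b \<in> V"
      using edge[OF eE] by blast
    have "p a \<noteq> p b" using e inj by (auto dest: inj_onD)
    then show "arc (\<gamma> e)" by (simp add: \<gamma>_def e(3,4))
    show "{pathstart (\<gamma> e), pathfinish (\<gamma> e)} = p ` e" unfolding \<gamma>_def e(3,4) by (simp add: e(1))
    show "path_image (\<gamma> e) \<inter> p ` V = p ` e"
    proof
      show "p ` e \<subseteq> path_image (\<gamma> e) \<inter> p ` V" unfolding \<gamma>_def e(3,4) using e by (auto simp: e(1))
      show "path_image (\<gamma> e) \<inter> p ` V \<subseteq> p ` e"
      proof
        fix z assume z: "z \<in> path_image (\<gamma> e) \<inter> p ` V"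
        then obtain v where v: "v \<in> V" "z = p v" by auto
        obtain f where f: "f \<in> E" "v \<in> f" using deg[OF v(1)] by blast
        show "z \<in> p ` e"
        proof (cases "e = f")
          case False
          obtain c d where fd: "f = {c, d}" "Min f = c" "Max f = d" using edge[OF f(1)] by blast
          have "z \<in> path_image (\<gamma> f)" unfolding \<gamma>_def fd(2,3) using f(2) fd(1) v(2) by auto
          then show ?thesis using cut[OF eE f(1) False] z by auto
        qed (use f v in auto)
      qed
    qed
  qed
  then show ?thesis
    unfolding planar_def using inj cut by (intro exI[of _ p] exI[of _ \<gamma>]) blast
qed

context grid
begin

definition cell_pt :: "nat \<Rightarrow> nat \<Rightarrow> nat \<Rightarrow> complex" where
  "cell_pt r s l = Complex (of_int (20 * int s + fst (cell_pos ! l))) (of_int (20 * int r + snd (cell_pos ! l)))"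

definition pt :: "nat \<Rightarrow> complex" where
  "pt v = cell_pt (v div 39 div C) (v div 39 mod C) (v mod 39)"

lemma pt_vx: "s < C \<Longrightarrow> l < 39 \<Longrightarrow> pt (vx r s l) = cell_pt r s l"
  unfolding pt_def by (simp add: vx_div cell_div)

text \<open>The points 39 and 40, at (20, 10) and (10, 20), are the points of the local vertices 0
  and 3, at (0, 10) and (10, 0), in the neighboring cells.\<close>

lemma pt_xv:
  assumes "(fl, a, b) \<in> set local_edges" "active fl r s" "s < C"
  shows "pt (xv r s b) = cell_pt r s b"
proof (cases "b < 39")
  case True
  then show ?thesis using pt_vx[OF assms(3)] by (simp add: xv_def)
next
  case False
  note f = local_edges_facts[OF assms(1)]
  have sc: "s + 1 < C" using active_1 f(4) assms(2) False by auto
  show ?thesis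
  proof (cases "b = 39")
    case True
    then show ?thesis using pt_vx[OF sc, of 0 r] by (simp add: xv_def cell_pt_def cell_pos_def)
  next
    case False
    with \<open>\<not> b < 39\<close> f have "b = 40" by simp
    then show ?thesis using pt_vx[OF assms(3), of 3 "r + 1"] by (simp add: xv_def cell_pt_def cell_pos_def)
  qed
qed

lemma coordinate_inject:
  fixes a b :: int
  assumes "20 * int s + a = 20 * int s' + b" "0 \<le> a" "a < 20" "0 \<le> b" "b < 20"
  shows "s = s'" "a = b"
proof -
  show "s = s'" using assms by linarith
  then show "a = b" using assms(1) by simp
qed

text \<open>Local vertices below 39 have coordinates from 0 to 19, so quotient and remainder by 20
  recover the cell and the local position.\<close>

lemma pt_inj: "inj_on pt {..<NV}"
proof (rule inj_onI)
  fix u v assume uv: "u \<in> {..<NV}" "v \<in> {..<NV}" "pt u = pt v"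
  obtain r s l where u: "r \<le> n" "s < C" "l < 39" "u = vx r s l" using NV_cases[of u] uv(1) by auto
  obtain r' s' l' where v: "r' \<le> n" "s' < C" "l' < 39" "v = vx r' s' l'" using NV_cases[of v] uv(2) by auto
  have e: "20 * int s + fst (cell_pos ! l) = 20 * int s' + fst (cell_pos ! l')"
    "20 * int r + snd (cell_pos ! l) = 20 * int r' + snd (cell_pos ! l')"
    using uv(3) pt_vx[OF u(2,3)] pt_vx[OF v(2,3)] u(4) v(4)
    unfolding cell_pt_def by (simp_all only: complex.inject of_int_eq_iff)
  have b: "0 \<le> fst (cell_pos ! l)" "fst (cell_pos ! l) < 20" "0 \<le> snd (cell_pos ! l)" "snd (cell_pos ! l) < 20"
    if "l < 39" for l
    using cell_pos_distinct(3) that by auto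
  have "s = s'" "fst (cell_pos ! l) = fst (cell_pos ! l')"
    using coordinate_inject[OF e(1) b(1,2)[OF u(3)] b(1,2)[OF v(3)]] by auto
  moreover have "r = r'" "snd (cell_pos ! l) = snd (cell_pos ! l')"
    using coordinate_inject[OF e(2) b(3,4)[OF u(3)] b(3,4)[OF v(3)]] by auto
  ultimately have "cell_pos ! l = cell_pos ! l'" by (simp add: prod_eq_iff)
  then have "l = l'" using cell_pos_distinct(1,2) u(3) v(3) by (simp add: nth_eq_iff_index_eq)
  then show "u = v" using u v \<open>s = s'\<close> \<open>r = r'\<close> by simp
qed

lemma orient_cell_pt:
  "planar_orient (cell_pt r s a) (cell_pt r s b) (cell_pt r s c) =
    of_int (orient (cell_pos ! a) (cell_pos ! b) (cell_pos ! c))"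
proof -
  have "orient A B D = (fst B - fst A) * (snd D - snd A) - (snd B - snd A) * (fst D - fst A)" for A B D
    by (cases A; cases B; cases D) simp
  then show ?thesis by (simp add: planar_orient_def cell_pt_def)
qed

lemma same_cell:
  assumes e: "(fl, a, b) \<in> set local_edges" "(fl', c, d) \<in> set local_edges" "(a, b) \<noteq> (c, d)"
    and z: "z \<in> closed_segment (cell_pt r s a) (cell_pt r s b)" "z \<in> closed_segment (cell_pt r s c) (cell_pt r s d)"
  shows "z \<in> {cell_pt r s a, cell_pt r s b} \<and> z \<in> {cell_pt r s c, cell_pt r s d}"
proof -
  let ?p = "cell_pt r s" and ?q = "\<lambda>l. cell_pos ! l"
  have ap: "apart (a, b) (c, d)" using local_apart e by fastforce
  have z': "z \<in> closed_segment (?p b) (?p a)" "z \<in> closed_segment (?p d) (?p c)"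
    using z by (simp_all add: closed_segment_commute)
  have end1: "z = ?p v" if "orient (?q v) (?q x) (?q y) \<noteq> 0" "z \<in> closed_segment (?p v) (?p x)"
    "z \<in> closed_segment (?p v) (?p y)" for v x y
    using segments_common_end[of "?p v" "?p x" "?p y"] that by (auto simp: orient_cell_pt)
  have dis: False if "orient (?q a') (?q b') (?q c') * orient (?q a') (?q b') (?q d') > 0"
    "z \<in> closed_segment (?p a') (?p b')" "z \<in> closed_segment (?p c') (?p d')" for a' b' c' d'
  proof -
    have "planar_orient (?p a') (?p b') (?p c') * planar_orient (?p a') (?p b') (?p d') > 0"
      using that(1) unfolding orient_cell_pt of_int_mult[symmetric] of_int_0_less_iff .
    from segments_disjoint[OF this] show False using that(2,3) by blast
  qed
  consider "a = c" "orient (?q a) (?q b) (?q d) \<noteq> 0" | "a = d" "orient (?q a) (?q b) (?q c) \<noteq> 0"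
    | "b = c" "orient (?q b) (?q a) (?q d) \<noteq> 0" | "b = d" "orient (?q b) (?q a) (?q c) \<noteq> 0"
    | "orient (?q a) (?q b) (?q c) * orient (?q a) (?q b) (?q d) > 0"
    | "orient (?q c) (?q d) (?q a) * orient (?q c) (?q d) (?q b) > 0"
    using ap unfolding apart.simps Let_def by argo
  then show ?thesis
  proof cases
    case 1 then show ?thesis using end1[OF 1(2)] z by simp
  next
    case 2 then show ?thesis using end1[OF 2(2)] z(1) z'(2) by simp
  next
    case 3 then show ?thesis using end1[OF 3(2)] z'(1) z(2) by simp
  next
    case 4 then show ?thesis using end1[OF 4(2)] z'(1) z'(2) by simp
  next
    case 5 then show ?thesis using dis[OF 5] z by simp
  next
    case 6 then show ?thesis using dis[OF 6] z by simp
  qed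
qed

lemma sides:
  assumes "(fl, a, b) \<in> set local_edges"
  shows "fst (cell_pos ! a) \<in> {0..20}" "fst (cell_pos ! b) \<in> {0..20}"
    "snd (cell_pos ! a) \<in> {0..20}" "snd (cell_pos ! b) \<in> {0..20}"
    "\<not> (fst (cell_pos ! a) = 0 \<and> fst (cell_pos ! b) = 0)"
    "\<not> (fst (cell_pos ! a) = 20 \<and> fst (cell_pos ! b) = 20)"
    "\<not> (snd (cell_pos ! a) = 0 \<and> snd (cell_pos ! b) = 0)"
    "\<not> (snd (cell_pos ! a) = 20 \<and> snd (cell_pos ! b) = 20)"
proof -
  have "sides_ok (a, b)" using local_sides assms by fastforce
  note ok = this[unfolded sides_ok_def Let_def prod.case]
  show "fst (cell_pos ! a) \<in> {0..20}" "fst (cell_pos ! b) \<in> {0..20}"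
    "snd (cell_pos ! a) \<in> {0..20}" "snd (cell_pos ! b) \<in> {0..20}"
    "\<not> (fst (cell_pos ! a) = 0 \<and> fst (cell_pos ! b) = 0)"
    "\<not> (fst (cell_pos ! a) = 20 \<and> fst (cell_pos ! b) = 20)"
    "\<not> (snd (cell_pos ! a) = 0 \<and> snd (cell_pos ! b) = 0)"
    "\<not> (snd (cell_pos ! a) = 20 \<and> snd (cell_pos ! b) = 20)"
    using ok by blast+
qed

text \<open>Two different cells are separated by a grid line, namely the far side of the one with
  the smaller column or row number. The order in one coordinate suffices, whatever the other one
  is.\<close>

lemma cells_apart:
  assumes e: "(fl, a, b) \<in> set local_edges" "(fl', c, d) \<in> set local_edges" "s < s' \<or> r < r'"
    and z: "z \<in> closed_segment (cell_pt r s a) (cell_pt r s b)"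
      "z \<in> closed_segment (cell_pt r' s' c) (cell_pt r' s' d)"
  shows "z \<in> {cell_pt r s a, cell_pt r s b} \<and> z \<in> {cell_pt r' s' c, cell_pt r' s' d}"
proof -
  note A = sides[OF e(1)] and B = sides[OF e(2)]
  have le: "(of_int (20 * int s + i) :: real) \<le> of_int (20 * int s + 20)"
    "(of_int (20 * int s + i) :: real) = of_int (20 * int s + 20) \<longleftrightarrow> i = 20" if "i \<in> {0..20}" for s and i :: int
    using that by (simp_all only: of_int_le_iff of_int_eq_iff) auto
  have ge: "(of_int (20 * int s + 20) :: real) \<le> of_int (20 * int s' + i)"
    "(of_int (20 * int s' + i) :: real) = of_int (20 * int s + 20) \<Longrightarrow> i = 0" if "i \<in> {0..20}" "s < s'" for s s' and i :: int
    using that by (simp_all only: of_int_le_iff of_int_eq_iff) auto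
  show ?thesis
  proof (cases "s < s'")
    case True
    show ?thesis
      by (rule segments_separated[where \<phi> = Re and t = "of_int (20 * int s + 20)", OF _ _ _ _ _ _ _ z])
        (use A B True le ge in \<open>auto simp only: cell_pt_def complex.sel simp_thms\<close>)
  next
    case False
    then have "r < r'" using e(3) by simp
    show ?thesis
      by (rule segments_separated[where \<phi> = Im and t = "of_int (20 * int r + 20)", OF _ _ _ _ _ _ _ z])
        (use A B \<open>r < r'\<close> le ge in \<open>auto simp only: cell_pt_def complex.sel simp_thms\<close>)
  qed
qed

lemma planar_grid: "planar {..<NV} E"
proof (rule planar_straight[OF simple pt_inj])
  fix v assume "v \<in> {..<NV}"
  then obtain r s l where v: "r \<le> n" "s < C" "l < 39" "v = vx r s l" using NV_cases[of v] by auto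
  have "\<exists>z\<in>set local_edges. fst z = 0 \<and> (fst (snd z) = l \<or> snd (snd z) = l)"
  proof -
    have "\<forall>l\<in>set [0..<39]. \<exists>z\<in>set local_edges. fst z = 0 \<and> (fst (snd z) = l \<or> snd (snd z) = l)"
      by code_simp
    then show ?thesis using v(3) by simp
  qed
  then obtain a b where ab: "(0, a, b) \<in> set local_edges" "a = l \<or> b = l" by auto
  have "{vx r s a, xv r s b} \<in> E" by (rule edgeI[OF ab(1)]) (use v in \<open>auto simp: active_def\<close>)
  moreover have "v \<in> {vx r s a, xv r s b}" using ab(2) v by (auto simp: xv_def)
  ultimately show "\<exists>e\<in>E. v \<in> e" by blast
next
  fix a b c d z
  assume E: "{a, b} \<in> E" "{c, d} \<in> E" "{a, b} \<noteq> {c, d}"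
    and z: "z \<in> closed_segment (pt a) (pt b)" "z \<in> closed_segment (pt c) (pt d)"
  obtain fl a' b' r s where e: "(fl, a', b') \<in> set local_edges" "active fl r s" "r \<le> n" "s < C"
    "{a, b} = {vx r s a', xv r s b'}" using E(1) by (rule edgeE)
  obtain fl' c' d' r' s' where f: "(fl', c', d') \<in> set local_edges" "active fl' r' s'" "r' \<le> n" "s' < C"
    "{c, d} = {vx r' s' c', xv r' s' d'}" using E(2) by (rule edgeE)
  have pe: "pt (vx r s a') = cell_pt r s a'" "pt (xv r s b') = cell_pt r s b'"
    using pt_vx[OF e(4) local_edges_facts(1)[OF e(1)]] pt_xv[OF e(1,2,4)] by auto
  have pf: "pt (vx r' s' c') = cell_pt r' s' c'" "pt (xv r' s' d') = cell_pt r' s' d'"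
    using pt_vx[OF f(4) local_edges_facts(1)[OF f(1)]] pt_xv[OF f(1,2,4)] by auto
  have z1: "z \<in> closed_segment (cell_pt r s a') (cell_pt r s b')" and s1: "{pt a, pt b} = {cell_pt r s a', cell_pt r s b'}"
    using z(1) e(5) pe by (auto simp: doubleton_eq_iff closed_segment_commute)
  have z2: "z \<in> closed_segment (cell_pt r' s' c') (cell_pt r' s' d')"
    and s2: "{pt c, pt d} = {cell_pt r' s' c', cell_pt r' s' d'}"
    using z(2) f(5) pf by (auto simp: doubleton_eq_iff closed_segment_commute)
  show "z \<in> {pt a, pt b} \<and> z \<in> {pt c, pt d}"
  proof (cases "r = r' \<and> s = s'")
    case True
    then have "(a', b') \<noteq> (c', d')" using E(3) e(5) f(5) by auto
    then show ?thesis using same_cell[OF e(1) f(1)] z1 z2 s1 s2 True by simp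
  next
    case False
    then consider "s < s' \<or> r < r'" | "s' < s \<or> r' < r" by linarith
    then show ?thesis
    proof cases
      case 1
      from cells_apart[OF e(1) f(1) this z1 z2] show ?thesis unfolding s1 s2 .
    next
      case 2
      from cells_apart[OF f(1) e(1) this z2 z1] show ?thesis unfolding s1 s2 by blast
    qed
  qed
qed

end

lemma adjacent_swapI:
  "u \<in> V \<Longrightarrow> v \<in> V \<Longrightarrow> u \<noteq> v \<Longrightarrow> {u, v} \<in> E \<Longrightarrow> adjacent_swap V E c (c(u := c v, v := c u))"
  unfolding adjacent_swap_def by blast

lemma relpowp_two: "R a b \<Longrightarrow> R b c \<Longrightarrow> (R ^^ 2) a c"
  by (auto simp: numeral_2_eq_2)

context grid
begin

section \<open>Swaps\<close>

lemma triangle_mem: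
  assumes "l < 13"
  shows "(0, 3 * l, 3 * l + 1) \<in> set local_edges" "(0, 3 * l, 3 * l + 2) \<in> set local_edges"
    "(0, 3 * l + 1, 3 * l + 2) \<in> set local_edges"
proof -
  have "(3 * l, 3 * l + 1) \<in> set triangle_edges" "(3 * l, 3 * l + 2) \<in> set triangle_edges"
    "(3 * l + 1, 3 * l + 2) \<in> set triangle_edges"
    using assms by (auto simp: triangle_edges_def intro!: bexI[of _ l])
  then show "(0, 3 * l, 3 * l + 1) \<in> set local_edges" "(0, 3 * l, 3 * l + 2) \<in> set local_edges"
    "(0, 3 * l + 1, 3 * l + 2) \<in> set local_edges"
    unfolding local_edges_def by simp_all
qed

lemma triangle_edge:
  assumes "3 * t < NV"
  shows "{3 * t, 3 * t + 1} \<in> E" "{3 * t, 3 * t + 2} \<in> E" "{3 * t + 1, 3 * t + 2} \<in> E" "3 * t + 2 < NV"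
proof -
  obtain r s l where v: "r \<le> n" "s < C" "l < 39" "3 * t = vx r s l" using NV_cases[OF assms] .
  have "vx r s l mod 39 mod 3 = 0" unfolding mod39 v(4)[symmetric] by simp
  then have "l mod 3 = 0" using vx_div(2)[OF v(3)] by simp
  then obtain l' where l': "l = 3 * l'" by auto
  then have l13: "l' < 13" using v(3) by simp
  have x: "xv r s (3 * l' + 1) = 3 * t + 1" "xv r s (3 * l' + 2) = 3 * t + 2" "vx r s (3 * l') = 3 * t"
    "vx r s (3 * l' + 1) = 3 * t + 1"
    using l13 v(4) l' by (simp_all add: xv_def vx_def)
  have act: "active 0 r s" by (simp add: active_def)
  show "{3 * t, 3 * t + 1} \<in> E" "{3 * t, 3 * t + 2} \<in> E" "{3 * t + 1, 3 * t + 2} \<in> E"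
    using edgeI[OF triangle_mem(1)[OF l13] act v(1,2)] edgeI[OF triangle_mem(2)[OF l13] act v(1,2)]
      edgeI[OF triangle_mem(3)[OF l13] act v(1,2)] unfolding x .
  show "3 * t + 2 < NV" using vx_less[OF v(1,2), of "3 * l' + 2"] l13 v(4) l' by (simp add: vx_def)
qed

text \<open>A rotation of three colors is either trivial or a 3-cycle, and a 3-cycle is a product of
  two transpositions, both along edges of the triangle.\<close>

lemma rotate_triangle:
  assumes t: "3 * t < NV" and a: "a \<in> {1..3}" "b \<in> {1..3}"
    and c: "\<And>j. j < 3 \<Longrightarrow> c (3 * t + j) = rot a j"
  shows "\<exists>j\<le>2. (adjacent_swap {..<NV} E ^^ j) c (\<lambda>v. if v div 3 = t then rot b (v mod 3) else c v)"
proof -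
  let ?S = "adjacent_swap {..<NV} E"
  note e = triangle_edge[OF t]
  have V: "3 * t \<in> {..<NV}" "3 * t + 1 \<in> {..<NV}" "3 * t + 2 \<in> {..<NV}" using e(4) t by auto
  have c0: "c (3 * t) = a" "c (3 * t + 1) = nx a" "c (3 * t + 2) = nx (nx a)"
    using c[of 0] c[of 1] c[of 2] by (simp_all add: rot_def)
  have a3: "a = 1 \<or> a = 2 \<or> a = 3" "b = 1 \<or> b = 2 \<or> b = 3" using a by auto
  then have nx3: "nx (nx (nx a)) = a" by (elim disjE) (simp_all add: nx_def)
  have vc: "v = 3 * t \<or> v = 3 * t + 1 \<or> v = 3 * t + 2" if "v div 3 = t" for v :: nat
    using that by presburger
  have dv: "(3 * t) div 3 = t" "(3 * t + 1) div 3 = t" "(3 * t + 2) div 3 = t"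
    "(3 * t) mod 3 = 0" "(3 * t + 1) mod 3 = 1" "(3 * t + 2) mod 3 = 2" by presburger+
  define c1 where "c1 = c(3 * t := c (3 * t + 1), 3 * t + 1 := c (3 * t))"
  have s1: "?S c c1" unfolding c1_def by (rule adjacent_swapI[OF V(1,2) _ e(1)]) simp
  have eqI: "c' = (\<lambda>v. if v div 3 = t then rot b (v mod 3) else c v)"
    if "c' (3 * t) = b" "c' (3 * t + 1) = nx b" "c' (3 * t + 2) = nx (nx b)"
      "\<And>v. v div 3 \<noteq> t \<Longrightarrow> c' v = c v" for c'
  proof
    fix v
    consider "v = 3 * t" | "v = 3 * t + 1" | "v = 3 * t + 2" | "v div 3 \<noteq> t" using vc by blast
    then show "c' v = (if v div 3 = t then rot b (v mod 3) else c v)"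
    proof cases
      case 1
      show ?thesis unfolding 1 dv that by (simp add: rot_def)
    next
      case 2
      show ?thesis unfolding 2 dv that by (simp add: rot_def)
    next
      case 3
      show ?thesis unfolding 3 dv that by (simp add: rot_def)
    next
      case 4
      then show ?thesis using that(4)[OF 4] by simp
    qed
  qed
  have ne: "v \<noteq> 3 * t" "v \<noteq> 3 * t + 1" "v \<noteq> 3 * t + 2" if "v div 3 \<noteq> t" for v
    by (rule notI, use that dv in simp)+
  consider "b = a" | "b = nx a" | "b = nx (nx a)" using a3 by (elim disjE) (simp_all add: nx_def)
  then show ?thesis
  proof cases
    case 1
    have "c = (\<lambda>v. if v div 3 = t then rot b (v mod 3) else c v)"
      by (rule eqI) (simp_all only: 1 c0)
    then show ?thesis by (intro exI[of _ 0]) simp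
  next
    case 2
    define c2 where "c2 = c1(3 * t + 1 := c1 (3 * t + 2), 3 * t + 2 := c1 (3 * t + 1))"
    have "?S c1 c2" unfolding c2_def by (rule adjacent_swapI[OF V(2,3) _ e(3)]) simp
    from relpowp_two[of ?S c c1 c2, OF s1 this] have "(?S ^^ 2) c c2" .
    moreover have "c2 = (\<lambda>v. if v div 3 = t then rot b (v mod 3) else c v)"
      by (rule eqI) (use c0 nx3 ne in \<open>simp_all add: c2_def c1_def 2\<close>)
    ultimately show ?thesis by (intro exI[of _ 2]) simp
  next
    case 3
    define c2 where "c2 = c1(3 * t := c1 (3 * t + 2), 3 * t + 2 := c1 (3 * t))"
    have "?S c1 c2" unfolding c2_def by (rule adjacent_swapI[OF V(1,3) _ e(2)]) simp
    from relpowp_two[of ?S c c1 c2, OF s1 this] have "(?S ^^ 2) c c2" .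
    moreover have "c2 = (\<lambda>v. if v div 3 = t then rot b (v mod 3) else c v)"
      by (rule eqI) (use c0 nx3 ne in \<open>simp_all add: c2_def c1_def 3\<close>)
    ultimately show ?thesis by (intro exI[of _ 2]) simp
  qed
qed

text \<open>The triangles are disjoint, so they are rotated one after the other at two swaps each;
  after every round the untouched triangles still have their original colors.\<close>

lemma rotate_triangles:
  assumes "finite A" "\<And>t. t \<in> A \<Longrightarrow> 3 * t < NV" "\<And>t. k t \<in> {1..3}" "\<And>t. k' t \<in> {1..3}"
    and c: "\<And>v. v < NV \<Longrightarrow> c v = rot (k (v div 3)) (v mod 3)"
  shows "\<exists>j\<le>2 * card A. (adjacent_swap {..<NV} E ^^ j) c
    (\<lambda>v. if v div 3 \<in> A then rot (k' (v div 3)) (v mod 3) else c v)"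
  using assms(1,2)
proof (induction A rule: finite_induct)
  case empty
  have "(\<lambda>v. if v div 3 \<in> {} then rot (k' (v div 3)) (v mod 3) else c v) = c" by simp
  then have "(adjacent_swap {..<NV} E ^^ 0) c (\<lambda>v. if v div 3 \<in> {} then rot (k' (v div 3)) (v mod 3) else c v)"
    by simp
  then show ?case by (rule_tac x = 0 in exI) simp
next
  case (insert t A)
  define d where "d = (\<lambda>v. if v div 3 \<in> A then rot (k' (v div 3)) (v mod 3) else c v)"
  have "\<exists>j\<le>2 * card A. (adjacent_swap {..<NV} E ^^ j) c d"
    unfolding d_def by (rule insert.IH) (simp add: insert.prems)
  then obtain j where j: "j \<le> 2 * card A" "(adjacent_swap {..<NV} E ^^ j) c d" by blast
  have t: "3 * t < NV" using insert by simp
  define d' where "d' = (\<lambda>v. if v div 3 \<in> insert t A then rot (k' (v div 3)) (v mod 3) else c v)"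
  have d': "(\<lambda>v. if v div 3 = t then rot (k' t) (v mod 3) else d v) = d'"
    unfolding d_def d'_def by (rule ext) simp
  have "\<exists>i\<le>2. (adjacent_swap {..<NV} E ^^ i) d d'"
    unfolding d'[symmetric]
  proof (rule rotate_triangle[OF t assms(3)[of t] assms(4)[of t], of d])
    fix j :: nat assume j: "j < 3"
    then have "3 * t + j < NV" using triangle_edge(4)[OF t] by linarith
    moreover have "(3 * t + j) div 3 = t" "(3 * t + j) mod 3 = j" using j by simp_all
    ultimately show "d (3 * t + j) = rot (k t) j" using insert(2) c[of "3 * t + j"] by (simp add: d_def)
  qed
  then obtain i where i: "i \<le> 2" "(adjacent_swap {..<NV} E ^^ i) d d'" by blast
  have "(adjacent_swap {..<NV} E ^^ (j + i)) c d'"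
    using j(2) i(2) by (rule relpowp_trans)
  moreover have "j + i \<le> 2 * card (insert t A)" using j(1) i(1) insert(1,2) by simp
  ultimately show ?case unfolding d'_def[symmetric] by blast
qed

end

lemma adjacent_swap_imp_swap: "adjacent_swap V E c c' \<Longrightarrow> swap V E c c'"
  unfolding adjacent_swap_def swap_def by blast

lemma adjacent_swaps_imp_swaps: "(adjacent_swap V E ^^ j) c c' \<Longrightarrow> (swap V E ^^ j) c c'"
  by (rule relpowp_mono) (rule adjacent_swap_imp_swap)

text \<open>The source of the lower bound: a single swap changes the colors of at most two
  vertices.\<close>

lemma swaps_difference:
  assumes "finite V" "(swap V E ^^ j) c c'"
  shows "card {v \<in> V. c v \<noteq> c' v} \<le> 2 * j"
  using assms(2)
proof (induction j arbitrary: c')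
  case 0
  then show ?case by simp
next
  case (Suc j)
  then obtain d where d: "(swap V E ^^ j) c d" "swap V E d c'" by auto
  obtain u v where "c' = d(u := d v, v := d u)" using d(2) by (auto simp: swap_def)
  then have "{v \<in> V. c v \<noteq> c' v} \<subseteq> {v \<in> V. c v \<noteq> d v} \<union> {u, v}" by auto
  moreover have "finite ({v \<in> V. c v \<noteq> d v} \<union> {u, v})" using assms(1) by simp
  ultimately have "card {v \<in> V. c v \<noteq> c' v} \<le> card ({v \<in> V. c v \<noteq> d v} \<union> {u, v})"
    by (rule card_mono[rotated])
  also have "\<dots> \<le> card {v \<in> V. c v \<noteq> d v} + card {u, v}" by (rule card_Un_le)
  also have "\<dots> \<le> 2 * j + 2" using Suc.IH[OF d(1)] card_insert_le_m1[of 2 "{v}" u]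
    by (intro add_mono) (auto simp: card_insert_if)
  finally show ?case by simp
qed

lemma proper_coloring_cong:
  "(\<And>v. v \<in> V \<Longrightarrow> c v = c' v) \<Longrightarrow> proper_coloring V E r c \<Longrightarrow> proper_coloring V E r c'"
  unfolding proper_coloring_def coloring_def by simp

context grid
begin

section \<open>The initial coloring and its distance to proper colorings\<close>

text \<open>Every cell starts as if its row and its column had color 1. This depends only on the
  vertex number modulo 39 and satisfies all edges except those of type 2.\<close>

definition init_core :: "nat \<Rightarrow> nat" where
  "init_core t = cell_col 1 1 ! (t mod 13)"

definition init_col :: "nat \<Rightarrow> nat" where
  "init_col v = rot (init_core (v div 3)) (v mod 3)"

lemma init_core_range: "init_core t \<in> {1..3}"
proof -
  have "list_all (\<lambda>c. c \<in> {1..3}) (cell_col 1 1)" using cell_col_range by blast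
  moreover have "length (cell_col 1 1) = 13" by (simp add: cell_col_def)
  ultimately show ?thesis by (simp add: init_core_def list_all_length)
qed

lemma rot_range: "a \<in> {1..3} \<Longrightarrow> rot a j \<in> {1..3}"
  unfolding rot_def using nx_range by simp

lemma init_col_vx: "init_col (vx r s 0) = 1"
proof -
  have "vx r s 0 div 3 mod 13 = 0" "vx r s 0 mod 3 = 0"
    using mod39[of "vx r s 0"] vx_div(2)[of 0 r s] by simp_all
  then show ?thesis by (simp add: init_col_def init_core_def rot_def cell_col_def)
qed

lemma core_col_init:
  assumes "h 0 = 1" "h 3 = 1" "t div 13 mod C < M"
  shows "core_col h t = init_core t"
  using assms by (auto simp: core_col_def init_core_def row_col_def col_col_def)

text \<open>The elements number triangles, the triangle t consisting of the vertices 3t, 3t + 1, 3t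
  + 2. They are the triangles outside the prolongation, the only ones that a cheap solution
  recolors.\<close>

definition variable_part :: "nat set" where
  "variable_part = {t. 3 * t < NV \<and> M \<le> t div 13 mod C}"

lemma card_variable_part: "finite variable_part" "card variable_part \<le> 13 * ((n + 1) * (n + 1))"
proof -
  let ?f = "\<lambda>(r, j, l). 13 * (r * C + (M + j)) + l"
  let ?B = "{..n} \<times> {..n} \<times> {..<13 :: nat}"
  have sub: "variable_part \<subseteq> ?f ` ?B"
  proof
    fix t assume t: "t \<in> variable_part"
    obtain r s l where v: "r \<le> n" "s < C" "l < 39" "3 * t = vx r s l"
      using NV_cases[of "3 * t"] t by (auto simp: variable_part_def)
    have q: "t div 13 = r * C + s"
      using vx_div(1)[OF v(3), of r s] unfolding v(4)[symmetric] by (simp add: div_mult2_eq[of "3 * t" 3 13, simplified])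
    then have s: "M \<le> s" using t cell_div[OF v(2)] by (simp add: variable_part_def)
    have "t = 13 * (t div 13) + t mod 13" by simp
    then have "t = ?f (r, s - M, t mod 13)" using q s by simp
    moreover have "(r, s - M, t mod 13) \<in> ?B" using v s by (auto simp: C_def)
    ultimately show "t \<in> ?f ` ?B" by (rule image_eqI)
  qed
  show "finite variable_part" by (rule finite_subset[OF sub]) simp
  have "card variable_part \<le> card ?B" by (rule surj_card_le[OF _ sub]) simp
  then show "card variable_part \<le> 13 * ((n + 1) * (n + 1))"
    by (simp add: card_cartesian_product algebra_simps)
qed

lemma triangle_less: "v < NV \<Longrightarrow> 3 * (v div 3) < NV"
  using div_times_less_eq_dividend[of v 3] by linarith

definition satisfiable :: bool where
  "satisfiable \<longleftrightarrow> (\<exists>h. admissible h \<and> h 0 = 1 \<and> h 3 = 1)"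

text \<open>The coloring given by h coincides with the initial one left of column \<open>M\<close>.
  Recoloring the rest takes 2 swaps for each of the 13 triangles in (n + 1)^2 cells, which explains
  the factor 26.\<close>

lemma satisfiable_solvable:
  assumes sat: satisfiable and k: "26 * ((n + 1) * (n + 1)) \<le> k"
  shows "solvable_within adjacent_swap 3 {..<NV} E init_col k"
proof -
  obtain h where h: "admissible h" "h 0 = 1" "h 3 = 1" using sat by (auto simp: satisfiable_def)
  define c where "c = (\<lambda>v. if v div 3 \<in> variable_part then rot (core_col h (v div 3)) (v mod 3) else init_col v)"
  have "\<exists>j\<le>2 * card variable_part. (adjacent_swap {..<NV} E ^^ j) init_col c"
    unfolding c_def
    by (rule rotate_triangles[where k = init_core,
          OF card_variable_part(1) _ init_core_range core_col_range[OF h(1)]])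
      (simp_all add: init_col_def variable_part_def)
  then obtain j where j: "j \<le> 2 * card variable_part" "(adjacent_swap {..<NV} E ^^ j) init_col c" by blast
  have "proper_coloring {..<NV} E 3 c"
  proof (rule proper_coloring_cong[OF _ grid_col_proper[OF h(1)]])
    fix v assume v: "v \<in> {..<NV}"
    show "grid_col h v = c v"
    proof (cases "v div 3 \<in> variable_part")
      case True
      then show ?thesis by (simp add: c_def grid_col_def)
    next
      case False
      then have "v div 3 div 13 mod C < M"
        using triangle_less[of v] v by (simp add: variable_part_def)
      from core_col_init[OF h(2,3) this] show ?thesis using False by (simp add: c_def grid_col_def init_col_def)
    qed
  qed
  moreover have "j \<le> k" using j(1) card_variable_part(2) k by linarith
  ultimately show ?thesis using j(2) unfolding solvable_within_def by blast
qed

text \<open>If row 0 or row 3 ends with a color other than 1, all \<open>M\<close> left vertices on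
  its prolongation have changed, whereas at most k swaps change at most 2k < \<open>M\<close>
  vertices.\<close>

lemma solvable_satisfiable:
  assumes sol: "solvable_within swap 3 {..<NV} E init_col k" and k: "2 * k < M"
  shows satisfiable
proof (rule ccontr)
  assume nsat: "\<not> satisfiable"
  obtain j c where j: "j \<le> k" "(swap {..<NV} E ^^ j) init_col c" and c: "proper_coloring {..<NV} E 3 c"
    using sol unfolding solvable_within_def by blast
  have "\<not> (read_rows c 0 = 1 \<and> read_rows c 3 = 1)"
    using nsat read_rows_admissible[OF c] by (auto simp: satisfiable_def)
  then obtain i where i: "i = 0 \<or> i = 3" "c (vx i M 0) \<noteq> 1"
    using n4 by (auto simp: read_rows_def)
  have "c (vx i s 0) \<noteq> 1" if "s < M" for s
    using row_left[OF c i(1), of "M - s"] i(2) that by simp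
  moreover have "vx i s 0 < NV" if "s < M" for s
    using vx_less[of i s 0] i(1) n4 that by (auto simp: C_def)
  ultimately have sub: "(\<lambda>s. vx i s 0) ` {..<M} \<subseteq> {v \<in> {..<NV}. init_col v \<noteq> c v}"
    using init_col_vx[of i] by fastforce
  have "inj_on (\<lambda>s. vx i s 0) {..<M}" by (auto simp: inj_on_def vx_def)
  then have "M = card ((\<lambda>s. vx i s 0) ` {..<M})" by (simp add: card_image)
  also have "\<dots> \<le> card {v \<in> {..<NV}. init_col v \<noteq> c v}" by (rule card_mono[OF _ sub]) simp
  also have "\<dots> \<le> 2 * j" by (rule swaps_difference[OF _ j(2)]) simp
  finally show False using j(1) k by simp
qed

lemma chromatic:
  assumes "admissible h"
  shows "chromatic_number {..<NV} E = 3"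
  unfolding chromatic_number_def
proof (rule Least_equality)
  show "\<exists>c. proper_coloring {..<NV} E 3 c" using grid_col_proper[OF assms] by blast
  fix r assume "\<exists>c. proper_coloring {..<NV} E r c"
  then obtain c where c: "proper_coloring {..<NV} E r c" by blast
  have "0 < NV" by (simp add: NV_def C_def)
  then have e: "{0, 1} \<in> E" "{0, 2} \<in> E" "{1, 2} \<in> E" "2 < NV" using triangle_edge[of 0] by (simp_all add: numeral_2_eq_2)
  have "c 0 \<noteq> c 1" "c 0 \<noteq> c 2" "c 1 \<noteq> c 2" "c 0 \<in> {1..r}" "c 1 \<in> {1..r}" "c 2 \<in> {1..r}"
    using c e by (auto simp: proper_coloring_def coloring_def)
  then show "3 \<le> r" by auto
qed

text \<open>Rotating every triangle turns any proper coloring of cyclic form into the initial one.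
  Any admissible h will do, so the promise does not require \<open>satisfiable\<close>.\<close>

lemma promise:
  assumes h: "admissible h" and k: "0 < k"
  shows "swap_promise 3 {..<NV} E init_col k"
proof -
  \<comment> \<open>Swaps do not affect numbers outside the graph, so there the two colorings have
    to agree from the start.\<close>
  define c0 where "c0 v = (if v < NV then grid_col h v else init_col v)" for v
  have opt: "optimal_coloring {..<NV} E c0"
    unfolding optimal_coloring_def chromatic[OF h]
    by (rule proper_coloring_cong[OF _ grid_col_proper[OF h]]) (simp add: c0_def)
  let ?A = "{t. 3 * t < NV}"
  have finA: "finite ?A" by (rule finite_subset[of _ "{..<NV}"]) auto
  have "\<exists>j\<le>2 * card ?A. (adjacent_swap {..<NV} E ^^ j) c0
      (\<lambda>v. if v div 3 \<in> ?A then rot (init_core (v div 3)) (v mod 3) else c0 v)"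
    by (rule rotate_triangles[where k = "core_col h", OF finA _ core_col_range[OF h] init_core_range])
      (simp_all add: c0_def grid_col_def)
  then obtain j where "(swap {..<NV} E ^^ j) c0
      (\<lambda>v. if v div 3 \<in> ?A then rot (init_core (v div 3)) (v mod 3) else c0 v)"
    using adjacent_swaps_imp_swaps by meson
  moreover have "(\<lambda>v. if v div 3 \<in> ?A then rot (init_core (v div 3)) (v mod 3) else c0 v) = init_col"
    by (rule ext) (use triangle_less in \<open>auto simp: init_col_def c0_def\<close>)
  ultimately have "permutation_of {..<NV} E init_col c0"
    unfolding permutation_of_def using relpowp_imp_rtranclp by (simp only:) fast
  moreover have "coloring {..<NV} 3 init_col"
    unfolding coloring_def init_col_def using rot_range[OF init_core_range] by blast
  ultimately show ?thesis
    unfolding swap_promise_def using simple k chromatic[OF h] opt by blast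
qed

end

section \<open>Horn systems as coloring problems\<close>

text \<open>Besides initial facts and rules with two premises there are complementary pairs, of
  which exactly one member holds. They are not Horn clauses; they make room for the guess of the
  witness.\<close>

definition horn_sat ::
  "nat \<Rightarrow> (nat \<Rightarrow> bool) \<Rightarrow> (nat \<Rightarrow> nat \<Rightarrow> bool) \<Rightarrow> (nat \<Rightarrow> nat \<Rightarrow> nat \<Rightarrow> bool) \<Rightarrow> (nat \<Rightarrow> bool) \<Rightarrow> bool" where
  "horn_sat N ini cpl rul \<sigma> \<longleftrightarrow>
     (\<forall>a<N. ini a \<longrightarrow> \<sigma> a) \<and> (\<forall>a<N. \<forall>b<N. cpl a b \<longrightarrow> \<sigma> a \<noteq> \<sigma> b) \<and>
     (\<forall>a<N. \<forall>b<N. \<forall>c<N. rul a b c \<longrightarrow> \<sigma> a \<longrightarrow> \<sigma> b \<longrightarrow> \<sigma> c)"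

definition horn_size :: "nat \<Rightarrow> nat" where
  "horn_size N = 3 + N + N * N * N * 5"

text \<open>Vertices \<open>0\<close>, \<open>1\<close>, \<open>2\<close> carry the colors for false, true and neither, \<open>3 + a\<close> stands for the
  fact \<open>a\<close>, and five vertices \<open>p\<close>, \<open>q\<close>, \<open>r\<close>, \<open>p'\<close>, \<open>q'\<close> are reserved for each triple of facts.  The
  triangle \<open>p q r\<close> with \<open>p - a\<close> and \<open>q - b\<close> gives \<open>r\<close> the color true if \<open>a\<close> and \<open>b\<close> are true; then
  \<open>p'\<close>, which is not false, has the third color, and \<open>q'\<close>, which is not true, is false,
  so that its neighbor \<open>c\<close> is not.\<close>

definition horn_adj ::
  "nat \<Rightarrow> (nat \<Rightarrow> bool) \<Rightarrow> (nat \<Rightarrow> nat \<Rightarrow> bool) \<Rightarrow> (nat \<Rightarrow> nat \<Rightarrow> nat \<Rightarrow> bool) \<Rightarrow> nat \<Rightarrow> nat \<Rightarrow> bool" where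
  "horn_adj N ini cpl rul i j \<longleftrightarrow> i < horn_size N \<and> j < horn_size N \<and>
     ((i < 3 \<and> j < 3 \<and> i \<noteq> j) \<or>
      (3 \<le> j \<and> j < 3 + N \<and> (i = 2 \<or> (i = 0 \<and> ini (j - 3)) \<or> (3 \<le> i \<and> i < 3 + N \<and> cpl (i - 3) (j - 3)))) \<or>
      (3 + N \<le> j \<and>
       rul ((j - (3 + N)) div 5 div N div N) ((j - (3 + N)) div 5 div N mod N) ((j - (3 + N)) div 5 mod N) \<and>
       (((j - (3 + N)) mod 5 = 0 \<and> i = 3 + (j - (3 + N)) div 5 div N div N) \<or>
        ((j - (3 + N)) mod 5 = 1 \<and> i = 3 + (j - (3 + N)) div 5 div N mod N) \<or>
        ((j - (3 + N)) mod 5 = 3 \<and> i = 0) \<or>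
        ((j - (3 + N)) mod 5 = 4 \<and> (i = 1 \<or> i = 3 + (j - (3 + N)) div 5 mod N)) \<or>
        (1 \<le> (j - (3 + N)) mod 5 \<and> i + 1 = j) \<or>
        ((j - (3 + N)) mod 5 = 2 \<and> i + 2 = j))))"

definition gadget_vertex :: "nat \<Rightarrow> nat \<Rightarrow> nat \<Rightarrow> nat \<Rightarrow> nat \<Rightarrow> nat" where
  "gadget_vertex N a b c g = 3 + N + (((a * N + b) * N + c) * 5 + g)"

lemma gadget_vertex_decode:
  assumes "a < N" "b < N" "c < N" "g < 5"
  defines "z \<equiv> gadget_vertex N a b c g - (3 + N)"
  shows "z mod 5 = g" "z div 5 mod N = c" "z div 5 div N mod N = b" "z div 5 div N div N = a"
    "gadget_vertex N a b c g < horn_size N" "3 + N \<le> gadget_vertex N a b c g"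
proof -
  have z: "z = ((a * N + b) * N + c) * 5 + g" by (simp add: z_def gadget_vertex_def)
  have d5: "(y * 5 + g) div 5 = y" "(y * 5 + g) mod 5 = g" for y using assms(4) by auto
  have dN: "(y * N + r) div N = y" "(y * N + r) mod N = r" if "r < N" for y r using that by auto
  show "z mod 5 = g" unfolding z by (rule d5)
  have z5: "z div 5 = (a * N + b) * N + c" unfolding z by (rule d5)
  show "z div 5 mod N = c" unfolding z5 by (rule dN[OF assms(3)])
  have zN: "z div 5 div N = a * N + b" unfolding z5 by (rule dN[OF assms(3)])
  show "z div 5 div N mod N = b" "z div 5 div N div N = a" unfolding zN by (rule dN[OF assms(2)])+
  have "a * N + b + 1 \<le> N * N"
  proof -
    have "(a + 1) * N \<le> N * N" using assms(1) by (intro mult_le_mono1) simp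
    then show ?thesis using assms(2) by simp
  qed
  then have "(a * N + b + 1) * N \<le> N * N * N" by (rule mult_le_mono1)
  then have "(a * N + b) * N + c + 1 \<le> N * N * N" using assms(3) by simp
  then have "((a * N + b) * N + c + 1) * 5 \<le> N * N * N * 5" by (rule mult_le_mono1)
  then show "gadget_vertex N a b c g < horn_size N" using assms(4) by (simp add: gadget_vertex_def horn_size_def)
  show "3 + N \<le> gadget_vertex N a b c g" by (simp add: gadget_vertex_def)
qed

lemma gadget_vertex_cases:
  assumes "3 + N \<le> j" "j < horn_size N"
  obtains a b c g where "a < N" "b < N" "c < N" "g < 5" "j = gadget_vertex N a b c g"
proof -
  define z where "z = j - (3 + N)"
  have z: "z < N * N * N * 5" "j = 3 + N + z" using assms by (auto simp: z_def horn_size_def)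
  then have N: "0 < N" by (cases N) auto
  have 1: "z div 5 < N * N * N" using z(1) by (rule less_mult_imp_div_less)
  then have 2: "z div 5 div N < N * N" by (rule less_mult_imp_div_less)
  then have 3: "z div 5 div N div N < N" by (rule less_mult_imp_div_less)
  have "z = ((z div 5 div N div N * N + z div 5 div N mod N) * N + z div 5 mod N) * 5 + z mod 5"
    by (simp only: div_mult_mod_eq)
  then have j: "j = gadget_vertex N (z div 5 div N div N) (z div 5 div N mod N) (z div 5 mod N) (z mod 5)"
    unfolding gadget_vertex_def using z(2) by simp
  then show ?thesis using that[OF 3 _ _ _ j] N by simp
qed

lemma horn_adj_gadget:
  assumes "a < N" "b < N" "c < N" "g < 5"
  shows "horn_adj N ini cpl rul i (gadget_vertex N a b c g) \<longleftrightarrow> i < horn_size N \<and> rul a b c \<and>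
     ((g = 0 \<and> i = 3 + a) \<or> (g = 1 \<and> i = 3 + b) \<or> (g = 3 \<and> i = 0) \<or> (g = 4 \<and> (i = 1 \<or> i = 3 + c)) \<or>
      (1 \<le> g \<and> i + 1 = gadget_vertex N a b c g) \<or> (g = 2 \<and> i + 2 = gadget_vertex N a b c g))"
proof -
  note d = gadget_vertex_decode[OF assms]
  have "\<not> gadget_vertex N a b c g < 3 + N" "\<not> gadget_vertex N a b c g < 3" using d(6) by simp_all
  then show ?thesis unfolding horn_adj_def d(1-4) using d(5,6) by blast
qed

text \<open>The colors of \<open>p\<close>, \<open>q\<close>, \<open>r\<close>, \<open>p'\<close>,
  \<open>q'\<close>, where 1, 2, 3 stand for false, true and neither. Unless both premises are true,
  \<open>r\<close> can be 1, so that \<open>p'\<close> is 2 and \<open>q'\<close> is 3, which leaves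
  the conclusion free.\<close>

definition gadget_col :: "bool \<Rightarrow> bool \<Rightarrow> nat list" where
  "gadget_col u v = (if u \<and> v then [1, 3, 2, 3, 1] else if u then [3, 2, 1, 2, 3] else [2, 3, 1, 2, 3])"

definition horn_col :: "nat \<Rightarrow> (nat \<Rightarrow> bool) \<Rightarrow> nat \<Rightarrow> nat" where
  "horn_col N \<sigma> i =
     (if i < 3 then i + 1
      else if i < 3 + N then (if \<sigma> (i - 3) then 2 else 1)
      else gadget_col (\<sigma> ((i - (3 + N)) div 5 div N div N)) (\<sigma> ((i - (3 + N)) div 5 div N mod N)) !
        ((i - (3 + N)) mod 5))"

lemma horn_col_gadget:
  assumes "a < N" "b < N" "c < N" "g < 5"
  shows "horn_col N \<sigma> (gadget_vertex N a b c g) = gadget_col (\<sigma> a) (\<sigma> b) ! g"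
  unfolding horn_col_def gadget_vertex_decode(1-4)[OF assms] using gadget_vertex_decode(6)[OF assms] by simp

lemma less_5_cases: "g < 5 \<Longrightarrow> g = 0 \<or> g = 1 \<or> g = 2 \<or> g = 3 \<or> g = (4 :: nat)"
  by auto

lemma horn_col_range: "horn_col N \<sigma> i \<in> {1..3}"
proof -
  have "(i - (3 + N)) mod 5 < 5" by simp
  from less_5_cases[OF this] show ?thesis
    unfolding horn_col_def gadget_col_def by (elim disjE) auto
qed

lemma horn_col_proper:
  assumes sat: "horn_sat N ini cpl rul \<sigma>" and adj: "horn_adj N ini cpl rul i j"
  shows "horn_col N \<sigma> i \<noteq> horn_col N \<sigma> j"
proof (cases "3 + N \<le> j")
  case False
  have ini: "\<sigma> (j - 3)" if "ini (j - 3)" "3 \<le> j" "j < 3 + N"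
    using sat that unfolding horn_sat_def by (metis less_diff_conv2 add.commute)
  have cpl: "\<sigma> (i - 3) \<noteq> \<sigma> (j - 3)" if "cpl (i - 3) (j - 3)" "3 \<le> j" "j < 3 + N" "3 \<le> i" "i < 3 + N"
  proof -
    have "i - 3 < N" "j - 3 < N" using that by auto
    then show ?thesis using sat that(1) unfolding horn_sat_def by blast
  qed
  consider "i < 3" "j < 3" "i \<noteq> j" | "3 \<le> j" "j < 3 + N" "i = 2" | "3 \<le> j" "j < 3 + N" "i = 0" "ini (j - 3)"
    | "3 \<le> j" "j < 3 + N" "3 \<le> i" "i < 3 + N" "cpl (i - 3) (j - 3)"
    using adj False unfolding horn_adj_def by argo
  then show ?thesis
  proof cases
    case 1 then show ?thesis by (simp add: horn_col_def)
  next
    case 2 then show ?thesis by (simp add: horn_col_def)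
  next
    case 3 then show ?thesis using ini by (simp add: horn_col_def)
  next
    case 4 then show ?thesis using cpl by (simp add: horn_col_def)
  qed
next
  case True
  have "j < horn_size N" using adj by (simp add: horn_adj_def)
  then obtain a b c g where j: "a < N" "b < N" "c < N" "g < 5" "j = gadget_vertex N a b c g"
    using gadget_vertex_cases[OF True] by metis
  note A = adj[unfolded j(5) horn_adj_gadget[OF j(1-4)]]
  have r: "rul a b c" using A by blast
  have s: "\<sigma> a \<Longrightarrow> \<sigma> b \<Longrightarrow> \<sigma> c" using sat r j unfolding horn_sat_def by blast
  have f: "horn_col N \<sigma> (3 + d) = (if \<sigma> d then 2 else 1)" if "d < N" for d
    using that by (simp add: horn_col_def)
  have b: "horn_col N \<sigma> 0 = 1" "horn_col N \<sigma> 1 = 2" by (simp_all add: horn_col_def)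
  have jg: "horn_col N \<sigma> j = gadget_col (\<sigma> a) (\<sigma> b) ! g" using horn_col_gadget[OF j(1-4)] j(5) by simp
  consider "g = 0" "i = 3 + a" | "g = 1" "i = 3 + b" | "g = 3" "i = 0" | "g = 4" "i = 1" | "g = 4" "i = 3 + c"
    | g' where "g = Suc g'" "i = gadget_vertex N a b c g'" | "g = 2" "i = gadget_vertex N a b c 0"
  proof -
    have "i = gadget_vertex N a b c (g - 1)" if "1 \<le> g" "i + 1 = gadget_vertex N a b c g"
      using that by (simp add: gadget_vertex_def)
    moreover have "i = gadget_vertex N a b c 0" if "g = 2" "i + 2 = gadget_vertex N a b c g"
      using that by (simp add: gadget_vertex_def)
    moreover have "g = Suc (g - 1)" if "1 \<le> g" using that by simp
    moreover note A[THEN conjunct2, THEN conjunct2]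
    ultimately have "(g = 0 \<and> i = 3 + a) \<or> (g = 1 \<and> i = 3 + b) \<or> (g = 3 \<and> i = 0) \<or> (g = 4 \<and> i = 1) \<or>
      (g = 4 \<and> i = 3 + c) \<or> (g = Suc (g - 1) \<and> i = gadget_vertex N a b c (g - 1)) \<or>
      (g = 2 \<and> i = gadget_vertex N a b c 0)" by argo
    then show ?thesis using that by (elim disjE conjE) assumption+
  qed
  then show ?thesis
  proof cases
    case 1 then show ?thesis using jg f[OF j(1)] by (simp add: gadget_col_def)
  next
    case 2 then show ?thesis using jg f[OF j(2)] by (simp add: gadget_col_def)
  next
    case 3 then show ?thesis using jg b by (simp add: gadget_col_def)
  next
    case 4 then show ?thesis using jg b by (simp add: gadget_col_def)
  next
    case 5 then show ?thesis using jg f[OF j(3)] s by (simp add: gadget_col_def)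
  next
    case (6 g')
    have "horn_col N \<sigma> i = gadget_col (\<sigma> a) (\<sigma> b) ! g'"
      using horn_col_gadget[OF j(1-3), of g'] 6 j(4) by simp
    moreover have "g' = 0 \<or> g' = 1 \<or> g' = 2 \<or> g' = 3" using 6(1) j(4) by auto
    ultimately show ?thesis using jg 6(1) by (elim disjE) (simp_all add: gadget_col_def)
  next
    case 7
    have "horn_col N \<sigma> i = gadget_col (\<sigma> a) (\<sigma> b) ! 0"
      using horn_col_gadget[OF j(1-3), of 0] 7 by simp
    then show ?thesis using jg 7(1) by (simp add: gadget_col_def)
  qed
qed

lemma horn_sat_of_coloring:
  fixes h :: "nat \<Rightarrow> nat"
  assumes rng: "\<And>i. h i \<in> {1..3}" and adj: "\<And>i j. horn_adj N ini cpl rul i j \<Longrightarrow> h i \<noteq> h j"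
  shows "horn_sat N ini cpl rul (\<lambda>a. h (3 + a) = h 1)"
proof -
  have c: "h i = 1 \<or> h i = 2 \<or> h i = 3" for i using rng[of i] by auto
  have base: "h 0 \<noteq> h 1" "h 0 \<noteq> h 2" "h 1 \<noteq> h 2"
    using adj[of 0 1] adj[of 0 2] adj[of 1 2] by (simp_all add: horn_adj_def horn_size_def)
  have f2: "h 2 \<noteq> h (3 + a)" if "a < N" for a
    using adj[of 2 "3 + a"] that by (simp add: horn_adj_def horn_size_def)
  have f: "h (3 + a) = h 0 \<or> h (3 + a) = h 1" if "a < N" for a
    using c[of 0] c[of 1] c[of 2] c[of "3 + a"] base f2[OF that] by metis
  show ?thesis
    unfolding horn_sat_def
  proof (intro conjI allI impI)
    fix a assume "a < N" "ini a"
    then have "h 0 \<noteq> h (3 + a)" using adj[of 0 "3 + a"] by (simp add: horn_adj_def horn_size_def)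
    then show "h (3 + a) = h 1" using f[OF \<open>a < N\<close>] by metis
  next
    fix a b assume ab: "a < N" "b < N" "cpl a b"
    then have "h (3 + a) \<noteq> h (3 + b)" using adj[of "3 + a" "3 + b"] by (simp add: horn_adj_def horn_size_def)
    then show "(h (3 + a) = h 1) \<noteq> (h (3 + b) = h 1)" using f[OF ab(1)] f[OF ab(2)] by metis
  next
    fix a b d assume abd: "a < N" "b < N" "d < N" "rul a b d" "h (3 + a) = h 1" "h (3 + b) = h 1"
    let ?v = "gadget_vertex N a b d"
    have A: "h i \<noteq> h (?v g)" if "g < 5" "i < horn_size N"
      "(g = 0 \<and> i = 3 + a) \<or> (g = 1 \<and> i = 3 + b) \<or> (g = 3 \<and> i = 0) \<or> (g = 4 \<and> (i = 1 \<or> i = 3 + d)) \<or>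
      (1 \<le> g \<and> i + 1 = ?v g) \<or> (g = 2 \<and> i + 2 = ?v g)" for g i
      using adj[of i "?v g"] horn_adj_gadget[OF abd(1-3) that(1)] that abd(4) by blast
    have sz: "3 + a < horn_size N" "3 + b < horn_size N" "3 + d < horn_size N" "0 < horn_size N" "1 < horn_size N"
      using abd by (auto simp: horn_size_def)
    have gz: "?v g < horn_size N" if "g < 5" for g using gadget_vertex_decode(5)[OF abd(1-3) that] .
    have e: "h (3 + a) \<noteq> h (?v 0)" "h (3 + b) \<noteq> h (?v 1)" "h 0 \<noteq> h (?v 3)" "h 1 \<noteq> h (?v 4)"
      "h (3 + d) \<noteq> h (?v 4)"
      using A[of 0 "3 + a"] A[of 1 "3 + b"] A[of 3 0] A[of 4 1] A[of 4 "3 + d"] sz by simp_all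
    have v: "?v 0 + 1 = ?v 1" "?v 1 + 1 = ?v 2" "?v 2 + 1 = ?v 3" "?v 3 + 1 = ?v 4" "?v 0 + 2 = ?v 2"
      by (simp_all add: gadget_vertex_def)
    have e': "h (?v 0) \<noteq> h (?v 1)" "h (?v 1) \<noteq> h (?v 2)" "h (?v 2) \<noteq> h (?v 3)" "h (?v 3) \<noteq> h (?v 4)"
      "h (?v 0) \<noteq> h (?v 2)"
      using A[of 1 "?v 0"] A[of 2 "?v 1"] A[of 3 "?v 2"] A[of 4 "?v 3"] A[of 2 "?v 0"] gz v by simp_all
    have 2: "h (?v 2) = h 1"
      using c[of "?v 0"] c[of "?v 1"] c[of "?v 2"] c[of 1] e(1,2) e'(1,2,5) abd(5,6) by metis
    have 3: "h (?v 3) = h 2"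
      using c[of "?v 3"] c[of 0] c[of 1] c[of 2] base e(3) e'(3) 2 by metis
    have "h (?v 4) = h 0"
      using c[of "?v 4"] c[of 0] c[of 1] c[of 2] base e(4) e'(4) 3 by metis
    then show "h (3 + d) = h 1" using f[OF abd(3)] e(5) by metis
  qed
qed

section \<open>Computations as Horn systems\<close>

text \<open>The facts about a computation have a kind, a time and a position; position \<open>T + i\<close> stands for
  tape cell \<open>i\<close>, and facts that do not concern a cell have position \<open>0\<close>.  \<open>St q ss\<close> says that the
  machine is in state \<open>q\<close> and reads \<open>ss\<close> on the first tapes; \<open>Nb\<close>, \<open>On\<close> and \<open>Off\<close> describe
  the guessed second input.\<close>

datatype kind = Rejected | St nat "nat list" | Rd nat nat | Hd nat | Cl nat nat | Nb | On | Off

text \<open>Made total by letting the halting state repeat its configuration, so that all runs can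
  be inspected at the same time T.\<close>

definition tm_delta :: "tm \<Rightarrow> nat \<Rightarrow> nat list \<Rightarrow> nat \<times> (nat \<times> move) list" where
  "tm_delta M q ss = (if q < num_states M then delta M q ss else (q, map (\<lambda>s. (s, Stay)) ss))"

definition read_rule :: "kind \<Rightarrow> kind \<Rightarrow> kind \<Rightarrow> bool" where
  "read_rule a b c \<longleftrightarrow> (\<exists>\<tau> s. a = Hd \<tau> \<and> b = Cl \<tau> s \<and> c = Rd \<tau> s)"

text \<open>Rules have only two premises, so the symbols under the heads are gathered tape by tape;
  once all are known, \<open>St\<close> determines the transition. Rules with a single premise
  simply repeat it.\<close>

definition collect_rule :: "kind \<Rightarrow> kind \<Rightarrow> kind \<Rightarrow> bool" where
  "collect_rule a b c \<longleftrightarrow> (\<exists>q ss s. a = St q ss \<and> b = Rd (length ss) s \<and> c = St q (ss @ [s]))"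

definition state_rule :: "tm \<Rightarrow> kind \<Rightarrow> kind \<Rightarrow> kind \<Rightarrow> bool" where
  "state_rule M a b c \<longleftrightarrow> (\<exists>q ss. a = St q ss \<and> length ss = num_tapes M \<and> b = a \<and>
     c = St (fst (tm_delta M q ss)) [])"

definition move_rule :: "tm \<Rightarrow> move \<Rightarrow> kind \<Rightarrow> kind \<Rightarrow> kind \<Rightarrow> bool" where
  "move_rule M m a b c \<longleftrightarrow> (\<exists>q ss \<tau>. a = St q ss \<and> length ss = num_tapes M \<and> b = Hd \<tau> \<and> \<tau> < num_tapes M \<and>
     snd (snd (tm_delta M q ss) ! \<tau>) = m \<and> c = Hd \<tau>)"

definition write_rule :: "tm \<Rightarrow> kind \<Rightarrow> kind \<Rightarrow> kind \<Rightarrow> bool" where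
  "write_rule M a b c \<longleftrightarrow> (\<exists>q ss \<tau>. a = St q ss \<and> length ss = num_tapes M \<and> b = Hd \<tau> \<and> \<tau> < num_tapes M \<and>
     c = Cl \<tau> (fst (snd (tm_delta M q ss) ! \<tau>)))"

text \<open>A Horn rule cannot say that the head is not at a cell. The premise that it is at a
  different position takes the place of this negation.\<close>

definition keep_rule :: "kind \<Rightarrow> kind \<Rightarrow> kind \<Rightarrow> bool" where
  "keep_rule a b c \<longleftrightarrow> (\<exists>\<tau> s. a = Hd \<tau> \<and> b = Cl \<tau> s \<and> c = b)"

definition guess_rule :: "kind \<Rightarrow> kind \<Rightarrow> kind \<Rightarrow> bool" where
  "guess_rule a b c \<longleftrightarrow> a = Nb \<and> ((b = On \<and> c = Cl 1 2) \<or> (b = Off \<and> c = Cl 1 1))"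

definition blank_rule :: "kind \<Rightarrow> kind \<Rightarrow> kind \<Rightarrow> bool" where
  "blank_rule a b c \<longleftrightarrow> a = Cl 1 0 \<and> b = a \<and> c = a"

definition reject_rule :: "kind \<Rightarrow> kind \<Rightarrow> kind \<Rightarrow> bool" where
  "reject_rule a b c \<longleftrightarrow> (\<exists>s. a = Cl 0 s \<and> s \<noteq> 2) \<and> b = a \<and> c = Rejected"

text \<open>Nonblank cells of the guessed tape obtain their bit from \<open>On\<close> or
  \<open>Off\<close>, and a blank cell makes the next one blank, so the guess is a contiguous
  string. The blank rule starts at position T, lest the blanks to the left of cell 0 erase the
  witness. At time T, any symbol other than the bit for true in cell 0 of the first tape leads to
  rejection.\<close>

definition comp_rule :: "tm \<Rightarrow> nat \<Rightarrow> kind \<Rightarrow> nat \<Rightarrow> nat \<Rightarrow> kind \<Rightarrow> nat \<Rightarrow> nat \<Rightarrow> kind \<Rightarrow> nat \<Rightarrow> nat \<Rightarrow> bool" where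
  "comp_rule M T a t i b u j c v k \<longleftrightarrow> u = t \<and>
     ((v = t \<and> j = i \<and> k = 0 \<and> read_rule a b c) \<or>
      (v = t \<and> i = 0 \<and> j = 0 \<and> k = 0 \<and> collect_rule a b c) \<or>
      (v = t + 1 \<and> i = 0 \<and> j = 0 \<and> k = 0 \<and> state_rule M a b c) \<or>
      (v = t + 1 \<and> i = 0 \<and> k = j \<and> move_rule M Stay a b c) \<or>
      (v = t + 1 \<and> i = 0 \<and> k = j + 1 \<and> move_rule M Move_Right a b c) \<or>
      (v = t + 1 \<and> i = 0 \<and> k + 1 = j \<and> move_rule M Move_Left a b c) \<or>
      (v = t + 1 \<and> i = 0 \<and> k = j \<and> write_rule M a b c) \<or>
      (v = t + 1 \<and> i \<noteq> j \<and> k = j \<and> keep_rule a b c) \<or>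
      (t = 0 \<and> v = 0 \<and> j = i \<and> k = i \<and> guess_rule a b c) \<or>
      (t = 0 \<and> v = 0 \<and> j = i \<and> k = i + 1 \<and> T \<le> i \<and> blank_rule a b c) \<or>
      (t = T \<and> v = 0 \<and> i = T \<and> j = T \<and> k = 0 \<and> reject_rule a b c))"

text \<open>The second tape is declared blank only outside the Q cells reserved for the witness;
  within them the complementary pairs decide.\<close>

definition comp_init :: "tm \<Rightarrow> bool list \<Rightarrow> nat \<Rightarrow> nat \<Rightarrow> kind \<Rightarrow> nat \<Rightarrow> nat \<Rightarrow> bool" where
  "comp_init M x T Q a t i \<longleftrightarrow> t = 0 \<and>
     ((i = 0 \<and> a = St 0 []) \<or>
      (i = T \<and> (\<exists>\<tau><num_tapes M. a = Hd \<tau>)) \<or>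
      (i < T \<and> a = Cl 0 0) \<or>
      (T \<le> i \<and> fst (input_tape x) (int (i - T)) = 0 \<and> a = Cl 0 0) \<or>
      (T \<le> i \<and> fst (input_tape x) (int (i - T)) = 1 \<and> a = Cl 0 1) \<or>
      (T \<le> i \<and> fst (input_tape x) (int (i - T)) = 2 \<and> a = Cl 0 2) \<or>
      (\<exists>\<tau><num_tapes M. 2 \<le> \<tau> \<and> a = Cl \<tau> 0) \<or>
      ((i < T \<or> T + Q \<le> i) \<and> a = Cl 1 0))"

definition comp_compl :: "nat \<Rightarrow> nat \<Rightarrow> kind \<Rightarrow> nat \<Rightarrow> nat \<Rightarrow> kind \<Rightarrow> nat \<Rightarrow> nat \<Rightarrow> bool" where
  "comp_compl T Q a t i b u j \<longleftrightarrow> t = 0 \<and> u = 0 \<and> j = i \<and> T \<le> i \<and> i < T + Q \<and>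
     ((a = Cl 1 0 \<and> b = Nb) \<or> (a = On \<and> b = Off))"

definition kinds :: "tm \<Rightarrow> kind set" where
  "kinds M = {Rejected, Nb, On, Off} \<union>
     (\<lambda>(q, ss). St q ss) ` ({..num_states M} \<times> {ss. set ss \<subseteq> {..<num_symbols M} \<and> length ss \<le> num_tapes M}) \<union>
     (\<lambda>(\<tau>, s). Rd \<tau> s) ` ({..<num_tapes M} \<times> {..<num_symbols M}) \<union>
     Hd ` {..<num_tapes M} \<union> (\<lambda>(\<tau>, s). Cl \<tau> s) ` ({..<num_tapes M} \<times> {..<num_symbols M})"

lemma finite_kinds: "finite (kinds M)"
  unfolding kinds_def by (intro finite_UnI finite_imageI finite_cartesian_product finite_lists_length_le) auto

definition conf :: "tm \<Rightarrow> bool list \<Rightarrow> bool list \<Rightarrow> nat \<Rightarrow> tm_config" where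
  "conf M x w t = (tm_step M ^^ t) (tm_init M [x, w])"

definition good_conf :: "tm \<Rightarrow> tm_config \<Rightarrow> bool" where
  "good_conf M c \<longleftrightarrow> fst c \<le> num_states M \<and> length (snd c) = num_tapes M \<and>
     (\<forall>\<tau><num_tapes M. \<forall>i. fst (snd c ! \<tau>) i < num_symbols M)"

lemma read_tape_eq: "read_tape tp = fst tp (snd tp)"
  by (cases tp) simp

lemma tm_step_delta:
  "tm_step M (q, ts) = (fst (tm_delta M q (map read_tape ts)), map2 act_tape (snd (tm_delta M q (map read_tape ts))) ts)"
proof (cases "q < num_states M")
  case True
  then show ?thesis by (simp add: tm_delta_def case_prod_beta)
next
  case False
  have "map2 act_tape (map (\<lambda>s. (s, Stay)) (map read_tape ts)) ts = ts"
    by (induction ts) auto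
  then show ?thesis using False by (simp add: tm_delta_def)
qed

lemma good_conf_reads:
  assumes "good_conf M (q, ts)"
  shows "set (map read_tape ts) \<subseteq> {..<num_symbols M}" "length (map read_tape ts) = num_tapes M"
proof -
  show "length (map read_tape ts) = num_tapes M" using assms by (simp add: good_conf_def)
  show "set (map read_tape ts) \<subseteq> {..<num_symbols M}"
  proof
    fix s assume "s \<in> set (map read_tape ts)"
    then obtain \<tau> where "\<tau> < length ts" "s = read_tape (ts ! \<tau>)" by (auto simp: in_set_conv_nth)
    then show "s \<in> {..<num_symbols M}" using assms by (auto simp: good_conf_def read_tape_eq)
  qed
qed

lemma tm_delta_wf:
  assumes M: "wf_tm M" and q: "q \<le> num_states M" and ss: "length ss = num_tapes M" "set ss \<subseteq> {..<num_symbols M}"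
  shows "fst (tm_delta M q ss) \<le> num_states M" "length (snd (tm_delta M q ss)) = num_tapes M"
    "\<tau> < num_tapes M \<Longrightarrow> fst (snd (tm_delta M q ss) ! \<tau>) < num_symbols M"
proof -
  have "fst (tm_delta M q ss) \<le> num_states M \<and> length (snd (tm_delta M q ss)) = num_tapes M \<and>
    fst ` set (snd (tm_delta M q ss)) \<subseteq> {..<num_symbols M}"
  proof (cases "q < num_states M")
    case True
    obtain q' as where d: "delta M q ss = (q', as)" by fastforce
    then have "q' \<le> num_states M \<and> length as = num_tapes M \<and> fst ` set as \<subseteq> {..<num_symbols M}"
      using M True ss unfolding wf_tm_def by blast
    then show ?thesis using True d by (simp add: tm_delta_def)
  next
    case False
    then show ?thesis using ss q by (auto simp: tm_delta_def)
  qed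
  then show "fst (tm_delta M q ss) \<le> num_states M" "length (snd (tm_delta M q ss)) = num_tapes M"
    "\<tau> < num_tapes M \<Longrightarrow> fst (snd (tm_delta M q ss) ! \<tau>) < num_symbols M"
    using nth_mem[of \<tau> "snd (tm_delta M q ss)"] by (auto simp: image_subset_iff)
qed

lemma step_tape:
  assumes M: "wf_tm M" and c: "good_conf M (q, ts)" and \<tau>: "\<tau> < num_tapes M"
  defines "as \<equiv> snd (tm_delta M q (map read_tape ts))"
  shows "fst (snd (tm_step M (q, ts)) ! \<tau>) = (fst (ts ! \<tau>))(snd (ts ! \<tau>) := fst (as ! \<tau>))"
    "snd (snd (tm_step M (q, ts)) ! \<tau>) = snd (ts ! \<tau>) + move_offset (snd (as ! \<tau>))"
proof -
  have len: "length ts = num_tapes M" "length as = num_tapes M"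
    using c tm_delta_wf(2)[OF M _ good_conf_reads(2,1)[OF c]] by (auto simp: good_conf_def as_def)
  have "snd (tm_step M (q, ts)) ! \<tau> = act_tape (as ! \<tau>) (ts ! \<tau>)"
    unfolding tm_step_delta as_def[symmetric] using \<tau> len by simp
  then show "fst (snd (tm_step M (q, ts)) ! \<tau>) = (fst (ts ! \<tau>))(snd (ts ! \<tau>) := fst (as ! \<tau>))"
    "snd (snd (tm_step M (q, ts)) ! \<tau>) = snd (ts ! \<tau>) + move_offset (snd (as ! \<tau>))"
    by (cases "as ! \<tau>"; cases "ts ! \<tau>"; simp)+
qed

lemma good_conf_step:
  assumes M: "wf_tm M" and c: "good_conf M (q, ts)"
  shows "good_conf M (tm_step M (q, ts))"
proof -
  let ?as = "snd (tm_delta M q (map read_tape ts))"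
  have q: "q \<le> num_states M" using c by (simp add: good_conf_def)
  note d = tm_delta_wf[OF M q good_conf_reads(2,1)[OF c]]
  have "fst (snd (tm_step M (q, ts)) ! \<tau>) i < num_symbols M" if \<tau>: "\<tau> < num_tapes M" for \<tau> i
    unfolding step_tape(1)[OF M c \<tau>] using d(3)[OF \<tau>] c \<tau> by (simp add: good_conf_def)
  moreover have "length (snd (tm_step M (q, ts))) = num_tapes M"
    unfolding tm_step_delta using d(2) c by (simp add: good_conf_def)
  moreover have "fst (tm_step M (q, ts)) \<le> num_states M" unfolding tm_step_delta using d(1) by simp
  ultimately show ?thesis unfolding good_conf_def by blast
qed

lemma good_conf_conf:
  assumes M: "wf_tm M"
  shows "good_conf M (conf M x w t)"
proof (induction t)
  case 0
  have "3 \<le> num_symbols M" using M by (simp add: wf_tm_def)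
  then show ?case by (auto simp: conf_def good_conf_def tm_init_def input_tape_def bit_symbol_def)
next
  case (Suc t)
  obtain q ts where c: "conf M x w t = (q, ts)" by fastforce
  then have "conf M x w (Suc t) = tm_step M (q, ts)" by (simp add: conf_def)
  then show ?case using good_conf_step[OF M] Suc c by simp
qed

lemma conf_0:
  assumes "2 \<le> num_tapes M"
  shows "fst (conf M x w 0) = 0"
    "\<tau> < num_tapes M \<Longrightarrow> snd (conf M x w 0) ! \<tau> = input_tape (if \<tau> = 0 then x else if \<tau> = 1 then w else [])"
proof -
  show "fst (conf M x w 0) = 0" by (simp add: conf_def tm_init_def)
  assume "\<tau> < num_tapes M"
  then have "snd (conf M x w 0) ! \<tau> = input_tape (if \<tau> < 2 then [x, w] ! \<tau> else [])"
    by (simp add: conf_def tm_init_def)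
  moreover have "\<tau> < 2 \<longleftrightarrow> \<tau> = 0 \<or> \<tau> = 1" by auto
  ultimately show "snd (conf M x w 0) ! \<tau> = input_tape (if \<tau> = 0 then x else if \<tau> = 1 then w else [])"
    by auto
qed

section \<open>The facts that hold in a computation\<close>

text \<open>The intended meaning of the facts for a fixed witness w. \<open>Off\<close> is the exact
  negation of \<open>On\<close> at every position, so that the pair is complementary also on
  reserved cells beyond the end of w.\<close>

fun holds_in :: "tm \<Rightarrow> bool list \<Rightarrow> bool list \<Rightarrow> nat \<Rightarrow> kind \<Rightarrow> nat \<Rightarrow> nat \<Rightarrow> bool" where
  "holds_in M x w T (St q ss) t i \<longleftrightarrow> i = 0 \<and> q = fst (conf M x w t) \<and> length ss \<le> num_tapes M \<and>
     ss = take (length ss) (map read_tape (snd (conf M x w t)))"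
| "holds_in M x w T (Rd \<tau> s) t i \<longleftrightarrow> i = 0 \<and> \<tau> < num_tapes M \<and> s = read_tape (snd (conf M x w t) ! \<tau>)"
| "holds_in M x w T (Hd \<tau>) t i \<longleftrightarrow> \<tau> < num_tapes M \<and> int i - int T = snd (snd (conf M x w t) ! \<tau>)"
| "holds_in M x w T (Cl \<tau> s) t i \<longleftrightarrow> \<tau> < num_tapes M \<and> s = fst (snd (conf M x w t) ! \<tau>) (int i - int T)"
| "holds_in M x w T Nb t i \<longleftrightarrow> t = 0 \<and> T \<le> i \<and> i < T + length w"
| "holds_in M x w T On t i \<longleftrightarrow> t = 0 \<and> T \<le> i \<and> i < T + length w \<and> w ! (i - T)"
| "holds_in M x w T Off t i \<longleftrightarrow> \<not> (t = 0 \<and> T \<le> i \<and> i < T + length w \<and> w ! (i - T))"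
| "holds_in M x w T Rejected t i \<longleftrightarrow> False"

lemma holds_in_init:
  assumes "2 \<le> num_tapes M" "length w \<le> Q" "comp_init M x T Q a t i"
  shows "holds_in M x w T a t i"
proof -
  have t: "t = 0" using assms(3) by (simp add: comp_init_def)
  have i: "int (i - T) = int i - int T" if "T \<le> i" using that by simp
  show ?thesis
    using assms(3) unfolding comp_init_def t
    by (elim conjE disjE exE)
      (use assms(1,2) in \<open>auto simp: conf_0 t i input_tape_def\<close>)
qed

lemma holds_in_compl:
  assumes "2 \<le> num_tapes M" "comp_compl T Q a t i b u j"
  shows "holds_in M x w T a t i \<noteq> holds_in M x w T b u j"
  using assms by (auto simp: comp_compl_def conf_0 input_tape_def bit_symbol_def split: if_splits)

lemma full_state:
  assumes "wf_tm M" "holds_in M x w T (St q ss) t i" "length ss = num_tapes M"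
  shows "i = 0" "conf M x w t = (q, snd (conf M x w t))" "ss = map read_tape (snd (conf M x w t))"
proof -
  have "length (snd (conf M x w t)) = num_tapes M"
    using good_conf_conf[OF assms(1), of x w t] by (simp add: good_conf_def)
  then show "i = 0" "conf M x w t = (q, snd (conf M x w t))" "ss = map read_tape (snd (conf M x w t))"
    using assms(2,3) by (auto simp: prod_eq_iff)
qed

text \<open>The facts of an actual run are closed under all rules. Acceptance at time T is what
  excludes the premise of the reject rule.\<close>

lemma holds_in_rule:
  assumes M: "wf_tm M" "2 \<le> num_tapes M" and acc: "fst (snd (conf M x w T) ! 0) 0 = 2"
    and r: "comp_rule M T a t i b u j c v k" and a: "holds_in M x w T a t i" and b: "holds_in M x w T b u j"
  shows "holds_in M x w T c v k"
proof -
  have u: "u = t" using r by (simp add: comp_rule_def)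
  define ts where "ts = snd (conf M x w t)"
  have good: "good_conf M (conf M x w t)" by (rule good_conf_conf[OF M(1)])
  have len: "length ts = num_tapes M" using good by (simp add: good_conf_def ts_def)
  have step: "conf M x w (t + 1) = tm_step M (conf M x w t)" by (simp add: conf_def)
  have full: "conf M x w t = (q, ts)" "ss = map read_tape ts" "good_conf M (q, ts)"
    "conf M x w (t + 1) = tm_step M (q, ts)"
    if "a = St q ss" "length ss = num_tapes M" for q ss
    using full_state[OF M(1) a[unfolded that(1)] that(2)] good step by (simp_all add: ts_def)
  have mv: "holds_in M x w T c (t + 1) k" if m: "move_rule M m a b c" and k: "int k = int j + move_offset m" for m
  proof -
    obtain q ss \<tau> where *: "a = St q ss" "length ss = num_tapes M" "b = Hd \<tau>" "\<tau> < num_tapes M"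
      "snd (snd (tm_delta M q ss) ! \<tau>) = m" "c = Hd \<tau>" using m by (auto simp: move_rule_def)
    note f = full[OF *(1,2)]
    have "snd (ts ! \<tau>) = int j - int T" using b *(3) by (simp add: u ts_def)
    then show ?thesis using *(4-6) step_tape(2)[OF M(1) f(3) *(4)] f k by simp
  qed
  show ?thesis
    using r[unfolded comp_rule_def]
  proof (elim conjE disjE)
    assume rd: "v = t" "j = i" "k = 0" "read_rule a b c"
    obtain \<tau> s where "a = Hd \<tau>" "b = Cl \<tau> s" "c = Rd \<tau> s" using rd(4) by (auto simp: read_rule_def)
    then show ?thesis using a b by (simp add: rd(1-3) u read_tape_eq)
  next
    assume co: "v = t" "i = 0" "j = 0" "k = 0" "collect_rule a b c"
    obtain q ss s where *: "a = St q ss" "b = Rd (length ss) s" "c = St q (ss @ [s])"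
      using co(5) by (auto simp: collect_rule_def)
    have l: "length ss < num_tapes M" "s = read_tape (ts ! length ss)" using b * by (simp_all add: u ts_def)
    have "take (length (ss @ [s])) (map read_tape ts) = take (length ss) (map read_tape ts) @ [map read_tape ts ! length ss]"
      using l len by (simp add: take_Suc_conv_app_nth)
    then have "take (length (ss @ [s])) (map read_tape ts) = ss @ [s]" using a * l len by (simp add: ts_def)
    then show ?thesis using a * l by (simp add: co(1-4) ts_def)
  next
    assume st: "v = t + 1" "k = 0" "state_rule M a b c"
    obtain q ss where *: "a = St q ss" "length ss = num_tapes M" "c = St (fst (tm_delta M q ss)) []"
      using st(3) by (auto simp: state_rule_def)
    note f = full[OF *(1,2)]
    show ?thesis using f(2,4) *(3) st(1,2) by (simp add: tm_step_delta del: tm_step.simps)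
  next
    assume m0: "v = t + 1" "k = j" "move_rule M Stay a b c"
    then show ?thesis using mv by simp
  next
    assume mr: "v = t + 1" "k = j + 1" "move_rule M Move_Right a b c"
    then show ?thesis using mv by simp
  next
    assume ml: "v = t + 1" "k + 1 = j" "move_rule M Move_Left a b c"
    then show ?thesis using mv[OF ml(3)] by (simp add: ml(2)[symmetric])
  next
    assume wr: "v = t + 1" "k = j" "write_rule M a b c"
    obtain q ss \<tau> where *: "a = St q ss" "length ss = num_tapes M" "b = Hd \<tau>" "\<tau> < num_tapes M"
      "c = Cl \<tau> (fst (snd (tm_delta M q ss) ! \<tau>))" using wr(3) by (auto simp: write_rule_def)
    note f = full[OF *(1,2)]
    have "snd (ts ! \<tau>) = int j - int T" using b *(3) by (simp add: u ts_def)
    then show ?thesis using *(4,5) step_tape(1)[OF M(1) f(3) *(4)] f wr(1,2) by simp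
  next
    assume kp: "v = t + 1" "i \<noteq> j" "k = j" "keep_rule a b c"
    obtain \<tau> s where *: "a = Hd \<tau>" "b = Cl \<tau> s" "c = b" using kp(4) by (auto simp: keep_rule_def)
    obtain q where q: "conf M x w t = (q, ts)" unfolding ts_def by (metis prod.collapse)
    have \<tau>: "\<tau> < num_tapes M" and h: "snd (ts ! \<tau>) = int i - int T" "s = fst (ts ! \<tau>) (int j - int T)"
      using a b * by (simp_all add: u ts_def)
    have "int j - int T \<noteq> snd (ts ! \<tau>)" using h kp(2) by simp
    then have "fst (snd (tm_step M (q, ts)) ! \<tau>) (int j - int T) = s"
      unfolding step_tape(1)[OF M(1) good[unfolded q] \<tau>] using h by simp
    then show ?thesis using * \<tau> kp(1,3) step q by simp
  next
    assume gs: "t = 0" "v = 0" "j = i" "k = i" "guess_rule a b c"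
    have d: "nat (int i - int T) = i - T" by (simp add: nat_diff_distrib')
    show ?thesis using gs(5) a b M(2)
      by (auto simp: guess_rule_def gs(1-4) u conf_0 input_tape_def bit_symbol_def d)
  next
    assume bl: "t = 0" "v = 0" "k = i + 1" "T \<le> i" "blank_rule a b c"
    have "a = Cl 1 0" "c = Cl 1 0" using bl(5) by (auto simp: blank_rule_def)
    then show ?thesis using a bl(4) M(2)
      by (auto simp: bl(1-3) conf_0 input_tape_def bit_symbol_def split: if_splits)
  next
    assume rj: "t = T" "i = T" "reject_rule a b c"
    then show ?thesis using a acc by (auto simp: reject_rule_def)
  qed
qed

lemma kinds_iff:
  "St q ss \<in> kinds M \<longleftrightarrow> q \<le> num_states M \<and> set ss \<subseteq> {..<num_symbols M} \<and> length ss \<le> num_tapes M"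
  "Rd \<tau> s \<in> kinds M \<longleftrightarrow> \<tau> < num_tapes M \<and> s < num_symbols M"
  "Hd \<tau> \<in> kinds M \<longleftrightarrow> \<tau> < num_tapes M"
  "Cl \<tau> s \<in> kinds M \<longleftrightarrow> \<tau> < num_tapes M \<and> s < num_symbols M"
  "Rejected \<in> kinds M" "Nb \<in> kinds M" "On \<in> kinds M" "Off \<in> kinds M"
  unfolding kinds_def by (auto simp: image_iff)

text \<open>From a closed set S without rejection a witness is read off. S may contain more facts
  than the run of this witness, but by induction on time it contains all facts of the run, and so
  rejection would be derived if the output were not true. In T steps the heads stay within distance
  T of cell 0, which gives the width 2T + 1.\<close>

lemma comp_sound:
  fixes S :: "kind \<Rightarrow> nat \<Rightarrow> nat \<Rightarrow> bool"
  assumes M: "wf_tm M" "2 \<le> num_tapes M" and Q: "Q \<le> T" and W: "W = 2 * T + 1"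
    and ini: "\<And>a t i. a \<in> kinds M \<Longrightarrow> t < W \<Longrightarrow> i < W \<Longrightarrow> comp_init M x T Q a t i \<Longrightarrow> S a t i"
    and cpl: "\<And>a t i b u j. a \<in> kinds M \<Longrightarrow> t < W \<Longrightarrow> i < W \<Longrightarrow> b \<in> kinds M \<Longrightarrow> u < W \<Longrightarrow> j < W \<Longrightarrow>
      comp_compl T Q a t i b u j \<Longrightarrow> \<not> S a t i \<Longrightarrow> S b u j"
    and rul: "\<And>a t i b u j c v k. a \<in> kinds M \<Longrightarrow> t < W \<Longrightarrow> i < W \<Longrightarrow> b \<in> kinds M \<Longrightarrow> u < W \<Longrightarrow> j < W \<Longrightarrow>
      c \<in> kinds M \<Longrightarrow> v < W \<Longrightarrow> k < W \<Longrightarrow> comp_rule M T a t i b u j c v k \<Longrightarrow> S a t i \<Longrightarrow> S b u j \<Longrightarrow> S c v k"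
    and rej: "\<not> S Rejected 0 0"
  shows "\<exists>w. length w \<le> Q \<and> fst (snd (conf M x w T) ! 0) 0 = 2"
proof -
  have sym3: "3 \<le> num_symbols M" using M(1) by (simp add: wf_tm_def)
  have K: "0 < num_tapes M" "1 < num_tapes M" using M(2) by auto
  have cl1: "Cl 1 0 \<in> kinds M" "Cl 1 1 \<in> kinds M" "Cl 1 2 \<in> kinds M"
    "Cl 0 0 \<in> kinds M" "Cl 0 1 \<in> kinds M" "Cl 0 2 \<in> kinds M"
    using sym3 K by (simp_all add: kinds_iff)
  have W0: "0 < W" using W by simp
  \<comment> \<open>The witness ends at the first reserved cell for which S contains a blank, or
    after all Q cells if there is none.\<close>
  define L where "L = (LEAST i. i = Q \<or> S (Cl 1 0) 0 (T + i))"
  have L: "L = Q \<or> S (Cl 1 0) 0 (T + L)" unfolding L_def by (rule LeastI[of _ Q]) simp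
  have LQ: "L \<le> Q" unfolding L_def by (rule Least_le) simp
  have Lmin: "\<not> S (Cl 1 0) 0 (T + i)" if "i < L" for i
    using not_less_Least[of i "\<lambda>i. i = Q \<or> S (Cl 1 0) 0 (T + i)"] that unfolding L_def by blast
  define w where "w = map (\<lambda>i. S On 0 (T + i)) [0..<L]"
  have w: "length w = L" by (simp add: w_def)
  have bits: "S (Cl 1 (bit_symbol (w ! i))) 0 (T + i)" if i: "i < L" for i
  proof -
    have iW: "T + i < W" using i LQ Q W by simp
    have rng: "T \<le> T + i" "T + i < T + Q" using i LQ by auto
    have nb: "S Nb 0 (T + i)"
      by (rule cpl[of "Cl 1 0" 0 "T + i"]) (use cl1 iW rng W0 Lmin[OF i] in \<open>auto simp: kinds_iff comp_compl_def\<close>)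
    have wi: "w ! i = S On 0 (T + i)" using i by (simp add: w_def)
    show ?thesis
    proof (cases "S On 0 (T + i)")
      case True
      have "S (Cl 1 2) 0 (T + i)"
        by (rule rul[of Nb 0 "T + i" On 0 "T + i"])
          (use cl1 iW W0 nb True in \<open>auto simp: kinds_iff comp_rule_def guess_rule_def\<close>)
      then show ?thesis using True wi by (simp add: bit_symbol_def)
    next
      case False
      have off: "S Off 0 (T + i)"
        by (rule cpl[of On 0 "T + i"]) (use iW rng W0 False in \<open>auto simp: kinds_iff comp_compl_def\<close>)
      have "S (Cl 1 1) 0 (T + i)"
        by (rule rul[of Nb 0 "T + i" Off 0 "T + i"])
          (use cl1 iW W0 nb off in \<open>auto simp: kinds_iff comp_rule_def guess_rule_def\<close>)
      then show ?thesis using False wi by (simp add: bit_symbol_def)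
    qed
  qed
  have blanks: "S (Cl 1 0) 0 (T + (L + d))" if "T + (L + d) < W" for d
    using that
  proof (induction d)
    case 0
    show ?case
    proof (cases "L = Q")
      case True
      have "comp_init M x T Q (Cl 1 0) 0 (T + Q)" by (simp add: comp_init_def)
      then show ?thesis using ini[OF cl1(1) W0, of "T + Q"] 0 True by simp
    qed (use L in simp)
  next
    case (Suc d)
    have "comp_rule M T (Cl 1 0) 0 (T + (L + d)) (Cl 1 0) 0 (T + (L + d)) (Cl 1 0) 0 (T + (L + Suc d))"
      unfolding comp_rule_def blank_rule_def by simp
    then show ?case
      using rul[OF cl1(1) W0 _ cl1(1) W0 _ cl1(1) W0, of "T + (L + d)" "T + (L + d)" "T + (L + Suc d)"] Suc by simp
  qed
  \<comment> \<open>The bound on the head positions keeps every move within the positions below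
    \<open>W\<close>.\<close>
  have inv: "S (St (fst (conf M x w t)) []) t 0 \<and>
    (\<forall>\<tau><num_tapes M. \<bar>snd (snd (conf M x w t) ! \<tau>)\<bar> \<le> int t \<and> S (Hd \<tau>) t (nat (snd (snd (conf M x w t) ! \<tau>) + int T))) \<and>
    (\<forall>\<tau><num_tapes M. \<forall>i<W. S (Cl \<tau> (fst (snd (conf M x w t) ! \<tau>) (int i - int T))) t i)" if "t \<le> T" for t
    using that
  proof (induction t)
    case 0
    have "S (St 0 []) 0 0" by (rule ini) (auto simp: kinds_iff W0 comp_init_def)
    moreover have "S (Hd \<tau>) 0 T" if "\<tau> < num_tapes M" for \<tau>
      by (rule ini) (use that W in \<open>auto simp: kinds_iff comp_init_def\<close>)
    moreover have "S (Cl \<tau> (fst (input_tape (if \<tau> = 0 then x else if \<tau> = 1 then w else [])) (int i - int T))) 0 i"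
      if \<tau>: "\<tau> < num_tapes M" and i: "i < W" for \<tau> i
    proof -
      consider "\<tau> = 0" "i < T" | "\<tau> = 0" "T \<le> i" | "\<tau> = 1" "i < T" | d where "\<tau> = 1" "i = T + d" "d < L"
        | d where "\<tau> = 1" "i = T + (L + d)" | "2 \<le> \<tau>"
      proof -
        have "i < T \<or> (\<exists>d<L. i = T + d) \<or> (\<exists>d. i = T + (L + d))"
          by (metis add.assoc le_Suc_ex nat_add_left_cancel_less not_le)
        then show ?thesis using that by fastforce
      qed
      then show ?thesis
      proof cases
        case 1
        have "S (Cl 0 0) 0 i" by (rule ini) (use 1 i cl1 W0 in \<open>auto simp: comp_init_def\<close>)
        then show ?thesis using 1 by (simp add: input_tape_def)
      next
        case 2
        let ?s = "fst (input_tape x) (int (i - T))"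
        have "?s = 0 \<or> ?s = 1 \<or> ?s = 2" by (auto simp: input_tape_def bit_symbol_def)
        then have "S (Cl 0 ?s) 0 i"
          by (elim disjE) (use ini[OF cl1(4) W0 i] ini[OF cl1(5) W0 i] ini[OF cl1(6) W0 i] 2(2) in \<open>simp_all add: comp_init_def\<close>)
        then show ?thesis using 2 by (simp add: of_nat_diff)
      next
        case 3
        have "S (Cl 1 0) 0 i" by (rule ini) (use 3 i cl1 W0 in \<open>auto simp: comp_init_def\<close>)
        then show ?thesis using 3 by (simp add: input_tape_def)
      next
        case (4 d)
        then show ?thesis using bits[of d] w by (simp add: input_tape_def)
      next
        case (5 d)
        then show ?thesis using blanks[of d] w i by (simp add: input_tape_def)
      next
        case 6
        have "S (Cl \<tau> 0) 0 i" by (rule ini) (use 6 i \<tau> sym3 W0 in \<open>auto simp: kinds_iff comp_init_def\<close>)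
        then show ?thesis using 6 by (auto simp: input_tape_def)
      qed
    qed
    moreover have "snd (input_tape y) = 0" for y by (simp add: input_tape_def)
    ultimately show ?case by (simp add: conf_0[OF M(2)])
  next
    case (Suc t)
    obtain q ts where c: "conf M x w t = (q, ts)" by fastforce
    have good: "good_conf M (q, ts)" using good_conf_conf[OF M(1), of x w t] c by simp
    have c': "conf M x w (Suc t) = tm_step M (q, ts)" using c by (simp add: conf_def)
    have tT: "t < T" using Suc.prems by simp
    have tW: "t < W" "Suc t < W" using tT W by auto
    define rs where "rs = map read_tape ts"
    define as where "as = snd (tm_delta M q rs)"
    have q: "q \<le> num_states M" using good by (simp add: good_conf_def)
    have len: "length ts = num_tapes M" "length rs = num_tapes M" using good by (simp_all add: good_conf_def rs_def)
    have rs: "set rs \<subseteq> {..<num_symbols M}" using good_conf_reads(1)[OF good] by (simp add: rs_def)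
    note d = tm_delta_wf[OF M(1) q len(2) rs]
    define p where "p \<tau> = nat (snd (ts ! \<tau>) + int T)" for \<tau>
    have IH1: "S (St q []) t 0" using Suc.IH tT c by simp
    have IH2: "\<bar>snd (ts ! \<tau>)\<bar> \<le> int t" "S (Hd \<tau>) t (p \<tau>)" if "\<tau> < num_tapes M" for \<tau>
      using Suc.IH tT c that by (simp_all add: p_def)
    have IH3: "S (Cl \<tau> (fst (ts ! \<tau>) (int i - int T))) t i" if "\<tau> < num_tapes M" "i < W" for \<tau> i
      using Suc.IH tT c that by simp
    \<comment> \<open>As t < T, the head is strictly inside the window, so neither a left move nor a
      right move leaves it and no subtraction is truncated.\<close>
    have p: "int (p \<tau>) = snd (ts ! \<tau>) + int T" "1 \<le> p \<tau>" "p \<tau> + 1 < W" "p \<tau> < W" if "\<tau> < num_tapes M" for \<tau>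
      using IH2(1)[OF that] tT W by (auto simp: p_def)
    have cell: "fst (ts ! \<tau>) i < num_symbols M" if "\<tau> < num_tapes M" for \<tau> i
      using good that by (simp add: good_conf_def)
    have rd: "S (Rd \<tau> (rs ! \<tau>)) t 0" if \<tau>: "\<tau> < num_tapes M" for \<tau>
    proof -
      have e: "fst (ts ! \<tau>) (int (p \<tau>) - int T) = rs ! \<tau>"
        using p(1)[OF \<tau>] len \<tau> by (simp add: rs_def read_tape_eq)
      have "S (Cl \<tau> (rs ! \<tau>)) t (p \<tau>)" using IH3[OF \<tau> p(4)[OF \<tau>]] unfolding e .
      moreover have "rs ! \<tau> < num_symbols M" using cell[OF \<tau>, of "int (p \<tau>) - int T"] unfolding e .
      ultimately show ?thesis
        using rul[of "Hd \<tau>" t "p \<tau>" "Cl \<tau> (rs ! \<tau>)" t "p \<tau>" "Rd \<tau> (rs ! \<tau>)" t 0] \<tau> tW W0 p(4)[OF \<tau>] IH2(2)[OF \<tau>]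
        by (simp add: kinds_iff comp_rule_def read_rule_def)
    qed
    have col: "S (St q (take j rs)) t 0" if "j \<le> num_tapes M" for j
      using that
    proof (induction j)
      case 0
      then show ?case using IH1 by simp
    next
      case (Suc j)
      then have j: "j < num_tapes M" by simp
      have tk: "take (Suc j) rs = take j rs @ [rs ! j]" using j len by (simp add: take_Suc_conv_app_nth)
      have l: "length (take j rs) = j" using j len by simp
      have sub: "set (take i rs) \<subseteq> {..<num_symbols M}" for i using rs set_take_subset[of i rs] by blast
      have rj: "rs ! j < num_symbols M"
        using subsetD[OF rs nth_mem[of j rs]] j len by simp
      have k: "St q (take j rs) \<in> kinds M" "Rd j (rs ! j) \<in> kinds M" "St q (take (Suc j) rs) \<in> kinds M"
        using q j len sub rj by (simp_all add: kinds_iff)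
      have "comp_rule M T (St q (take j rs)) t 0 (Rd j (rs ! j)) t 0 (St q (take (Suc j) rs)) t 0"
        unfolding comp_rule_def collect_rule_def tk using l by simp
      from rul[OF k(1) tW(1) W0 k(2) tW(1) W0 k(3) tW(1) W0 this] show ?case
        using Suc.IH j rd[OF j] by simp
    qed
    have st: "S (St q rs) t 0" using col[of "num_tapes M"] len by simp
    have stk: "St q rs \<in> kinds M" using q rs len by (simp add: kinds_iff)
    have new_state: "S (St (fst (tm_delta M q rs)) []) (Suc t) 0"
      by (rule rul[OF stk tW(1) W0 stk tW(1) W0 _ tW(2) W0 _ st st])
        (use d len in \<open>simp_all add: kinds_iff comp_rule_def state_rule_def\<close>)
    have head: "S (Hd \<tau>) (Suc t) (nat (snd (ts ! \<tau>) + move_offset (snd (as ! \<tau>)) + int T))"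
      if \<tau>: "\<tau> < num_tapes M" for \<tau>
    proof -
      have hk: "Hd \<tau> \<in> kinds M" using \<tau> by (simp add: kinds_iff)
      define k where "k = nat (snd (ts ! \<tau>) + move_offset (snd (as ! \<tau>)) + int T)"
      have k: "k = (case snd (as ! \<tau>) of Stay \<Rightarrow> p \<tau> | Move_Right \<Rightarrow> p \<tau> + 1 | Move_Left \<Rightarrow> p \<tau> - 1)"
        using p(1,2)[OF \<tau>] by (cases "snd (as ! \<tau>)") (auto simp: k_def)
      have kW: "k < W" using p(3)[OF \<tau>] by (cases "snd (as ! \<tau>)") (auto simp: k)
      have mr: "move_rule M (snd (as ! \<tau>)) (St q rs) (Hd \<tau>) (Hd \<tau>)"
        using len \<tau> by (simp add: move_rule_def as_def)
      have "comp_rule M T (St q rs) t 0 (Hd \<tau>) t (p \<tau>) (Hd \<tau>) (Suc t) k"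
        using mr p(2)[OF \<tau>] by (cases "snd (as ! \<tau>)") (simp_all add: comp_rule_def k)
      from rul[OF stk tW(1) W0 hk tW(1) p(4)[OF \<tau>] hk tW(2) kW this st IH2(2)[OF \<tau>]]
      show ?thesis by (simp add: k_def)
    qed
    have written: "S (Cl \<tau> (fst (as ! \<tau>))) (Suc t) (p \<tau>)" if \<tau>: "\<tau> < num_tapes M" for \<tau>
    proof -
      have hk: "Hd \<tau> \<in> kinds M" "Cl \<tau> (fst (as ! \<tau>)) \<in> kinds M" using \<tau> d(3)[OF \<tau>] by (simp_all add: kinds_iff as_def)
      have "comp_rule M T (St q rs) t 0 (Hd \<tau>) t (p \<tau>) (Cl \<tau> (fst (as ! \<tau>))) (Suc t) (p \<tau>)"
        using len \<tau> by (simp add: comp_rule_def write_rule_def as_def)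
      from rul[OF stk tW(1) W0 hk(1) tW(1) p(4)[OF \<tau>] hk(2) tW(2) p(4)[OF \<tau>] this st IH2(2)[OF \<tau>]] show ?thesis .
    qed
    have keep: "S (Cl \<tau> (fst (ts ! \<tau>) (int i - int T))) (Suc t) i" if \<tau>: "\<tau> < num_tapes M" "i < W" "i \<noteq> p \<tau>" for \<tau> i
    proof -
      let ?c = "Cl \<tau> (fst (ts ! \<tau>) (int i - int T))"
      have hk: "Hd \<tau> \<in> kinds M" "?c \<in> kinds M" using \<tau> cell[OF \<tau>(1)] by (simp_all add: kinds_iff)
      have "comp_rule M T (Hd \<tau>) t (p \<tau>) ?c t i ?c (Suc t) i"
        using \<tau>(3) by (simp add: comp_rule_def keep_rule_def)
      from rul[OF hk(1) tW(1) p(4)[OF \<tau>(1)] hk(2) tW(1) \<tau>(2) hk(2) tW(2) \<tau>(2) this IH2(2)[OF \<tau>(1)] IH3[OF \<tau>(1,2)]]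
      show ?thesis .
    qed
    note sp = step_tape[OF M(1) good, folded rs_def, folded as_def]
    show ?case
      unfolding c'
    proof (intro conjI allI impI)
      show "S (St (fst (tm_step M (q, ts))) []) (Suc t) 0"
        unfolding tm_step_delta rs_def[symmetric] using new_state by simp
    next
      fix \<tau> assume \<tau>: "\<tau> < num_tapes M"
      show "S (Hd \<tau>) (Suc t) (nat (snd (snd (tm_step M (q, ts)) ! \<tau>) + int T))"
        unfolding sp(2)[OF \<tau>] using head[OF \<tau>] .
      have "\<bar>move_offset m\<bar> \<le> 1" for m by (cases m) auto
      from this[of "snd (as ! \<tau>)"] show "\<bar>snd (snd (tm_step M (q, ts)) ! \<tau>)\<bar> \<le> int (Suc t)"
        unfolding sp(2)[OF \<tau>] using IH2(1)[OF \<tau>] abs_triangle_ineq[of "snd (ts ! \<tau>)" "move_offset (snd (as ! \<tau>))"]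
        by linarith
    next
      fix \<tau> i assume \<tau>: "\<tau> < num_tapes M" and i: "i < W"
      show "S (Cl \<tau> (fst (snd (tm_step M (q, ts)) ! \<tau>) (int i - int T))) (Suc t) i"
      proof (cases "i = p \<tau>")
        case True
        then have "int i - int T = snd (ts ! \<tau>)" using p(1)[OF \<tau>] by simp
        then show ?thesis unfolding sp(1)[OF \<tau>] using written[OF \<tau>] True by simp
      next
        case False
        then have "int i - int T \<noteq> snd (ts ! \<tau>)" using p(1)[OF \<tau>] by auto
        then show ?thesis unfolding sp(1)[OF \<tau>] using keep[OF \<tau> i False] by simp
      qed
    qed
  qed
  have "fst (snd (conf M x w T) ! 0) 0 = 2"
  proof (rule ccontr)
    let ?s = "fst (snd (conf M x w T) ! 0) 0"
    assume s: "?s \<noteq> 2"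
    have TW: "T < W" using W by simp
    have "\<forall>\<tau><num_tapes M. \<forall>i<W. S (Cl \<tau> (fst (snd (conf M x w T) ! \<tau>) (int i - int T))) T i"
      using inv[of T] by simp
    from this[rule_format, OF K(1) TW] have S: "S (Cl 0 ?s) T T" by simp
    have "?s < num_symbols M" using good_conf_conf[OF M(1), of x w T] K(1) by (simp add: good_conf_def)
    then have k: "Cl 0 ?s \<in> kinds M" using K by (simp add: kinds_iff)
    have "comp_rule M T (Cl 0 ?s) T T (Cl 0 ?s) T T Rejected 0 0"
      using s by (simp add: comp_rule_def reject_rule_def)
    from rul[OF k TW TW k TW TW kinds_iff(5) W0 W0 this S S] rej show False by simp
  qed
  then show ?thesis using w LQ by auto
qed

section \<open>Encoding instances\<close>

text \<open>Binary digits are addressed by the powers of two themselves, in increasing order,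
  instead of by exponents. These powers are bounded by the encoded number and hence available in
  unary.\<close>

definition power_of_two :: "nat \<Rightarrow> bool" where
  "power_of_two p \<longleftrightarrow> (\<exists>k. p = 2 ^ k)"

text \<open>A positive number is a power of two iff 1 is its only odd divisor. This is a bounded
  quantifier over remainders, hence computable; d = 0 does no harm, since p mod 0 = p is
  positive.\<close>

lemma power_of_two_arith:
  "power_of_two p \<longleftrightarrow> 0 < p \<and> (\<forall>d<p + 1. p mod d \<noteq> 0 \<or> d mod 2 \<noteq> 1 \<or> d = 1)"
proof
  assume "power_of_two p"
  then obtain k where k: "p = 2 ^ k" by (auto simp: power_of_two_def)
  have odd_div: "d = 1" if "p mod d = 0" "d mod 2 = 1" for d
  proof -
    have "d dvd 2 ^ k" using that(1) k by auto
    then obtain j where "d = 2 ^ j" using divides_primepow_nat[OF two_is_prime_nat] by blast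
    then show ?thesis using that(2) by (cases j) auto
  qed
  show "0 < p \<and> (\<forall>d<p + 1. p mod d \<noteq> 0 \<or> d mod 2 \<noteq> 1 \<or> d = 1)"
  proof (intro conjI allI impI)
    show "0 < p" by (simp add: k)
    show "p mod d \<noteq> 0 \<or> d mod 2 \<noteq> 1 \<or> d = 1" for d using odd_div[of d] by argo
  qed
next
  assume "0 < p \<and> (\<forall>d<p + 1. p mod d \<noteq> 0 \<or> d mod 2 \<noteq> 1 \<or> d = 1)"
  then show "power_of_two p"
  proof (induction p rule: less_induct)
    case (less p)
    show ?case
    proof (cases "even p")
      case True
      then obtain m where m: "p = 2 * m" by auto
      have "m mod d \<noteq> 0 \<or> d mod 2 \<noteq> 1 \<or> d = 1" if "d < m + 1" for d
      proof -
        have "p mod d = 0" if "m mod d = 0"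
          using that m by (simp add: mod_eq_0_iff_dvd)
        moreover have "d < p + 1" using that m by simp
        ultimately show ?thesis using less.prems[THEN conjunct2, rule_format, of d] by argo
      qed
      moreover have "m < p" "0 < m" using less.prems m by auto
      ultimately have "power_of_two m" using less.IH[of m] by simp
      then obtain k where "m = 2 ^ k" by (auto simp: power_of_two_def)
      then have "p = 2 ^ Suc k" using m by simp
      then show ?thesis unfolding power_of_two_def by blast
    next
      case False
      then have "p mod 2 = 1" by presburger
      then have "p = 1" using less.prems[THEN conjunct2, rule_format, of p] by simp
      then have "p = 2 ^ 0" by simp
      then show ?thesis unfolding power_of_two_def by blast
    qed
  qed
qed

lemma powers_of_two_upto:
  assumes "0 < n"
  shows "filter power_of_two [0..<n + 1] = 1 # map ((*) 2) (filter power_of_two [0..<n div 2 + 1])"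
proof (rule sorted_distinct_set_unique)
  have s: "sorted (map ((*) 2) (filter power_of_two [0..<n div 2 + 1]))"
    unfolding sorted_map by (rule sorted_wrt_mono_rel[OF _ sorted_wrt_filter[OF sorted_upt]]) simp
  have ge: "1 \<le> y" if "power_of_two y" for y using that by (auto simp: power_of_two_def)
  show "sorted (filter power_of_two [0..<n + 1])" by (rule sorted_wrt_filter[OF sorted_upt])
  show "distinct (filter power_of_two [0..<n + 1])" by simp
  show "sorted (1 # map ((*) 2) (filter power_of_two [0..<n div 2 + 1]))"
    using s ge by (auto intro: order_trans)
  show "distinct (1 # map ((*) 2) (filter power_of_two [0..<n div 2 + 1]))"
    by (auto simp: distinct_map inj_on_def)
  have "p = 1 \<or> (\<exists>q. power_of_two q \<and> q \<le> n div 2 \<and> p = 2 * q)" if p: "power_of_two p" "p \<le> n" for p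
  proof -
    obtain k where k: "p = 2 ^ k" using p(1) by (auto simp: power_of_two_def)
    show ?thesis
    proof (cases k)
      case (Suc j)
      then have "p = 2 * 2 ^ j" using k by simp
      moreover have "power_of_two (2 ^ j)" by (auto simp: power_of_two_def)
      ultimately show ?thesis using p(2) by (intro disjI2 exI[of _ "2 ^ j"]) auto
    qed (use k in simp)
  qed
  moreover have "power_of_two 1" unfolding power_of_two_def by (rule exI[of _ 0]) simp
  moreover have "power_of_two (2 * q)" if q: "power_of_two q" for q
  proof -
    obtain k where "q = 2 ^ k" using q by (auto simp: power_of_two_def)
    then have "2 * q = 2 ^ Suc k" by simp
    then show ?thesis unfolding power_of_two_def by blast
  qed
  ultimately have "power_of_two p \<and> p \<le> n \<longleftrightarrow> p = 1 \<or> (\<exists>q. power_of_two q \<and> q \<le> n div 2 \<and> p = 2 * q)" for p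
    using assms by (metis Suc_leI One_nat_def less_eq_div_iff_mult_less_eq mult.commute zero_less_numeral)
  moreover have "p \<in> set (filter power_of_two [0..<n + 1]) \<longleftrightarrow> power_of_two p \<and> p \<le> n" for p
    by (auto simp: less_Suc_eq_le simp del: upt_Suc)
  moreover have "p \<in> set (1 # map ((*) 2) (filter power_of_two [0..<n div 2 + 1])) \<longleftrightarrow>
    p = 1 \<or> (\<exists>q. power_of_two q \<and> q \<le> n div 2 \<and> p = 2 * q)" for p
    by (simp add: image_iff less_Suc_eq_le del: upt_Suc) blast
  ultimately show "set (filter power_of_two [0..<n + 1]) = set (1 # map ((*) 2) (filter power_of_two [0..<n div 2 + 1]))"
    by (intro set_eqI) (simp only:)
qed

lemma bin_digits_filter: "bin_digits n = map (\<lambda>p. odd (n div p)) (filter power_of_two [0..<n + 1])"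
proof (induction n rule: less_induct)
  case (less n)
  show ?case
  proof (cases "n = 0")
    case True
    have "\<not> power_of_two 0" by (simp add: power_of_two_def)
    then show ?thesis using True by (simp add: bin_digits.simps)
  next
    case False
    have "bin_digits n = odd n # bin_digits (n div 2)" using False bin_digits.simps[of n] by simp
    also have "bin_digits (n div 2) = map (\<lambda>p. odd (n div 2 div p)) (filter power_of_two [0..<n div 2 + 1])"
      using less[of "n div 2"] False by simp
    finally show ?thesis
      using powers_of_two_upto[of n] False by (simp add: div_mult2_eq comp_def del: upt_Suc)
  qed
qed

text \<open>Layout of the code word of a number n < B: the positions 2p and 2p + 1 are reserved for
  every p < B and are silent unless p is a power of two up to n, when they emit the continuation
  mark and the digit n div p mod 2. Position 2B emits the end mark.\<close>

definition code_symbol :: "nat \<Rightarrow> nat \<Rightarrow> nat \<Rightarrow> nat" where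
  "code_symbol B n i =
     (if i < 2 * B
      then (if power_of_two (i div 2) \<and> i div 2 \<le> n
            then (if i mod 2 = 0 then 2 else 1 + n div (i div 2) mod 2) else 0)
      else 1)"

lemma concat_map_pairs:
  "concat (map F [0..<2 * B]) = concat (map (\<lambda>p. F (2 * p) @ F (2 * p + 1)) [0..<B])"
  by (induction B) auto

lemma concat_map_filter:
  "concat (map (\<lambda>p. if P p then G p else []) l) = concat (map G (filter P l))"
  by (induction l) auto

lemma emit_code_symbol:
  assumes "n < B"
  shows "concat (map (\<lambda>i. emit (code_symbol B n i)) [0..<2 * B + 1]) = encode_nat n"
proof -
  let ?F = "\<lambda>i. emit (code_symbol B n i)"
  have two: "emit 2 = [True]" "emit 1 = [False]" "emit (1 + m mod 2) = [odd m]" "emit 0 = []" for m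
    by (auto simp: emit_def odd_iff_mod_2_eq_one)
  have pair: "?F (2 * p) @ ?F (2 * p + 1) =
    (if power_of_two p \<and> p \<le> n then [True, odd (n div p)] else [])" if "p < B" for p
  proof -
    have m: "2 * p mod 2 = 0" "(2 * p + 1) mod 2 = 1" "2 * p div 2 = p" "(2 * p + 1) div 2 = p"
      "2 * p < 2 * B" "2 * p + 1 < 2 * B" using that by simp_all
    show ?thesis
      unfolding code_symbol_def m using m(5,6) by (simp add: two del: One_nat_def)
  qed
  have fl: "filter (\<lambda>p. power_of_two p \<and> p \<le> n) [0..<B] = filter power_of_two [0..<n + 1]"
  proof -
    have "[0..<B] = [0..<n + 1] @ [n + 1..<B]" using upt_add_eq_append[of 0 "n + 1" "B - (n + 1)"] assms by (simp del: upt_Suc)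
    moreover have "filter (\<lambda>p. power_of_two p \<and> p \<le> n) [n + 1..<B] = []" by (auto simp: filter_empty_conv)
    moreover have "filter (\<lambda>p. power_of_two p \<and> p \<le> n) [0..<n + 1] = filter power_of_two [0..<n + 1]"
      by (rule filter_cong) auto
    ultimately show ?thesis by (simp del: upt_Suc)
  qed
  have "concat (map ?F [0..<2 * B]) =
    concat (map (\<lambda>p. if power_of_two p \<and> p \<le> n then [True, odd (n div p)] else []) [0..<B])"
    unfolding concat_map_pairs using pair by (intro arg_cong[where f = concat] map_cong) auto
  also have "\<dots> = concat (map (\<lambda>b. [True, b]) (bin_digits n))"
    unfolding concat_map_filter fl bin_digits_filter by (simp add: comp_def)
  finally have "concat (map ?F [0..<2 * B]) = concat (map (\<lambda>b. [True, b]) (bin_digits n))" .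
  moreover have "?F (2 * B) = [False]" by (simp add: code_symbol_def emit_def)
  ultimately show ?thesis by (simp add: encode_nat_def)
qed

lemma concat_map_upt_add:
  "concat (map F [0..<a + b]) = concat (map F [0..<a]) @ concat (map (\<lambda>i. F (a + i)) [0..<b])"
  by (induction b) auto

lemma concat_map_blocks:
  assumes "0 < (m :: nat)"
  shows "concat (map (\<lambda>i. G (i div m) (i mod m)) [0..<n * m]) = concat (map (\<lambda>j. concat (map (G j) [0..<m])) [0..<n])"
proof (induction n)
  case (Suc n)
  have e: "map (\<lambda>i. G ((n * m + i) div m) ((n * m + i) mod m)) [0..<m] = map (G n) [0..<m]"
    using assms by (intro map_cong) auto
  have "Suc n * m = n * m + m" by simp
  then have "concat (map (\<lambda>i. G (i div m) (i mod m)) [0..<Suc n * m]) =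
    concat (map (\<lambda>i. G (i div m) (i mod m)) [0..<n * m]) @
    concat (map (\<lambda>i. G ((n * m + i) div m) ((n * m + i) mod m)) [0..<m])"
    by (simp only: concat_map_upt_add)
  then show ?case unfolding e Suc.IH by simp
qed simp

text \<open>The four fields hold the order, the adjacency matrix, the colors and the budget. Colors
  are below 4, so the layout of a color has width 2 * 4 + 1 = 9.\<close>

definition instance_symbol :: "nat \<Rightarrow> (nat \<Rightarrow> nat \<Rightarrow> bool) \<Rightarrow> (nat \<Rightarrow> nat) \<Rightarrow> nat \<Rightarrow> nat \<Rightarrow> nat" where
  "instance_symbol n A c k i =
     (if i < 2 * (n + 1) + 1 then code_symbol (n + 1) n i
      else if i - (2 * (n + 1) + 1) < n * n
      then (if A ((i - (2 * (n + 1) + 1)) div n) ((i - (2 * (n + 1) + 1)) mod n) then 2 else 1)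
      else if i - (2 * (n + 1) + 1 + n * n) < n * 9
      then code_symbol 4 (c ((i - (2 * (n + 1) + 1 + n * n)) div 9)) ((i - (2 * (n + 1) + 1 + n * n)) mod 9)
      else code_symbol (k + 1) k (i - (2 * (n + 1) + 1 + n * n + n * 9)))"

definition instance_length :: "nat \<Rightarrow> nat \<Rightarrow> nat" where
  "instance_length n k = 2 * (n + 1) + 1 + n * n + n * 9 + (2 * (k + 1) + 1)"

lemma code_symbol_le: "code_symbol B n i \<le> 2"
proof -
  have "m mod 2 \<le> 1" for m :: nat using mod_less_divisor[of 2 m] by linarith
  then show ?thesis by (simp add: code_symbol_def)
qed

lemma instance_symbol_le: "instance_symbol n A c k i \<le> 2"
  unfolding instance_symbol_def using code_symbol_le by simp

lemma emit_instance:
  assumes n: "0 < n" and A: "\<And>i j. i < n \<Longrightarrow> j < n \<Longrightarrow> A i j \<longleftrightarrow> {i, j} \<in> E" and c: "\<And>i. i < n \<Longrightarrow> c i \<le> 3"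
  shows "concat (map (\<lambda>i. emit (instance_symbol n A c k i)) [0..<instance_length n k]) = encode_instance n E c k"
proof -
  let ?F = "\<lambda>i. emit (instance_symbol n A c k i)"
  let ?a = "2 * (n + 1) + 1"
  have 1: "concat (map ?F [0..<?a]) = encode_nat n"
  proof -
    have e: "map ?F [0..<?a] = map (\<lambda>i. emit (code_symbol (n + 1) n i)) [0..<?a]"
      by (rule map_cong) (auto simp: instance_symbol_def)
    show ?thesis unfolding e by (rule emit_code_symbol) simp
  qed
  have 2: "concat (map (\<lambda>i. ?F (?a + i)) [0..<n * n]) = concat (map (\<lambda>i. map (\<lambda>j. {i, j} \<in> E) [0..<n]) [0..<n])"
  proof -
    have e: "map (\<lambda>i. ?F (?a + i)) [0..<n * n] = map (\<lambda>i. (\<lambda>i j. emit (if A i j then 2 else 1)) (i div n) (i mod n)) [0..<n * n]"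
      by (rule map_cong) (auto simp: instance_symbol_def)
    have "concat (map (\<lambda>i. ?F (?a + i)) [0..<n * n]) =
      concat (map (\<lambda>i. concat (map (\<lambda>j. emit (if A i j then 2 else 1)) [0..<n])) [0..<n])"
      unfolding e by (rule concat_map_blocks[OF n, of "\<lambda>i j. emit (if A i j then 2 else 1)" n])
    also have "\<dots> = concat (map (\<lambda>i. map (\<lambda>j. {i, j} \<in> E) [0..<n]) [0..<n])"
    proof (intro arg_cong[where f = concat] map_cong refl)
      fix i assume i: "i \<in> set [0..<n]"
      have "concat (map (\<lambda>j. emit (if A i j then 2 else 1)) [0..<n]) = concat (map (\<lambda>j. [{i, j} \<in> E]) [0..<n])"
        using i A by (intro arg_cong[where f = concat] map_cong) (auto simp: emit_def)
      then show "concat (map (\<lambda>j. emit (if A i j then 2 else 1)) [0..<n]) = map (\<lambda>j. {i, j} \<in> E) [0..<n]"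
        by (simp add: concat_map_singleton)
    qed
    finally show ?thesis .
  qed
  have 3: "concat (map (\<lambda>i. ?F (?a + n * n + i)) [0..<n * 9]) = concat (map (\<lambda>i. encode_nat (c i)) [0..<n])"
  proof -
    have e: "map (\<lambda>i. ?F (?a + n * n + i)) [0..<n * 9] = map (\<lambda>i. (\<lambda>j i. emit (code_symbol 4 (c j) i)) (i div 9) (i mod 9)) [0..<n * 9]"
      by (rule map_cong) (auto simp: instance_symbol_def)
    have "concat (map (\<lambda>i. ?F (?a + n * n + i)) [0..<n * 9]) =
      concat (map (\<lambda>j. concat (map (\<lambda>i. emit (code_symbol 4 (c j) i)) [0..<9])) [0..<n])"
      unfolding e by (rule concat_map_blocks[of 9 "\<lambda>j i. emit (code_symbol 4 (c j) i)" n]) simp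
    also have "\<dots> = concat (map (\<lambda>i. encode_nat (c i)) [0..<n])"
    proof (intro arg_cong[where f = concat] map_cong refl)
      fix j assume "j \<in> set [0..<n]"
      then have "c j < 4" using c[of j] by simp
      from emit_code_symbol[OF this] show "concat (map (\<lambda>i. emit (code_symbol 4 (c j) i)) [0..<9]) = encode_nat (c j)"
        by (simp del: upt_rec_numeral)
    qed
    finally show ?thesis .
  qed
  have 4: "concat (map (\<lambda>i. ?F (?a + n * n + n * 9 + i)) [0..<2 * (k + 1) + 1]) = encode_nat k"
  proof -
    have e: "map (\<lambda>i. ?F (?a + n * n + n * 9 + i)) [0..<2 * (k + 1) + 1] =
      map (\<lambda>i. emit (code_symbol (k + 1) k i)) [0..<2 * (k + 1) + 1]"
      by (rule map_cong) (auto simp: instance_symbol_def)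
    show ?thesis unfolding e by (rule emit_code_symbol) simp
  qed
  show ?thesis
    unfolding instance_length_def encode_instance_def concat_map_upt_add[of ?F "?a + n * n + n * 9"]
      concat_map_upt_add[of ?F "?a + n * n"] concat_map_upt_add[of ?F "?a"] 1 2 3 4 append_assoc ..
qed

section \<open>Computability of the reduction\<close>

lemmas cmp_intros = cmpb_conj cmpb_disj cmpb_eq cmpb_less cmpb_le cmpb_not
  cmp_add cmp_mult cmp_diff cmp_div cmp_mod cmp_const

lemma cmpb_if:
  assumes "cmpb k P" "cmpb k Q" "cmpb k R"
  shows "cmpb k (\<lambda>x e. if P x e then Q x e else R x e)"
  by (rule cmpb_cong[OF cmpb_disj[OF cmpb_conj[OF assms(1,2)] cmpb_conj[OF cmpb_not[OF assms(1)] assms(3)]]]) auto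

lemma cmpb_power_of_two:
  assumes F: "cmp k F"
  shows "cmpb k (\<lambda>x e. power_of_two (F x e))"
proof -
  have "cmpb (Suc k) (\<lambda>x e. F x (tl e) mod (e ! 0) \<noteq> 0 \<or> (e ! 0) mod 2 \<noteq> 1 \<or> e ! 0 = 1)"
    by (intro cmp_intros cmp_tl[OF F] cmp_nth) auto
  from cmpb_all[OF cmp_add[OF F cmp_const[of k 1]] this]
  have "cmpb k (\<lambda>x e. \<forall>d<F x e + 1. F x e mod d \<noteq> 0 \<or> d mod 2 \<noteq> 1 \<or> d = 1)" by simp
  from cmpb_conj[OF cmpb_less[OF cmp_const[of k 0] F] this]
  show ?thesis unfolding power_of_two_arith .
qed

lemma cmp_code_symbol:
  assumes "cmp k B" "cmp k F" "cmp k I"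
  shows "cmp k (\<lambda>x e. code_symbol (B x e) (F x e) (I x e))"
  unfolding code_symbol_def
  by (intro cmp_if cmpb_power_of_two cmp_intros assms)

lemma cmp_instance_symbol:
  assumes N: "cmp k N" and K: "cmp k K" and I: "cmp k I"
    and A: "\<And>F G. cmp k F \<Longrightarrow> cmp k G \<Longrightarrow> cmpb k (\<lambda>x e. A x (F x e) (G x e))"
    and c: "\<And>F. cmp k F \<Longrightarrow> cmp k (\<lambda>x e. c x (F x e))"
  shows "cmp k (\<lambda>x e. instance_symbol (N x e) (A x) (c x) (K x e) (I x e))"
  unfolding instance_symbol_def
  by (intro cmp_if cmp_code_symbol A c cmp_intros N K I)

lemma cmpb_horn_adj:
  assumes N: "cmp k (\<lambda>x e. N x)" and F: "cmp k F" and G: "cmp k G"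
    and ini: "\<And>F. cmp k F \<Longrightarrow> cmpb k (\<lambda>x e. ini x (F x e))"
    and cpl: "\<And>F G. cmp k F \<Longrightarrow> cmp k G \<Longrightarrow> cmpb k (\<lambda>x e. cpl x (F x e) (G x e))"
    and rul: "\<And>F G H. cmp k F \<Longrightarrow> cmp k G \<Longrightarrow> cmp k H \<Longrightarrow> cmpb k (\<lambda>x e. rul x (F x e) (G x e) (H x e))"
  shows "cmpb k (\<lambda>x e. horn_adj (N x) (ini x) (cpl x) (rul x) (F x e) (G x e))"
  unfolding horn_adj_def horn_size_def
  by (intro ini cpl rul cmp_intros N F G)

lemma cmpb_link:
  assumes n: "cmp k (\<lambda>x e. n x)" and M: "cmp k (\<lambda>x e. M x)" and F: "cmp k F" and G: "cmp k G"
    and adj: "\<And>F G. cmp k F \<Longrightarrow> cmp k G \<Longrightarrow> cmpb k (\<lambda>x e. adj x (F x e) (G x e))"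
  shows "cmpb k (\<lambda>x e. grid_graph.link (n x) (M x) (adj x) (F x e) (G x e))"
  unfolding grid_graph.link_def grid_graph.active_def grid_graph.target_def grid_graph.C_def
  by (intro cmpb_bex_list cmpb_conj cmpb_if cmp_if adj cmpb_const cmp_intros n M F G)

text \<open>The remainder makes the index smaller than the constant \<open>length ks\<close> for
  every argument, so an arbitrary predicate of the kind can be decided by a finite table.\<close>

lemma cmpb_kind:
  assumes "cmp k F" "0 < length ks"
  shows "cmpb k (\<lambda>x e. P (ks ! (F x e mod length ks)))"
  by (rule cmpb_finite[of k "\<lambda>x e. F x e mod length ks" "length ks" "\<lambda>z. P (ks ! z)"])
    (use assms in \<open>auto intro: cmp_mod cmp_const\<close>)

lemma cmpb_kind3:
  assumes "cmp k F" "cmp k G" "cmp k H" "0 < length ks"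
  shows "cmpb k (\<lambda>x e. P (ks ! (F x e mod length ks)) (ks ! (G x e mod length ks)) (ks ! (H x e mod length ks)))"
  by (rule cmpb_finite3[of k "\<lambda>x e. F x e mod length ks" "length ks" "\<lambda>x e. G x e mod length ks"
        "\<lambda>x e. H x e mod length ks" "\<lambda>y z w. P (ks ! y) (ks ! z) (ks ! w)"])
    (use assms in \<open>auto intro: cmp_mod cmp_const\<close>)

section \<open>The reduction\<close>

locale reduction =
  fixes Ver :: tm and ks :: "kind list" and P Q :: "nat poly"
begin

text \<open>The first summand bounds the running time of the verifier for every witness of
  admissible length; the second one ensures that the witness fits into the window of the
  simulation.\<close>

definition time :: "bool list \<Rightarrow> nat" where
  "time x = poly P (length x + poly Q (length x)) + poly Q (length x)"

definition wit :: "bool list \<Rightarrow> nat" where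
  "wit x = poly Q (length x)"

definition width :: "bool list \<Rightarrow> nat" where
  "width x = 2 * time x + 1"

definition facts :: "bool list \<Rightarrow> nat" where
  "facts x = width x * width x * length ks"

definition ini :: "bool list \<Rightarrow> nat \<Rightarrow> bool" where
  "ini x a \<longleftrightarrow> comp_init Ver x (time x) (wit x) (ks ! (a mod length ks))
     (a div length ks div width x) (a div length ks mod width x)"

definition cpl :: "bool list \<Rightarrow> nat \<Rightarrow> nat \<Rightarrow> bool" where
  "cpl x a b \<longleftrightarrow> comp_compl (time x) (wit x)
     (ks ! (a mod length ks)) (a div length ks div width x) (a div length ks mod width x)
     (ks ! (b mod length ks)) (b div length ks div width x) (b div length ks mod width x)"

definition rul :: "bool list \<Rightarrow> nat \<Rightarrow> nat \<Rightarrow> nat \<Rightarrow> bool" where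
  "rul x a b c \<longleftrightarrow> comp_rule Ver (time x)
     (ks ! (a mod length ks)) (a div length ks div width x) (a div length ks mod width x)
     (ks ! (b mod length ks)) (b div length ks div width x) (b div length ks mod width x)
     (ks ! (c mod length ks)) (c div length ks div width x) (c div length ks mod width x)"

definition adj :: "bool list \<Rightarrow> nat \<Rightarrow> nat \<Rightarrow> bool" where
  "adj x = horn_adj (facts x) (ini x) (cpl x) (rul x)"

definition rows :: "bool list \<Rightarrow> nat" where
  "rows x = horn_size (facts x)"

definition budget :: "bool list \<Rightarrow> nat" where
  "budget x = 26 * ((rows x + 1) * (rows x + 1))"

text \<open>The least length that exceeds twice the budget, as the lower bound on the number of
  swaps requires.\<close>

definition bulk :: "bool list \<Rightarrow> nat" where
  "bulk x = 2 * budget x + 1"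

definition order :: "bool list \<Rightarrow> nat" where
  "order x = grid_graph.NV (rows x) (bulk x)"

definition edges :: "bool list \<Rightarrow> nat set set" where
  "edges x = grid_graph.E (rows x) (bulk x) (adj x)"

definition colors :: "nat \<Rightarrow> nat" where
  "colors v = rot (cell_col 1 1 ! (v div 3 mod 13)) (v mod 3)"

definition reduce :: "bool list \<Rightarrow> bool list" where
  "reduce x = encode_instance (order x) (edges x) colors (budget x)"

end

locale proper_reduction = reduction +
  assumes wf: "wf_tm Ver" and tapes: "2 \<le> num_tapes Ver"
    and ks: "set ks = kinds Ver" "ks \<noteq> []" "ks ! 0 = Rejected"
begin

lemma ks_pos: "0 < length ks"
  using ks(2) by simp

lemma width_pos: "0 < width x"
  by (simp add: width_def)

lemma facts_pos: "0 < facts x"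
  using ks_pos width_pos by (simp add: facts_def)

lemma grid: "grid (rows x) (adj x)"
proof
  show "4 \<le> rows x" using facts_pos[of x] by (simp add: rows_def horn_size_def)
  show "i < rows x \<and> j < rows x" if "adj x i j" for i j
    using that by (simp add: adj_def horn_adj_def rows_def)
qed

lemma admissible_iff:
  "grid.admissible (adj x) h \<longleftrightarrow> (\<forall>i. h i \<in> {1..3}) \<and> (\<forall>i j. adj x i j \<longrightarrow> h i \<noteq> h j)"
  by (rule grid.admissible_def[OF grid])

section \<open>Codes of facts and satisfying assignments\<close>

lemma fact_exists:
  assumes "k \<in> kinds Ver" "t < width x" "i < width x"
  obtains a where "a < facts x" "ks ! (a mod length ks) = k" "a div length ks div width x = t"
    "a div length ks mod width x = i"
proof -
  obtain z where z: "z < length ks" "ks ! z = k" using assms(1) ks(1) by (metis in_set_conv_nth)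
  define a where "a = (t * width x + i) * length ks + z"
  have "(y * n + z) mod n = z" "(y * n + z) div n = y" if "z < n" for y n using that by auto
  from this[OF z(1)] have 1: "a mod length ks = z" "a div length ks = t * width x + i" unfolding a_def .
  have 2: "(t * width x + i) div width x = t" "(t * width x + i) mod width x = i" using assms(3) by simp_all
  have "t * width x + i < width x * width x"
  proof -
    have "(t + 1) * width x \<le> width x * width x" using assms(2) by (intro mult_le_mono1) simp
    then show ?thesis using assms(3) by simp
  qed
  then have "(t * width x + i + 1) * length ks \<le> width x * width x * length ks" by (intro mult_le_mono1) simp
  then have "a < facts x" using z(1) by (simp add: a_def facts_def)
  then show ?thesis using that[of a] 1 2 z(2) by simp
qed

lemma sat_always: "\<exists>\<sigma>. horn_sat (facts x) (ini x) (cpl x) (rul x) \<sigma>"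
proof (rule exI[of _ "\<lambda>a. ks ! (a mod length ks) \<notin> {Nb, Off}"])
  show "horn_sat (facts x) (ini x) (cpl x) (rul x) (\<lambda>a. ks ! (a mod length ks) \<notin> {Nb, Off})"
    unfolding horn_sat_def
  proof (intro conjI allI impI)
    fix a assume "ini x a"
    then show "ks ! (a mod length ks) \<notin> {Nb, Off}" unfolding ini_def comp_init_def by auto
  next
    fix a b assume "cpl x a b"
    then show "(ks ! (a mod length ks) \<notin> {Nb, Off}) \<noteq> (ks ! (b mod length ks) \<notin> {Nb, Off})"
      unfolding cpl_def comp_compl_def by auto
  next
    fix a b c assume "rul x a b c"
    then show "ks ! (c mod length ks) \<notin> {Nb, Off}"
      unfolding rul_def comp_rule_def
      by (elim conjE disjE)
        (auto simp: read_rule_def collect_rule_def state_rule_def move_rule_def write_rule_def keep_rule_def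
          guess_rule_def blank_rule_def reject_rule_def)
  qed
qed

lemma sat_of_witness:
  assumes w: "length w \<le> wit x" "fst (snd (conf Ver x w (time x)) ! 0) 0 = 2"
  shows "\<exists>\<sigma>. horn_sat (facts x) (ini x) (cpl x) (rul x) \<sigma> \<and> \<not> \<sigma> 0"
proof -
  define \<sigma> where "\<sigma> a = holds_in Ver x w (time x) (ks ! (a mod length ks))
    (a div length ks div width x) (a div length ks mod width x)" for a
  have "horn_sat (facts x) (ini x) (cpl x) (rul x) \<sigma>"
    unfolding horn_sat_def \<sigma>_def
  proof (intro conjI allI impI)
    fix a assume "ini x a"
    then show "holds_in Ver x w (time x) (ks ! (a mod length ks))
      (a div length ks div width x) (a div length ks mod width x)"
      unfolding ini_def by (rule holds_in_init[OF tapes w(1)])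
  next
    fix a b assume "cpl x a b"
    then show "holds_in Ver x w (time x) (ks ! (a mod length ks)) (a div length ks div width x) (a div length ks mod width x) \<noteq>
      holds_in Ver x w (time x) (ks ! (b mod length ks)) (b div length ks div width x) (b div length ks mod width x)"
      unfolding cpl_def by (rule holds_in_compl[OF tapes])
  next
    fix a b c assume "rul x a b c"
      "holds_in Ver x w (time x) (ks ! (a mod length ks)) (a div length ks div width x) (a div length ks mod width x)"
      "holds_in Ver x w (time x) (ks ! (b mod length ks)) (b div length ks div width x) (b div length ks mod width x)"
    then show "holds_in Ver x w (time x) (ks ! (c mod length ks)) (c div length ks div width x) (c div length ks mod width x)"
      unfolding rul_def by (rule holds_in_rule[OF wf tapes w(2)])
  qed
  moreover have "\<not> \<sigma> 0" unfolding \<sigma>_def using ks(3) by simp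
  ultimately show ?thesis by blast
qed

text \<open>A kind may occur several times in \<open>ks\<close>, so a fact may have several codes.
  \<open>S\<close> demands that all of them be true; then a fact outside \<open>S\<close> has a
  false code, which forces all codes of its complement to be true.\<close>

lemma witness_of_sat:
  assumes sat: "horn_sat (facts x) (ini x) (cpl x) (rul x) \<sigma>" and rej: "\<not> \<sigma> 0"
  shows "\<exists>w. length w \<le> wit x \<and> fst (snd (conf Ver x w (time x)) ! 0) 0 = 2"
proof -
  let ?is = "\<lambda>a k t i. a < facts x \<and> ks ! (a mod length ks) = k \<and> a div length ks div width x = t \<and>
    a div length ks mod width x = i"
  define S where "S k t i \<longleftrightarrow> (\<forall>a. ?is a k t i \<longrightarrow> \<sigma> a)" for k t i
  have ex: "\<exists>a. ?is a k t i" if "k \<in> kinds Ver" "t < width x" "i < width x" for k t i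
    by (rule fact_exists[OF that]) (intro exI conjI; assumption)
  have s_ini: "\<sigma> a" if "a < facts x" "ini x a" for a
    using sat that unfolding horn_sat_def by simp
  have s_cpl: "\<sigma> a \<noteq> \<sigma> b" if "a < facts x" "b < facts x" "cpl x a b" for a b
    using sat that unfolding horn_sat_def by simp
  have s_rul: "\<sigma> c" if "a < facts x" "b < facts x" "c < facts x" "rul x a b c" "\<sigma> a" "\<sigma> b" for a b c
    using sat[unfolded horn_sat_def, THEN conjunct2, THEN conjunct2, rule_format, OF that] .
  show ?thesis
  proof (rule comp_sound[of Ver "wit x" "time x" "width x" x S])
    show "wf_tm Ver" "2 \<le> num_tapes Ver" by (fact wf tapes)+
    show "wit x \<le> time x" by (simp add: wit_def time_def)
    show "width x = 2 * time x + 1" by (simp add: width_def)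
  next
    fix a t i assume i: "comp_init Ver x (time x) (wit x) a t i"
    show "S a t i" unfolding S_def
    proof (intro allI impI)
      fix a' assume a': "?is a' a t i"
      then have "ini x a'" using i by (simp add: ini_def)
      then show "\<sigma> a'" using s_ini a' by simp
    qed
  next
    fix a t i b u j
    assume k: "a \<in> kinds Ver" "t < width x" "i < width x" and c: "comp_compl (time x) (wit x) a t i b u j"
      and nS: "\<not> S a t i"
    obtain a' where a': "?is a' a t i" "\<not> \<sigma> a'" using nS unfolding S_def by blast
    show "S b u j" unfolding S_def
    proof (intro allI impI)
      fix b' assume b': "?is b' b u j"
      then have "cpl x a' b'" using a' c by (simp add: cpl_def)
      then have "\<sigma> a' \<noteq> \<sigma> b'" using s_cpl[of a' b'] a' b' by blast
      then show "\<sigma> b'" using a'(2) by blast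
    qed
  next
    fix a t i b u j c v k
    assume k: "a \<in> kinds Ver" "t < width x" "i < width x" "b \<in> kinds Ver" "u < width x" "j < width x"
      and r: "comp_rule Ver (time x) a t i b u j c v k" and S: "S a t i" "S b u j"
    obtain a' where a': "?is a' a t i" using ex[OF k(1-3)] by (rule exE)
    obtain b' where b': "?is b' b u j" using ex[OF k(4-6)] by (rule exE)
    have \<sigma>: "\<sigma> a'" "\<sigma> b'" using S a' b' unfolding S_def by simp_all
    show "S c v k" unfolding S_def
    proof (intro allI impI)
      fix c' assume c': "?is c' c v k"
      then have "rul x a' b' c'" using a' b' r by (simp add: rul_def)
      then show "\<sigma> c'" using s_rul[of a' b' c'] a' b' c' \<sigma> by simp
    qed
  next
    have "?is 0 Rejected 0 0" using ks(3) facts_pos by simp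
    then show "\<not> S Rejected 0 0" using rej unfolding S_def by (intro notI) (drule spec[of _ 0], simp)
  qed
qed

lemma admissible_of_sat:
  assumes "horn_sat (facts x) (ini x) (cpl x) (rul x) \<sigma>"
  shows "grid.admissible (adj x) (horn_col (facts x) \<sigma>)"
  unfolding admissible_iff unfolding adj_def using horn_col_range horn_col_proper[OF assms] by blast

lemma satisfiable_iff:
  "grid.satisfiable (adj x) \<longleftrightarrow> (\<exists>w. length w \<le> wit x \<and> fst (snd (conf Ver x w (time x)) ! 0) 0 = 2)"
proof
  assume "grid.satisfiable (adj x)"
  then obtain h where h: "grid.admissible (adj x) h" "h 0 = 1" "h 3 = 1"
    unfolding grid.satisfiable_def[OF grid] by blast
  have rng: "\<And>i. h i \<in> {1..3}" and ne: "\<And>i j. horn_adj (facts x) (ini x) (cpl x) (rul x) i j \<Longrightarrow> h i \<noteq> h j"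
    using h(1) unfolding admissible_iff unfolding adj_def by blast+
  have "h 0 \<noteq> h 1" using ne[of 0 1] by (simp add: horn_adj_def horn_size_def)
  then have "\<not> h (3 + 0) = h 1" using h by simp
  from witness_of_sat[OF horn_sat_of_coloring[OF rng ne] this]
  show "\<exists>w. length w \<le> wit x \<and> fst (snd (conf Ver x w (time x)) ! 0) 0 = 2" .
next
  assume "\<exists>w. length w \<le> wit x \<and> fst (snd (conf Ver x w (time x)) ! 0) 0 = 2"
  then obtain \<sigma> where \<sigma>: "horn_sat (facts x) (ini x) (cpl x) (rul x) \<sigma>" "\<not> \<sigma> 0" using sat_of_witness by blast
  have "horn_col (facts x) \<sigma> 0 = 1" "horn_col (facts x) \<sigma> 3 = 1"
    using \<sigma>(2) facts_pos[of x] by (simp_all add: horn_col_def)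
  then show "grid.satisfiable (adj x)"
    unfolding grid.satisfiable_def[OF grid] using admissible_of_sat[OF \<sigma>(1)] by blast
qed

lemma colors_eq: "grid.init_col = colors"
  unfolding fun_eq_iff grid.init_col_def[OF grid] grid.init_core_def[OF grid] colors_def by simp

lemma promise_reduce:
  "planar {..<order x} (edges x)" "swap_promise 3 {..<order x} (edges x) colors (budget x)"
proof -
  obtain \<sigma> where "horn_sat (facts x) (ini x) (cpl x) (rul x) \<sigma>" using sat_always by blast
  from grid.promise[OF grid admissible_of_sat[OF this]]
  show "swap_promise 3 {..<order x} (edges x) colors (budget x)"
    unfolding order_def edges_def colors_eq by (simp add: budget_def)
  show "planar {..<order x} (edges x)" unfolding order_def edges_def by (rule grid.planar_grid[OF grid])
qed

lemma solvable_reduce: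
  assumes "grid.satisfiable (adj x)"
  shows "solvable_within adjacent_swap 3 {..<order x} (edges x) colors (budget x)"
    "solvable_within swap 3 {..<order x} (edges x) colors (budget x)"
proof -
  show *: "solvable_within adjacent_swap 3 {..<order x} (edges x) colors (budget x)"
    using grid.satisfiable_solvable[OF grid assms, of "budget x"]
    unfolding order_def edges_def colors_eq by (simp add: budget_def)
  then show "solvable_within swap 3 {..<order x} (edges x) colors (budget x)"
    unfolding solvable_within_def using adjacent_swaps_imp_swaps by blast
qed

lemma unsolvable_reduce:
  assumes "\<not> grid.satisfiable (adj x)"
  shows "\<not> solvable_within swap 3 {..<order x} (edges x) colors (budget x)"
    "\<not> solvable_within adjacent_swap 3 {..<order x} (edges x) colors (budget x)"
proof -
  show *: "\<not> solvable_within swap 3 {..<order x} (edges x) colors (budget x)"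
    using grid.solvable_satisfiable[OF grid[of x], where M = "bulk x" and k = "budget x"] assms
    unfolding order_def edges_def colors_eq by (auto simp: bulk_def)
  then show "\<not> solvable_within adjacent_swap 3 {..<order x} (edges x) colors (budget x)"
    unfolding solvable_within_def using adjacent_swaps_imp_swaps by blast
qed

lemma Swap_PromiseI:
  assumes "planar {..<n} E" "swap_promise 3 {..<n} E c k"
  shows "solvable_within step 3 {..<n} E c k \<Longrightarrow> encode_instance n E c k \<in> fst (Swap_Promise step planar 3)"
    "\<not> solvable_within step 3 {..<n} E c k \<Longrightarrow> encode_instance n E c k \<in> snd (Swap_Promise step planar 3)"
  unfolding Swap_Promise_def fst_conv snd_conv mem_Collect_eq using assms by (intro exI conjI; simp)+

lemmas reduce_mem = Swap_PromiseI[OF promise_reduce, folded reduce_def]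

section \<open>Polynomial-time computability of the reduction\<close>

lemma cmp_time: "cmp k (\<lambda>x e. time x)"
  unfolding time_def by (intro cmp_add cmp_poly cmp_length)

lemma cmp_wit: "cmp k (\<lambda>x e. wit x)"
  unfolding wit_def by (intro cmp_poly cmp_length)

lemma cmp_width: "cmp k (\<lambda>x e. width x)"
  unfolding width_def by (intro cmp_time cmp_intros)

lemma cmp_facts: "cmp k (\<lambda>x e. facts x)"
  unfolding facts_def by (intro cmp_width cmp_intros)

lemma cmp_rows: "cmp k (\<lambda>x e. rows x)"
  unfolding rows_def horn_size_def by (intro cmp_facts cmp_intros)

lemma cmp_budget: "cmp k (\<lambda>x e. budget x)"
  unfolding budget_def by (intro cmp_rows cmp_intros)

lemma cmp_bulk: "cmp k (\<lambda>x e. bulk x)"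
  unfolding bulk_def by (intro cmp_budget cmp_intros)

lemma cmp_order: "cmp k (\<lambda>x e. order x)"
  unfolding order_def grid_graph.NV_def grid_graph.C_def by (intro cmp_rows cmp_bulk cmp_intros)

lemma cmpb_ini:
  assumes F: "cmp k F"
  shows "cmpb k (\<lambda>x e. ini x (F x e))"
proof -
  note kd = cmpb_kind[OF F ks_pos]
  show ?thesis
    unfolding ini_def comp_init_def input_symbol_def[symmetric]
    by (intro cmp_input_symbol cmp_time cmp_wit cmp_width kd[of "\<lambda>a. a = St 0 []"]
        kd[of "\<lambda>a. \<exists>\<tau><num_tapes Ver. a = Hd \<tau>"] kd[of "\<lambda>a. a = Cl 0 0"] kd[of "\<lambda>a. a = Cl 0 1"]
        kd[of "\<lambda>a. a = Cl 0 2"] kd[of "\<lambda>a. \<exists>\<tau><num_tapes Ver. 2 \<le> \<tau> \<and> a = Cl \<tau> 0"]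
        kd[of "\<lambda>a. a = Cl 1 0"] cmp_intros F)
qed

lemma cmpb_cpl:
  assumes F: "cmp k F" and G: "cmp k G"
  shows "cmpb k (\<lambda>x e. cpl x (F x e) (G x e))"
proof -
  note kF = cmpb_kind[OF F ks_pos] and kG = cmpb_kind[OF G ks_pos]
  show ?thesis
    unfolding cpl_def comp_compl_def
    by (intro cmp_time cmp_wit cmp_width kF[of "\<lambda>a. a = Cl 1 0"] kG[of "\<lambda>a. a = Nb"]
        kF[of "\<lambda>a. a = On"] kG[of "\<lambda>a. a = Off"] cmp_intros F G)
qed

lemma cmpb_rul:
  assumes F: "cmp k F" and G: "cmp k G" and H: "cmp k H"
  shows "cmpb k (\<lambda>x e. rul x (F x e) (G x e) (H x e))"
proof -
  note kd = cmpb_kind3[OF F G H ks_pos]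
  show ?thesis
    unfolding rul_def comp_rule_def
    by (intro cmp_time cmp_width kd[of read_rule] kd[of collect_rule] kd[of "state_rule Ver"]
        kd[of "move_rule Ver Stay"] kd[of "move_rule Ver Move_Right"] kd[of "move_rule Ver Move_Left"]
        kd[of "write_rule Ver"] kd[of keep_rule] kd[of guess_rule] kd[of blank_rule] kd[of reject_rule]
        cmp_intros F G H)
qed

lemma cmpb_adj:
  "cmp k F \<Longrightarrow> cmp k G \<Longrightarrow> cmpb k (\<lambda>x e. adj x (F x e) (G x e))"
  unfolding adj_def by (rule cmpb_horn_adj[OF cmp_facts _ _ cmpb_ini cmpb_cpl cmpb_rul])

text \<open>\<open>link\<close> finds an edge only from the end that belongs to its cell, while the
  adjacency matrix needs it in both directions.\<close>

definition joined :: "bool list \<Rightarrow> nat \<Rightarrow> nat \<Rightarrow> bool" where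
  "joined x u v \<longleftrightarrow> grid_graph.link (rows x) (bulk x) (adj x) u v \<or> grid_graph.link (rows x) (bulk x) (adj x) v u"

lemma cmpb_joined:
  "cmp k F \<Longrightarrow> cmp k G \<Longrightarrow> cmpb k (\<lambda>x e. joined x (F x e) (G x e))"
  unfolding joined_def by (intro cmpb_disj cmpb_link[OF cmp_rows cmp_bulk _ _ cmpb_adj])

lemma joined_iff: "u < order x \<Longrightarrow> v < order x \<Longrightarrow> joined x u v \<longleftrightarrow> {u, v} \<in> edges x"
  unfolding joined_def edges_def order_def grid_graph.E_def by (auto simp: doubleton_eq_iff)

lemma colors_range: "colors v \<in> {1..3}"
  using grid.rot_range[OF grid grid.init_core_range[OF grid], of "v div 3" "v mod 3"]
  unfolding colors_def grid.init_core_def[OF grid] .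

lemma cmp_colors:
  assumes F: "cmp k F"
  shows "cmp k (\<lambda>x e. colors (F x e))"
proof -
  have m: "colors (v mod 39) = colors v" for v
    using mod_mult2_eq[of v 3 13] by (simp add: colors_def)
  have "cmp k (\<lambda>x e. F x e mod 39)" by (intro cmp_intros F)
  have "cmp k (\<lambda>x e. if colors (F x e mod 39) = 1 then 1 else if colors (F x e mod 39) = 2 then 2 else 3)"
    by (intro cmp_if cmp_const cmpb_finite[OF \<open>cmp k (\<lambda>x e. F x e mod 39)\<close>, of 39 "\<lambda>z. colors z = 1"]
        cmpb_finite[OF \<open>cmp k (\<lambda>x e. F x e mod 39)\<close>, of 39 "\<lambda>z. colors z = 2"]) simp_all
  then show ?thesis
  proof (rule cmp_cong)
    fix x e
    have "colors (F x e) = 1 \<or> colors (F x e) = 2 \<or> colors (F x e) = 3"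
      using colors_range[of "F x e"] by auto
    then show "(if colors (F x e mod 39) = 1 then 1 else if colors (F x e mod 39) = 2 then 2 else 3) = colors (F x e)"
      unfolding m by auto
  qed
qed

theorem poly_time_reduce: "poly_time 1 (\<lambda>xs. reduce (xs ! 0))"
proof -
  define S where "S x i = instance_symbol (order x) (joined x) colors (budget x) i" for x i
  have "poly_time 1 (\<lambda>xs. concat (map (\<lambda>i. emit (S (xs ! 0) i)) [0..<instance_length (order (xs ! 0)) (budget (xs ! 0))]))"
  proof (rule poly_time_emit)
    show "cmp 0 (\<lambda>x e. instance_length (order x) (budget x))"
      unfolding instance_length_def by (intro cmp_order cmp_budget cmp_intros)
    show "cmp 1 (\<lambda>x e. S x (e ! 0))"
      unfolding S_def
      by (rule cmp_instance_symbol[OF cmp_order cmp_budget cmp_nth cmpb_joined cmp_colors]) simp_all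
    show "S x i \<le> 2" for x i unfolding S_def by (rule instance_symbol_le)
  qed
  moreover have "concat (map (\<lambda>i. emit (S x i)) [0..<instance_length (order x) (budget x)]) = reduce x" for x
    unfolding S_def reduce_def
  proof (rule emit_instance)
    show "0 < order x" by (simp add: order_def grid_graph.NV_def grid_graph.C_def)
    show "joined x i j \<longleftrightarrow> {i, j} \<in> edges x" if "i < order x" "j < order x" for i j
      using joined_iff[OF that] .
    show "colors i \<le> 3" for i using colors_range[of i] by simp
  qed
  ultimately show ?thesis by simp
qed

end

lemma accepts_at:
  assumes "tm_outputs_within M [x, w] s [b]" "s \<le> t" "1 \<le> num_tapes M" "wf_tm M"
  shows "fst (snd (conf M x w t) ! 0) 0 = 2 \<longleftrightarrow> b"
proof -
  obtain ts where ts: "(tm_step M ^^ s) (tm_init M [x, w]) = (num_states M, ts)" "tape_output (hd ts) [b]"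
    using assms(1) by (auto simp: tm_outputs_within_def)
  have "(tm_step M ^^ t) (tm_init M [x, w]) = (num_states M, ts)"
    by (rule funpow_stays[OF ts(1) _ assms(2)]) simp
  then have c: "conf M x w t = (num_states M, ts)" by (simp add: conf_def)
  have "length ts = num_tapes M" using good_conf_conf[OF assms(4), of x w t] c by (simp add: good_conf_def)
  then have "hd ts = ts ! 0" using assms(3) by (intro hd_conv_nth) auto
  then have "fst (ts ! 0) 0 = bit_symbol b" using ts(2) by (auto simp: tape_output_def)
  then show ?thesis using c by (simp add: bit_symbol_def)
qed

text \<open>One function serves both kinds of swaps: solvability is shown with adjacent swaps, which
  are swaps, and unsolvability for arbitrary swaps, hence also for adjacent ones.\<close>

lemma NP_reduction:
  assumes "L \<in> NP"
  shows "\<exists>f. poly_time 1 (\<lambda>xs. f (xs ! 0)) \<and>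
    (\<forall>x. x \<in> L \<longrightarrow> f x \<in> fst (Swap_Promise swap planar 3) \<and> f x \<in> fst (Swap_Promise adjacent_swap planar 3)) \<and>
    (\<forall>x. x \<notin> L \<longrightarrow> f x \<in> snd (Swap_Promise swap planar 3) \<and> f x \<in> snd (Swap_Promise adjacent_swap planar 3))"
proof -
  obtain R and Q :: "nat poly" where R: "poly_time 2 (\<lambda>xs. [R (xs ! 0) (xs ! 1)])"
    and L: "\<And>x. x \<in> L \<longleftrightarrow> (\<exists>w. length w \<le> poly Q (length x) \<and> R x w)"
    using assms by (auto simp: NP_def)
  obtain Ver and P :: "nat poly" where Ver: "wf_tm Ver" "2 \<le> num_tapes Ver"
    and out: "\<And>xs. length xs = 2 \<Longrightarrow> tm_outputs_within Ver xs (poly P (\<Sum>x\<leftarrow>xs. length x)) [R (xs ! 0) (xs ! 1)]"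
    using R by (auto simp: poly_time_def)
  obtain l where l: "set l = kinds Ver" using finite_list[OF finite_kinds] by blast
  \<comment> \<open>\<open>Rejected\<close> is put in front so that its fact receives code 0; that
    it occurs again in \<open>l\<close> is harmless.\<close>
  have ks: "set (Rejected # l) = kinds Ver" using l kinds_iff(5) by auto
  interpret proper_reduction Ver "Rejected # l" P Q
    by unfold_locales (use Ver ks in auto)
  have acc: "fst (snd (conf Ver x w (time x)) ! 0) 0 = 2 \<longleftrightarrow> R x w" if "length w \<le> wit x" for x w
  proof (rule accepts_at)
    show "tm_outputs_within Ver [x, w] (poly P (length x + length w)) [R x w]"
      using out[of "[x, w]"] by simp
    show "poly P (length x + length w) \<le> time x"
      using poly_nat_mono[of "length x + length w" "length x + poly Q (length x)" P] that
      by (simp add: time_def wit_def)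
  qed (use Ver in auto)
  have "x \<in> L \<longleftrightarrow> grid.satisfiable (adj x)" for x
    unfolding satisfiable_iff L using acc unfolding wit_def by blast
  then show ?thesis
    using poly_time_reduce reduce_mem(1)[OF solvable_reduce(2)] reduce_mem(1)[OF solvable_reduce(1)]
      reduce_mem(2)[OF unsolvable_reduce(1)] reduce_mem(2)[OF unsolvable_reduce(2)]
    by (intro exI[of _ reduce] conjI allI impI) simp_all
qed

theorem theorem5:
  "NP_hard (Swap_Promise swap planar 3) \<and> NP_hard (Swap_Promise adjacent_swap planar 3)"
proof (unfold NP_hard_def, intro conjI ballI)
  fix L assume "L \<in> NP"
  then show "\<exists>f. poly_time 1 (\<lambda>xs. f (xs ! 0)) \<and> (\<forall>x. x \<in> L \<longrightarrow> f x \<in> fst (Swap_Promise swap planar 3)) \<and>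
      (\<forall>x. x \<notin> L \<longrightarrow> f x \<in> snd (Swap_Promise swap planar 3))"
    by (rule exE[OF NP_reduction]) (intro exI conjI, auto)
next
  fix L assume "L \<in> NP"
  then show "\<exists>f. poly_time 1 (\<lambda>xs. f (xs ! 0)) \<and> (\<forall>x. x \<in> L \<longrightarrow> f x \<in> fst (Swap_Promise adjacent_swap planar 3)) \<and>
      (\<forall>x. x \<notin> L \<longrightarrow> f x \<in> snd (Swap_Promise adjacent_swap planar 3))"
    by (rule exE[OF NP_reduction]) (intro exI conjI, auto)
qed

end
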